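(* Let $d$ be a prime and let $T:\mathcal{B}(\mathbb{C}^d)\to\mathcal{B}(\mathbb{C}^d)$ be a channel. Suppose that for some $0<\varepsilon<1/2$, $$\|\mathrm{id}-T\|_{cb}<2^{-H_2(\varepsilon)/\varepsilon}.$$ Then $$Q(T)\ge(1-4\varepsilon)\log_2 d-H_2(2\varepsilon),$$ where $H_2(r)=-r\log_2r-(1-r)\log_2(1-r)$.
   Context: A channel from input space $\mathcal{H}_1$ to output space $\mathcal{H}_2$ (finite dimensional) is a completely positive unital linear map $T:\mathcal{B}(\mathcal{H}_2)\to\mathcal{B}(\mathcal{H}_1)$. The cb-norm of a linear map $S:\mathcal{B}(\mathcal{K}_2)\to\mathcal{B}(\mathcal{K}_1)$ is $\|S\|_{cb}=\sup\{\|(S\otimes\mathrm{id}_{\mathcal{B}(\mathbb{C}^k)})(A)\|:k\in\mathbb{N},\ A\in\mathcal{B}(\mathcal{K}_2\otimes\mathbb{C}^k),\ \|A\|\le1\}$. For a positive integer $M$, $\Delta(T,M)=\inf_{E,D}\|ETD-\mathrm{id}_{\mathcal{B}(\mathcal{H}_0)}\|_{cb}$, with $\dim\mathcal{H}_0=M$ and the infimum over all channels $D:\mathcal{B}(\mathcal{H}_0)\to\mathcal{B}(\mathcal{H}_2)$ and $E:\mathcal{B}(\mathcal{H}_1)\to\mathcal{B}(\mathcal{H}_0)$. A number $c\ge0$ is an achievable rate if $\lim_{n\to\infty}\Delta(T^{\otimes n},\lfloor2^{cn}\rfloor)=0$, and the quantum capacity $Q(T)$ is the supremum of all achievable rates ($Q(T)=\infty$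 if every $c$ is achievable). *)

theory Defs
  imports Complex_Main "Jordan_Normal_Form.Matrix" "HOL-Computational_Algebra.Primes"
    "HOL-Library.Extended_Real"
begin

(* Operators on C^n are n x n complex matrices.  A map S : B(C^n2) -> B(C^n1) is a
   function on complex matrices; only its values on n2 x n2 matrices matter.
   Tensor products C^a (x) C^b = C^(a*b) use the index convention (i,k) |-> i*b + k. *)

definition vnorm :: "complex vec \<Rightarrow> real" where
  "vnorm v = sqrt (\<Sum>i<dim_vec v. (cmod (v $ i))^2)"

definition opnorm :: "nat \<Rightarrow> complex mat \<Rightarrow> real" where
  "opnorm n M = Sup {vnorm (mult_mat_vec M v) | v. v \<in> carrier_vec n \<and> vnorm v \<le> 1}"

definition psd :: "nat \<Rightarrow> complex mat \<Rightarrow> bool" where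
  "psd n M \<longleftrightarrow> M \<in> carrier_mat n n \<and>
     (\<forall>v \<in> carrier_vec n. let z = (\<Sum>i<n. cnj (v $ i) * (mult_mat_vec M v) $ i)
                            in Im z = 0 \<and> Re z \<ge> 0)"

definition lin_map :: "nat \<Rightarrow> nat \<Rightarrow> (complex mat \<Rightarrow> complex mat) \<Rightarrow> bool" where
  "lin_map n1 n2 S \<longleftrightarrow>
     (\<forall>A \<in> carrier_mat n2 n2. S A \<in> carrier_mat n1 n1) \<and>
     (\<forall>A \<in> carrier_mat n2 n2. \<forall>B \<in> carrier_mat n2 n2. S (A + B) = S A + S B) \<and>
     (\<forall>A \<in> carrier_mat n2 n2. \<forall>c. S (smult_mat c A) = smult_mat c (S A))"

definition munit :: "nat \<Rightarrow> nat \<Rightarrow> nat \<Rightarrow> complex mat" where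
  "munit n i j = mat n n (\<lambda>(r,c). if r = i \<and> c = j then 1 else 0)"

definition kron :: "complex mat \<Rightarrow> complex mat \<Rightarrow> complex mat" where
  "kron X Y = mat (dim_row X * dim_row Y) (dim_col X * dim_col Y)
     (\<lambda>(r,c). X $$ (r div dim_row Y, c div dim_col Y) * Y $$ (r mod dim_row Y, c mod dim_col Y))"

(* tensor product S1 (x) S2 : B(C^b1 (x) C^b2) -> B(C^a1 (x) C^a2) of
   S1 : B(C^b1) -> B(C^a1) and S2 : B(C^b2) -> B(C^a2), defined by linear extension *)
definition tensor_map :: "nat \<Rightarrow> nat \<Rightarrow> nat \<Rightarrow> nat \<Rightarrow>
    (complex mat \<Rightarrow> complex mat) \<Rightarrow> (complex mat \<Rightarrow> complex mat) \<Rightarrow> complex mat \<Rightarrow> complex mat" where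
  "tensor_map a1 b1 a2 b2 S1 S2 A = mat (a1 * a2) (a1 * a2) (\<lambda>(r,c).
     (\<Sum>i<b1. \<Sum>j<b1. \<Sum>k<b2. \<Sum>l<b2.
        A $$ (i * b2 + k, j * b2 + l) * kron (S1 (munit b1 i j)) (S2 (munit b2 k l)) $$ (r,c)))"

definition ampl :: "nat \<Rightarrow> nat \<Rightarrow> nat \<Rightarrow> (complex mat \<Rightarrow> complex mat) \<Rightarrow> complex mat \<Rightarrow> complex mat" where
  "ampl n1 n2 k S = tensor_map n1 n2 k k S (\<lambda>X. X)"

definition completely_positive :: "nat \<Rightarrow> nat \<Rightarrow> (complex mat \<Rightarrow> complex mat) \<Rightarrow> bool" where
  "completely_positive n1 n2 S \<longleftrightarrow>
     (\<forall>k\<ge>1. \<forall>A. psd (n2 * k) A \<longrightarrow> psd (n1 * k) (ampl n1 n2 k S A))"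

(* channel T : B(C^n2) -> B(C^n1) (Heisenberg picture): linear, CP, unital *)
definition channel :: "nat \<Rightarrow> nat \<Rightarrow> (complex mat \<Rightarrow> complex mat) \<Rightarrow> bool" where
  "channel n1 n2 T \<longleftrightarrow> lin_map n1 n2 T \<and> completely_positive n1 n2 T \<and> T (one_mat n2) = one_mat n1"

definition cb_norm :: "nat \<Rightarrow> nat \<Rightarrow> (complex mat \<Rightarrow> complex mat) \<Rightarrow> real" where
  "cb_norm n1 n2 S = Sup {opnorm (n1 * k) (ampl n1 n2 k S A) | k A.
      k \<ge> 1 \<and> A \<in> carrier_mat (n2 * k) (n2 * k) \<and> opnorm (n2 * k) A \<le> 1}"

fun tensor_pow :: "nat \<Rightarrow> (complex mat \<Rightarrow> complex mat) \<Rightarrow> nat \<Rightarrow> complex mat \<Rightarrow> complex mat" where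
  "tensor_pow d T 0 = (\<lambda>X. X)"
| "tensor_pow d T (Suc n) = tensor_map (d ^ n) (d ^ n) d d (tensor_pow d T n) T"

definition Delta :: "nat \<Rightarrow> nat \<Rightarrow> (complex mat \<Rightarrow> complex mat) \<Rightarrow> nat \<Rightarrow> real" where
  "Delta n1 n2 T M = Inf {cb_norm M M (\<lambda>X. E (T (D X)) - X) | E D.
      channel n2 M D \<and> channel M n1 E}"

definition achievable_rate :: "nat \<Rightarrow> (complex mat \<Rightarrow> complex mat) \<Rightarrow> real \<Rightarrow> bool" where
  "achievable_rate d T c \<longleftrightarrow> c \<ge> 0 \<and>
     (\<lambda>n. Delta (d ^ n) (d ^ n) (tensor_pow d T n) (nat \<lfloor>2 powr (c * real n)\<rfloor>)) \<longlonglongrightarrow> 0"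

(* quantum capacity (infinite iff every rate is achievable) *)
definition quantum_capacity :: "nat \<Rightarrow> (complex mat \<Rightarrow> complex mat) \<Rightarrow> ereal" where
  "quantum_capacity d T = Sup (ereal ` {c. achievable_rate d T c})"

definition H2 :: "real \<Rightarrow> real" where
  "H2 r = - r * log 2 r - (1 - r) * log 2 (1 - r)"

end

theory Submission
  imports Defs "HOL-Analysis.L2_Norm" "HOL-Library.FuncSet" "HOL-Number_Theory.Cong"
begin

text \<open>
  Write \<open>T = id + R\<close>, so that the \<open>n\<close>-th tensor power of \<open>T\<close> is the sum over all \<open>S \<subseteq> {..<n}\<close> of the maps
  \<open>F S\<close> acting as \<open>R\<close> on the sites in \<open>S\<close> and as the identity elsewhere.  A code correcting every
  error on at most \<open>e = \<epsilon> n\<close> sites reduces \<open>F S\<close> with \<open>0 < card S \<le> e\<close> to a multiple of the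
  identity, and this multiple is \<open>0\<close> because \<open>R 1 = 0\<close>.  The remaining sets contribute at most
  the sum of \<open>\<parallel>R\<parallel> ^ card S\<close> over \<open>card S > e\<close>, which the Chernoff bound makes exponentially small.

  The codes come from the graph basis \<open>d\<^sup>-\<^sup>n\<^sup>/\<^sup>2 \<Sum>x \<omega>\<^bsup>q(x) + u x\<^esup> |x>\<close>, where \<open>q\<close> is the quadratic form of
  a graph with adjacency matrix \<open>G\<close> over the integers mod \<open>d\<close>.  The Weyl operator with label \<open>(a,b)\<close> moves the basis vector \<open>u\<close>
  to \<open>u + b - G a\<close> up to a phase.  Hence codewords \<open>u\<^sub>p\<close> span a pure code as soon as no difference
  \<open>u\<^sub>q - u\<^sub>p\<close> equals a syndrome \<open>b - G a\<close> of weight at most \<open>2 e\<close>: a union bound over graphs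
  handles \<open>p = q\<close>, a greedy choice \<open>p \<noteq> q\<close>.
\<close>

section \<open>Operator bounds for kernels\<close>

text \<open>The two entropies come from two separate counts. The difference of two correctable
  errors has weight at most \<open>2 * e\<close>, so about \<open>2 powr (n * H2 (2 * \<epsilon>)) *
  d powr (4 * \<epsilon> * n)\<close> labels matter: a choice of up to
  \<open>2 * \<epsilon> * n\<close> sites with \<open>d * d\<close> Weyl labels on each. Codewords
  can be added while their number times this count stays below \<open>d ^ n\<close>, up to a factor
  2; hence the rate. The hypothesis on the cb-norm is what makes the base
  \<open>2 powr H2 \<epsilon> * \<delta> powr \<epsilon>\<close> of the tail bound smaller than 1
  for some \<open>\<delta>\<close> above the norm.

  Norms are estimated through sesquilinear forms over arbitrary index sets. A bound that tolerates
  every ancilla lets a map on one tensor factor treat the other factors as part of its ancilla; with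
  product types as indices this regrouping is a mere bijection, and arithmetic with
  \<open>div\<close> and \<open>mod\<close> enters only on the way back to matrices.

  If the claimed bound is not positive, no error correction is needed: a one-dimensional code has
  rate 0 and no error.\<close>

definition l2norm :: "'a set \<Rightarrow> ('a \<Rightarrow> complex) \<Rightarrow> real" where
  "l2norm I v = L2_set (\<lambda>i. cmod (v i)) I"

definition sesq_form :: "'a set \<Rightarrow> ('a \<Rightarrow> complex) \<Rightarrow> ('a \<Rightarrow> 'a \<Rightarrow> complex) \<Rightarrow> ('a \<Rightarrow> complex) \<Rightarrow> complex" where
  "sesq_form I w A v = (\<Sum>i\<in>I. \<Sum>j\<in>I. cnj (w i) * A i j * v j)"

text \<open>The weak form of an operator norm bound. It adds up along sums of kernels and, unlike
  \<open>opnorm\<close>, is available over any index type, in particular over products.\<close>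

definition op_bounded :: "'a set \<Rightarrow> ('a \<Rightarrow> 'a \<Rightarrow> complex) \<Rightarrow> real \<Rightarrow> bool" where
  "op_bounded I A c \<longleftrightarrow> (\<forall>w v. cmod (sesq_form I w A v) \<le> c * l2norm I w * l2norm I v)"

text \<open>A linear map \<open>S\<close> on matrices is represented by its coefficients
  \<open>s r c p q\<close>, the \<open>(r,c)\<close> entry of \<open>S\<close> applied to the \<open>(p,q)\<close> matrix unit.  The following is the action of
  \<open>S \<otimes> id\<close> in these terms, for an arbitrary ancilla index type.\<close>

definition ampl_kernel :: "'j set \<Rightarrow> ('i \<Rightarrow> 'i \<Rightarrow> 'j \<Rightarrow> 'j \<Rightarrow> complex) \<Rightarrow>
    ('j \<times> 'k \<Rightarrow> 'j \<times> 'k \<Rightarrow> complex) \<Rightarrow> 'i \<times> 'k \<Rightarrow> 'i \<times> 'k \<Rightarrow> complex" where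
  "ampl_kernel J s A = (\<lambda>(r,x) (c,y). \<Sum>p\<in>J. \<Sum>q\<in>J. s r c p q * A (p,x) (q,y))"

text \<open>A definition cannot quantify over ancilla types, so the ancilla is a finite set of
  naturals; \<open>cbbD\<close> lifts this restriction. The scale \<open>c\<close> is built in so
  that bounds compose without normalising \<open>A\<close>.\<close>

definition cb_bounded :: "'i set \<Rightarrow> 'j set \<Rightarrow> ('i \<Rightarrow> 'i \<Rightarrow> 'j \<Rightarrow> 'j \<Rightarrow> complex) \<Rightarrow> real \<Rightarrow> bool" where
  "cb_bounded I J s \<delta> \<longleftrightarrow> (\<forall>(K::nat set) A c. finite K \<and> c > 0 \<and> op_bounded (J \<times> K) A c
      \<longrightarrow> op_bounded (I \<times> K) (ampl_kernel J s A) (\<delta> * c))"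

definition pair_tensor :: "('i \<Rightarrow> 'i \<Rightarrow> 'j \<Rightarrow> 'j \<Rightarrow> complex) \<Rightarrow> ('k \<Rightarrow> 'k \<Rightarrow> 'l \<Rightarrow> 'l \<Rightarrow> complex) \<Rightarrow>
    'i \<times> 'k \<Rightarrow> 'i \<times> 'k \<Rightarrow> 'j \<times> 'l \<Rightarrow> 'j \<times> 'l \<Rightarrow> complex" where
  "pair_tensor s1 s2 = (\<lambda>(r,r') (c,c') (p,p') (q,q'). s1 r c p q * s2 r' c' p' q')"

lemma sum_swap_pairs:
  fixes f :: "_ \<Rightarrow> _ \<Rightarrow> _ \<Rightarrow> _ \<Rightarrow> 'z::comm_monoid_add"
  shows "(\<Sum>x\<in>A. \<Sum>y\<in>B. \<Sum>p\<in>C. \<Sum>q\<in>D. f x y p q) = (\<Sum>p\<in>C. \<Sum>q\<in>D. \<Sum>x\<in>A. \<Sum>y\<in>B. f x y p q)"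
  using sum.swap[of "\<lambda>u v. f (fst u) (snd u) (fst v) (snd v)" "C \<times> D" "A \<times> B"]
  unfolding sum.cartesian_product' by simp

lemma sum_swap_inner:
  fixes f :: "_ \<Rightarrow> _ \<Rightarrow> _ \<Rightarrow> 'z::comm_monoid_add"
  shows "(\<Sum>x\<in>A. \<Sum>y\<in>B. \<Sum>t\<in>T. f x y t) = (\<Sum>t\<in>T. \<Sum>x\<in>A. \<Sum>y\<in>B. f x y t)"
  using sum.swap[of "\<lambda>u t. f (fst u) (snd u) t" T "A \<times> B"]
  unfolding sum.cartesian_product' by simp

lemma l2norm_nonneg [simp]: "0 \<le> l2norm I v"
  by (simp add: l2norm_def)

lemma l2norm_power2: "(l2norm I v)\<^sup>2 = (\<Sum>i\<in>I. (cmod (v i))\<^sup>2)"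
  by (simp add: l2norm_def L2_set_def sum_nonneg)

lemma l2norm_cong: "(\<And>i. i \<in> I \<Longrightarrow> v i = w i) \<Longrightarrow> l2norm I v = l2norm I w"
  by (simp add: l2norm_def L2_set_def)

lemma l2norm_reindex: "bij_betw f I I' \<Longrightarrow> l2norm I' v = l2norm I (\<lambda>i. v (f i))"
  unfolding l2norm_def L2_set_def by (subst sum.reindex_bij_betw [symmetric, of f I I']) auto

lemma sesq_form_cong:
  assumes "\<And>i. i \<in> I \<Longrightarrow> w i = w' i" "\<And>i. i \<in> I \<Longrightarrow> v i = v' i"
    "\<And>i j. i \<in> I \<Longrightarrow> j \<in> I \<Longrightarrow> A i j = A' i j"
  shows "sesq_form I w A v = sesq_form I w' A' v'"
  unfolding sesq_form_def using assms by (intro sum.cong) auto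

lemma op_bounded_cong:
  assumes "\<And>i j. i \<in> I \<Longrightarrow> j \<in> I \<Longrightarrow> A i j = A' i j"
  shows "op_bounded I A c = op_bounded I A' c"
  unfolding op_bounded_def using sesq_form_cong[of I _ _ _ _ A A', OF refl refl assms] by auto

lemma sesq_form_reindex:
  assumes "bij_betw f I I'"
  shows "sesq_form I' w A v = sesq_form I (\<lambda>i. w (f i)) (\<lambda>i j. A (f i) (f j)) (\<lambda>i. v (f i))"
proof -
  have "sesq_form I' w A v = (\<Sum>i\<in>I. \<Sum>j\<in>I'. cnj (w (f i)) * A (f i) j * v j)"
    unfolding sesq_form_def by (rule sum.reindex_bij_betw [OF assms, symmetric])
  also have "\<dots> = (\<Sum>i\<in>I. \<Sum>j\<in>I. cnj (w (f i)) * A (f i) (f j) * v (f j))"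
    by (rule sum.cong[OF refl], rule sum.reindex_bij_betw [OF assms, symmetric])
  finally show ?thesis by (simp add: sesq_form_def)
qed

lemma op_bounded_reindex:
  assumes "bij_betw f I I'"
  shows "op_bounded I' A c \<longleftrightarrow> op_bounded I (\<lambda>i j. A (f i) (f j)) c"
proof
  assume "op_bounded I (\<lambda>i j. A (f i) (f j)) c"
  then show "op_bounded I' A c"
    unfolding op_bounded_def sesq_form_reindex[OF assms] l2norm_reindex[OF assms] by blast
next
  assume *: "op_bounded I' A c"
  show "op_bounded I (\<lambda>i j. A (f i) (f j)) c"
    unfolding op_bounded_def
  proof (intro allI)
    fix w v :: "'a \<Rightarrow> complex"
    let ?g = "inv_into I f"
    have g: "?g (f i) = i" if "i \<in> I" for i
      using assms that by (auto simp: bij_betw_def)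
    have "cmod (sesq_form I' (\<lambda>i. w (?g i)) A (\<lambda>i. v (?g i))) \<le> c * l2norm I' (\<lambda>i. w (?g i)) * l2norm I' (\<lambda>i. v (?g i))"
      using * by (auto simp: op_bounded_def)
    moreover have "sesq_form I' (\<lambda>i. w (?g i)) A (\<lambda>i. v (?g i)) = sesq_form I w (\<lambda>i j. A (f i) (f j)) v"
      unfolding sesq_form_reindex[OF assms] by (intro sesq_form_cong) (auto simp: g)
    moreover have "l2norm I' (\<lambda>i. u (?g i)) = l2norm I u" for u
      unfolding l2norm_reindex[OF assms] by (intro l2norm_cong) (auto simp: g)
    ultimately show "cmod (sesq_form I w (\<lambda>i j. A (f i) (f j)) v) \<le> c * l2norm I w * l2norm I v"
      by simp
  qed
qed

lemma op_bounded_mono: "op_bounded I A c \<Longrightarrow> c \<le> c' \<Longrightarrow> op_bounded I A c'"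
  unfolding op_bounded_def by (meson l2norm_nonneg mult_right_mono order_trans)

lemma op_bounded_scale:
  assumes "op_bounded I A c" shows "op_bounded I (\<lambda>i j. z * A i j) (cmod z * c)"
proof -
  have "sesq_form I w (\<lambda>i j. z * A i j) v = z * sesq_form I w A v" for w v
    by (simp add: sesq_form_def sum_distrib_left algebra_simps)
  then show ?thesis using assms
    by (auto simp: op_bounded_def norm_mult mult.assoc intro!: mult_left_mono)
qed

lemma op_bounded_sum:
  assumes "finite T" "\<And>t. t \<in> T \<Longrightarrow> op_bounded I (A t) (c t)"
  shows "op_bounded I (\<lambda>i j. \<Sum>t\<in>T. A t i j) (\<Sum>t\<in>T. c t)"
  unfolding op_bounded_def
proof (intro allI)
  fix w v
  have "sesq_form I w (\<lambda>i j. \<Sum>t\<in>T. A t i j) v = (\<Sum>i\<in>I. \<Sum>j\<in>I. \<Sum>t\<in>T. cnj (w i) * A t i j * v j)"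
    by (simp add: sesq_form_def sum_distrib_left sum_distrib_right)
  also have "\<dots> = (\<Sum>t\<in>T. sesq_form I w (A t) v)"
    unfolding sesq_form_def by (rule sum_swap_inner)
  finally have "cmod (sesq_form I w (\<lambda>i j. \<Sum>t\<in>T. A t i j) v) \<le> (\<Sum>t\<in>T. cmod (sesq_form I w (A t) v))"
    by (simp add: norm_sum)
  also have "\<dots> \<le> (\<Sum>t\<in>T. c t * l2norm I w * l2norm I v)"
    using assms(2) by (intro sum_mono) (auto simp: op_bounded_def)
  finally show "cmod (sesq_form I w (\<lambda>i j. \<Sum>t\<in>T. A t i j) v) \<le> (\<Sum>t\<in>T. c t) * l2norm I w * l2norm I v"
    by (simp add: sum_distrib_right)
qed

lemma ampl_kernel_reindex_right:
  "ampl_kernel J s A (r, h x) (c, h y) = ampl_kernel J s (\<lambda>i j. A (map_prod id h i) (map_prod id h j)) (r,x) (c,y)"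
  by (simp add: ampl_kernel_def)

text \<open>A finite ancilla of any type is in bijection with an initial segment of the
  naturals.\<close>

lemma cbbD:
  assumes "cb_bounded I J s \<delta>" "finite K" "c > 0" "op_bounded (J \<times> K) A c"
  shows "op_bounded (I \<times> K) (ampl_kernel J s A) (\<delta> * c)"
proof -
  obtain h where h: "bij_betw h {0..<card K} K"
    using ex_bij_betw_nat_finite[OF assms(2)] by auto
  have b: "bij_betw (map_prod id h) (X \<times> {0..<card K}) (X \<times> K)" for X
    by (rule bij_betw_map_prod) (auto simp: h)
  have "op_bounded (I \<times> {0..<card K}) (ampl_kernel J s (\<lambda>i j. A (map_prod id h i) (map_prod id h j))) (\<delta> * c)"
    using assms by (auto simp: cb_bounded_def op_bounded_reindex[OF b, symmetric])
  then have "op_bounded (I \<times> {0..<card K}) (\<lambda>i j. ampl_kernel J s A (map_prod id h i) (map_prod id h j)) (\<delta> * c)"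
    by (subst op_bounded_cong) (auto simp: ampl_kernel_reindex_right)
  then show ?thesis by (simp only: op_bounded_reindex[OF b, symmetric])
qed

lemma cb_bounded_cong:
  assumes "\<And>r c p q. r \<in> I \<Longrightarrow> c \<in> I \<Longrightarrow> p \<in> J \<Longrightarrow> q \<in> J \<Longrightarrow> s r c p q = s' r c p q"
  shows "cb_bounded I J s \<delta> = cb_bounded I J s' \<delta>"
proof -
  have "op_bounded (I \<times> K) (ampl_kernel J s A) c = op_bounded (I \<times> K) (ampl_kernel J s' A) c" for K :: "nat set" and A c
    by (rule op_bounded_cong) (auto simp: ampl_kernel_def assms intro!: sum.cong)
  then show ?thesis by (simp add: cb_bounded_def)
qed

text \<open>Factor the product as \<open>s1\<close> on the first component after \<open>s2\<close>
  on the second. While one of them acts, the other tensor factor is absorbed into the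
  ancilla.\<close>

lemma cb_bounded_tensor:
  fixes I1 :: "'a set" and J1 :: "'b set" and I2 :: "'c set" and J2 :: "'d set"
  assumes "cb_bounded I1 J1 s1 \<delta>1" "cb_bounded I2 J2 s2 \<delta>2" "\<delta>2 > 0"
    and fin: "finite J1" "finite J2" "finite I2"
  shows "cb_bounded (I1 \<times> I2) (J1 \<times> J2) (pair_tensor s1 s2) (\<delta>1 * \<delta>2)"
  unfolding cb_bounded_def
proof (intro allI impI, elim conjE)
  fix K :: "nat set" and A :: "('b \<times> 'd) \<times> nat \<Rightarrow> ('b \<times> 'd) \<times> nat \<Rightarrow> complex" and c :: real
  assume K: "finite K" and c: "c > 0" and A: "op_bounded ((J1 \<times> J2) \<times> K) A c"
  \<comment> \<open>\<open>s2\<close> goes first, with \<open>J1 \<times> K\<close> as its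
    ancilla.\<close>
  define A1 where "A1 = (\<lambda>(p',(p,x)) (q',(q,y)). A ((p,p'),x) ((q,q'),y))"
  have b1: "bij_betw (\<lambda>(p',(p,x)). ((p,p'),x)) (J2 \<times> (J1 \<times> K)) ((J1 \<times> J2) \<times> K)"
    by (rule bij_betwI[where g="\<lambda>((p,p'),x). (p',(p,x))"]) auto
  have "op_bounded (J2 \<times> (J1 \<times> K)) A1 c"
    using A unfolding op_bounded_reindex[OF b1]
    by (subst op_bounded_cong[where A=A1]) (auto simp: A1_def)
  then have A2: "op_bounded (I2 \<times> (J1 \<times> K)) (ampl_kernel J2 s2 A1) (\<delta>2 * c)"
    using fin K c by (intro cbbD[OF assms(2)]) auto
  \<comment> \<open>Regroup for \<open>s1\<close>, whose ancilla is the already transformed factor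
    together with \<open>K\<close>.\<close>
  define A3 where "A3 = (\<lambda>(p,(r',x)) (q,(c',y)). ampl_kernel J2 s2 A1 (r',(p,x)) (c',(q,y)))"
  have b3: "bij_betw (\<lambda>(p,(r',x)). (r',(p,x))) (J1 \<times> (I2 \<times> K)) (I2 \<times> (J1 \<times> K))"
    by (rule bij_betwI[where g="\<lambda>(r',(p,x)). (p,(r',x))"]) auto
  have "op_bounded (J1 \<times> (I2 \<times> K)) A3 (\<delta>2 * c)"
    using A2 unfolding op_bounded_reindex[OF b3]
    by (subst op_bounded_cong[where A=A3]) (auto simp: A3_def)
  then have A4: "op_bounded (I1 \<times> (I2 \<times> K)) (ampl_kernel J1 s1 A3) (\<delta>1 * (\<delta>2 * c))"
    using fin K c assms(3) by (intro cbbD[OF assms(1)]) auto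
  have b5: "bij_betw (\<lambda>(r,(r',x)). ((r,r'),x)) (I1 \<times> (I2 \<times> K)) ((I1 \<times> I2) \<times> K)"
    by (rule bij_betwI[where g="\<lambda>((p,p'),x). (p,(p',x))"]) auto
  have eq: "ampl_kernel (J1 \<times> J2) (pair_tensor s1 s2) A ((r,r'),x) ((c,c'),y) = ampl_kernel J1 s1 A3 (r,(r',x)) (c,(c',y))"
    for r r' x c c' y
  proof -
    have "ampl_kernel J1 s1 A3 (r,(r',x)) (c,(c',y)) =
       (\<Sum>p\<in>J1. \<Sum>q\<in>J1. \<Sum>p'\<in>J2. \<Sum>q'\<in>J2. s1 r c p q * s2 r' c' p' q' * A ((p,p'),x) ((q,q'),y))"
      by (simp add: ampl_kernel_def A3_def A1_def sum_distrib_left mult.assoc)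
    also have "\<dots> = (\<Sum>p\<in>J1. \<Sum>p'\<in>J2. \<Sum>q\<in>J1. \<Sum>q'\<in>J2. s1 r c p q * s2 r' c' p' q' * A ((p,p'),x) ((q,q'),y))"
      by ((rule sum.cong[OF refl])+, rule sum.swap)
    also have "\<dots> = ampl_kernel (J1 \<times> J2) (pair_tensor s1 s2) A ((r,r'),x) ((c,c'),y)"
      by (simp add: ampl_kernel_def pair_tensor_def sum.cartesian_product')
    finally show ?thesis by simp
  qed
  show "op_bounded ((I1 \<times> I2) \<times> K) (ampl_kernel (J1 \<times> J2) (pair_tensor s1 s2) A) (\<delta>1 * \<delta>2 * c)"
    using A4 unfolding op_bounded_reindex[OF b5] mult.assoc
    by (subst op_bounded_cong[where A'="ampl_kernel J1 s1 A3"]) (auto simp: eq mult.assoc)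
qed

lemma cb_bounded_reindex:
  fixes I :: "'a set" and I' :: "'b set" and J :: "'c set" and J' :: "'d set"
  assumes "bij_betw f I I'" "bij_betw g J J'" "cb_bounded I' J' s \<delta>"
  shows "cb_bounded I J (\<lambda>r c p q. s (f r) (f c) (g p) (g q)) \<delta>"
  unfolding cb_bounded_def
proof (intro allI impI, elim conjE)
  fix K :: "nat set" and A :: "'c \<times> nat \<Rightarrow> 'c \<times> nat \<Rightarrow> complex" and c :: real
  assume K: "finite K" and c: "c > 0" and A: "op_bounded (J \<times> K) A c"
  let ?g = "inv_into J g"
  have bg: "bij_betw (map_prod g id) (J \<times> K) (J' \<times> K)" and bf: "bij_betw (map_prod f id) (I \<times> K) (I' \<times> K)"
    using assms by (auto intro: bij_betw_map_prod)
  have g: "?g (g i) = i" if "i \<in> J" for i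
    using assms that by (auto simp: bij_betw_def)
  define B where "B = (\<lambda>i j. A (map_prod ?g id i) (map_prod ?g id j))"
  have "op_bounded (J' \<times> K) B c"
    unfolding op_bounded_reindex[OF bg] using A by (subst op_bounded_cong) (auto simp: B_def g)
  then have "op_bounded (I' \<times> K) (ampl_kernel J' s B) (\<delta> * c)"
    using assms(3) K c by (auto simp: cb_bounded_def)
  then have "op_bounded (I \<times> K) (\<lambda>i j. ampl_kernel J' s B (map_prod f id i) (map_prod f id j)) (\<delta> * c)"
    unfolding op_bounded_reindex[OF bf] .
  moreover have "ampl_kernel J' s B (f r, x) (f c, y) = ampl_kernel J (\<lambda>r c p q. s (f r) (f c) (g p) (g q)) A (r,x) (c,y)"
    for r x c y
  proof -
    have "ampl_kernel J' s B (f r, x) (f c, y) = (\<Sum>p\<in>J. \<Sum>q\<in>J'. s (f r) (f c) (g p) q * B (g p, x) (q, y))"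
      by (simp add: ampl_kernel_def sum.reindex_bij_betw[OF assms(2), symmetric])
    also have "\<dots> = (\<Sum>p\<in>J. \<Sum>q\<in>J. s (f r) (f c) (g p) (g q) * B (g p, x) (g q, y))"
      by (rule sum.cong[OF refl], rule sum.reindex_bij_betw[OF assms(2), symmetric])
    also have "\<dots> = ampl_kernel J (\<lambda>r c p q. s (f r) (f c) (g p) (g q)) A (r,x) (c,y)"
      by (auto simp: ampl_kernel_def B_def g intro!: sum.cong)
    finally show ?thesis .
  qed
  ultimately show "op_bounded (I \<times> K) (ampl_kernel J (\<lambda>r c p q. s (f r) (f c) (g p) (g q)) A) (\<delta> * c)"
    by (subst op_bounded_cong) auto
qed

lemma cb_bounded_comp:
  fixes I :: "'a set" and J :: "'b set" and L :: "'c set"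
  assumes "cb_bounded I J s \<delta>1" "cb_bounded J L t \<delta>2" "\<delta>2 > 0"
  shows "cb_bounded I L (\<lambda>r c p q. \<Sum>a\<in>J. \<Sum>b\<in>J. s r c a b * t a b p q) (\<delta>1 * \<delta>2)"
  unfolding cb_bounded_def
proof (intro allI impI, elim conjE)
  fix K :: "nat set" and A :: "'c \<times> nat \<Rightarrow> 'c \<times> nat \<Rightarrow> complex" and c :: real
  assume K: "finite K" and c: "c > 0" and A: "op_bounded (L \<times> K) A c"
  have "op_bounded (I \<times> K) (ampl_kernel J s (ampl_kernel L t A)) (\<delta>1 * (\<delta>2 * c))"
    using assms K c A unfolding cb_bounded_def by (meson mult_pos_pos)
  moreover have "ampl_kernel J s (ampl_kernel L t A) (r,x) (c,y) = ampl_kernel L (\<lambda>r c p q. \<Sum>a\<in>J. \<Sum>b\<in>J. s r c a b * t a b p q) A (r,x) (c,y)"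
    for r x c y
  proof -
    have "ampl_kernel J s (ampl_kernel L t A) (r,x) (c,y) = (\<Sum>a\<in>J. \<Sum>b\<in>J. \<Sum>p\<in>L. \<Sum>q\<in>L. s r c a b * t a b p q * A (p,x) (q,y))"
      by (simp add: ampl_kernel_def sum_distrib_left mult.assoc)
    also have "\<dots> = (\<Sum>p\<in>L. \<Sum>q\<in>L. \<Sum>a\<in>J. \<Sum>b\<in>J. s r c a b * t a b p q * A (p,x) (q,y))"
      by (rule sum_swap_pairs)
    finally show ?thesis by (simp add: ampl_kernel_def sum_distrib_right)
  qed
  ultimately show "op_bounded (I \<times> K) (ampl_kernel L (\<lambda>r c p q. \<Sum>a\<in>J. \<Sum>b\<in>J. s r c a b * t a b p q) A) (\<delta>1 * \<delta>2 * c)"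
    unfolding mult.assoc by (subst op_bounded_cong) (auto simp: mult.assoc)
qed

lemma cb_bounded_sum:
  fixes I :: "'a set" and J :: "'b set"
  assumes "finite T" "\<And>t. t \<in> T \<Longrightarrow> cb_bounded I J (s t) (\<delta> t)"
  shows "cb_bounded I J (\<lambda>r c p q. \<Sum>t\<in>T. s t r c p q) (\<Sum>t\<in>T. \<delta> t)"
  unfolding cb_bounded_def
proof (intro allI impI, elim conjE)
  fix K :: "nat set" and A :: "'b \<times> nat \<Rightarrow> 'b \<times> nat \<Rightarrow> complex" and c :: real
  assume K: "finite K" and c: "c > 0" and A: "op_bounded (J \<times> K) A c"
  have "op_bounded (I \<times> K) (\<lambda>i j. \<Sum>t\<in>T. ampl_kernel J (s t) A i j) (\<Sum>t\<in>T. \<delta> t * c)"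
    using assms K c A by (intro op_bounded_sum) (auto simp: cb_bounded_def)
  moreover have "(\<Sum>t\<in>T. ampl_kernel J (s t) A (r,x) (c,y)) = ampl_kernel J (\<lambda>r c p q. \<Sum>t\<in>T. s t r c p q) A (r,x) (c,y)"
    for r x c y
  proof -
    have "ampl_kernel J (\<lambda>r c p q. \<Sum>t\<in>T. s t r c p q) A (r,x) (c,y) = 
       (\<Sum>p\<in>J. \<Sum>q\<in>J. \<Sum>t\<in>T. s t r c p q * A (p,x) (q,y))"
      by (simp add: ampl_kernel_def sum_distrib_right)
    also have "\<dots> = (\<Sum>t\<in>T. \<Sum>p\<in>J. \<Sum>q\<in>J. s t r c p q * A (p,x) (q,y))"
      by (rule sum_swap_inner)
    finally show ?thesis by (simp add: ampl_kernel_def)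
  qed
  ultimately show "op_bounded (I \<times> K) (ampl_kernel J (\<lambda>r c p q. \<Sum>t\<in>T. s t r c p q) A) ((\<Sum>t\<in>T. \<delta> t) * c)"
    unfolding sum_distrib_right by (subst op_bounded_cong) auto
qed

lemma cb_bounded_uminus:
  fixes I :: "'a set" and J :: "'b set"
  assumes "cb_bounded I J s \<delta>" shows "cb_bounded I J (\<lambda>r c p q. - s r c p q) \<delta>"
  unfolding cb_bounded_def
proof (intro allI impI, elim conjE)
  fix K :: "nat set" and A :: "'b \<times> nat \<Rightarrow> 'b \<times> nat \<Rightarrow> complex" and c :: real
  assume K: "finite K" and c: "c > 0" and A: "op_bounded (J \<times> K) A c"
  have "op_bounded (I \<times> K) (\<lambda>i j. (-1) * ampl_kernel J s A i j) (cmod (-1) * (\<delta> * c))"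
    using assms K c A by (intro op_bounded_scale) (auto simp: cb_bounded_def)
  then show "op_bounded (I \<times> K) (ampl_kernel J (\<lambda>r c p q. - s r c p q) A) (\<delta> * c)"
    by (subst op_bounded_cong[of _ _ "\<lambda>i j. (-1) * ampl_kernel J s A i j"]) (auto simp: ampl_kernel_def sum_negf)
qed

lemma sesq_form_ampl_kernel:
  "sesq_form (I \<times> K) w (ampl_kernel J s A) v = (\<Sum>r\<in>I. \<Sum>c\<in>I. \<Sum>p\<in>J. \<Sum>q\<in>J. s r c p q *
     (\<Sum>x\<in>K. \<Sum>y\<in>K. cnj (w (r,x)) * A (p,x) (q,y) * v (c,y)))"
proof -
  have "sesq_form (I \<times> K) w (ampl_kernel J s A) v =
     (\<Sum>r\<in>I. \<Sum>x\<in>K. \<Sum>c\<in>I. \<Sum>y\<in>K. \<Sum>p\<in>J. \<Sum>q\<in>J. s r c p q * (cnj (w (r,x)) * A (p,x) (q,y) * v (c,y)))"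
    by (simp add: sesq_form_def ampl_kernel_def sum.cartesian_product' sum_distrib_left sum_distrib_right algebra_simps)
  also have "\<dots> = (\<Sum>r\<in>I. \<Sum>c\<in>I. \<Sum>x\<in>K. \<Sum>y\<in>K. \<Sum>p\<in>J. \<Sum>q\<in>J. s r c p q * (cnj (w (r,x)) * A (p,x) (q,y) * v (c,y)))"
    by ((rule sum.cong[OF refl])+, rule sum.swap)
  also have "\<dots> = (\<Sum>r\<in>I. \<Sum>c\<in>I. \<Sum>p\<in>J. \<Sum>q\<in>J. \<Sum>x\<in>K. \<Sum>y\<in>K. s r c p q * (cnj (w (r,x)) * A (p,x) (q,y) * v (c,y)))"
    by ((rule sum.cong[OF refl])+, rule sum_swap_pairs)
  finally show ?thesis by (simp add: sum_distrib_left)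
qed

lemma l2norm_slice_le:
  assumes "finite J" "finite K" "r \<in> I" "finite I"
  shows "l2norm (J \<times> K) (\<lambda>(p',x). if p' = p then w (r,x) else 0) \<le> l2norm (I \<times> K) w"
proof -
  have "(\<Sum>u\<in>J \<times> K. (cmod (case u of (p',x) \<Rightarrow> if p' = p then w (r,x) else 0))\<^sup>2)
      = (\<Sum>p'\<in>J. \<Sum>x\<in>K. if p' = p then (cmod (w (r,x)))\<^sup>2 else 0)"
    unfolding sum.cartesian_product' by (intro sum.cong) auto
  also have "\<dots> = (\<Sum>p'\<in>J. if p' = p then (\<Sum>x\<in>K. (cmod (w (r,x)))\<^sup>2) else 0)"
    by (intro sum.cong) auto
  also have "\<dots> \<le> (\<Sum>x\<in>K. (cmod (w (r,x)))\<^sup>2)"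
    using assms by (simp add: sum_nonneg)
  also have "\<dots> \<le> (\<Sum>i\<in>I. \<Sum>x\<in>K. (cmod (w (i,x)))\<^sup>2)"
    using assms by (intro member_le_sum[of r I "\<lambda>i. \<Sum>x\<in>K. (cmod (w (i,x)))\<^sup>2"]) (auto intro: sum_nonneg)
  also have "\<dots> = (\<Sum>u\<in>I \<times> K. (cmod (w u))\<^sup>2)"
    by (simp add: sum.cartesian_product')
  finally show ?thesis unfolding l2norm_def L2_set_def by (rule real_sqrt_le_mono)
qed

text \<open>Each coefficient \<open>s r c p q\<close> multiplies one block of \<open>A\<close>, and
  vectors supported on single slices test that block. The bound is wasteful but independent of the
  ancilla, which makes the supremum in \<open>cb_norm\<close> finite.\<close>

lemma cb_bounded_crude:
  fixes I :: "'a set" and J :: "'b set"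
  assumes "finite I" "finite J"
  shows "cb_bounded I J s (\<Sum>r\<in>I. \<Sum>c\<in>I. \<Sum>p\<in>J. \<Sum>q\<in>J. cmod (s r c p q))"
  unfolding cb_bounded_def op_bounded_def
proof (intro allI impI, elim conjE)
  fix K :: "nat set" and A :: "'b \<times> nat \<Rightarrow> 'b \<times> nat \<Rightarrow> complex" and k :: real and w v
  assume K: "finite K" and k: "k > 0"
    and A: "\<forall>w v. cmod (sesq_form (J \<times> K) w A v) \<le> k * l2norm (J \<times> K) w * l2norm (J \<times> K) v"
  have *: "cmod (\<Sum>x\<in>K. \<Sum>y\<in>K. cnj (w (r,x)) * A (p,x) (q,y) * v (c,y)) \<le> k * l2norm (I \<times> K) w * l2norm (I \<times> K) v"
    if "r \<in> I" "c \<in> I" "p \<in> J" "q \<in> J" for r c p q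
  proof -
    let ?w = "\<lambda>(p',x). if p' = p then w (r,x) else 0" and ?v = "\<lambda>(p',x). if p' = q then v (c,x) else 0"
    have "sesq_form (J \<times> K) ?w A ?v = (\<Sum>p'\<in>J. \<Sum>x\<in>K. \<Sum>q'\<in>J. \<Sum>y\<in>K.
        if p' = p then if q' = q then cnj (w (r,x)) * A (p,x) (q,y) * v (c,y) else 0 else 0)"
      unfolding sesq_form_def sum.cartesian_product' by (intro sum.cong refl) auto
    also have "\<dots> = (\<Sum>p'\<in>J. \<Sum>x\<in>K. if p' = p then \<Sum>q'\<in>J. \<Sum>y\<in>K.
         if q' = q then cnj (w (r,x)) * A (p,x) (q,y) * v (c,y) else 0 else 0)"
      by (intro sum.cong refl) auto
    also have "\<dots> = (\<Sum>p'\<in>J. if p' = p then \<Sum>x\<in>K. \<Sum>q'\<in>J. 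
         if q' = q then \<Sum>y\<in>K. cnj (w (r,x)) * A (p,x) (q,y) * v (c,y) else 0 else 0)"
      by (intro sum.cong refl) (auto intro!: sum.cong)
    also have "\<dots> = (\<Sum>x\<in>K. \<Sum>y\<in>K. cnj (w (r,x)) * A (p,x) (q,y) * v (c,y))"
      using that assms by (simp)
    finally have eq: "sesq_form (J \<times> K) ?w A ?v = (\<Sum>x\<in>K. \<Sum>y\<in>K. cnj (w (r,x)) * A (p,x) (q,y) * v (c,y))" .
    have "cmod (\<Sum>x\<in>K. \<Sum>y\<in>K. cnj (w (r,x)) * A (p,x) (q,y) * v (c,y)) \<le> k * l2norm (J \<times> K) ?w * l2norm (J \<times> K) ?v"
      using A[rule_format, of ?w ?v] unfolding eq .
    also have "\<dots> \<le> k * l2norm (I \<times> K) w * l2norm (I \<times> K) v"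
      using k K assms that by (intro mult_mono mult_left_mono l2norm_slice_le) auto
    finally show ?thesis .
  qed
  have "cmod (sesq_form (I \<times> K) w (ampl_kernel J s A) v) \<le> (\<Sum>r\<in>I. \<Sum>c\<in>I. \<Sum>p\<in>J. \<Sum>q\<in>J. cmod (s r c p q) *
     (k * l2norm (I \<times> K) w * l2norm (I \<times> K) v))"
    unfolding sesq_form_ampl_kernel
    by (intro order_trans[OF norm_sum] sum_mono) (auto simp: norm_mult intro!: mult_left_mono *)
  then show "cmod (sesq_form (I \<times> K) w (ampl_kernel J s A) v) \<le> (\<Sum>r\<in>I. \<Sum>c\<in>I. \<Sum>p\<in>J. \<Sum>q\<in>J. cmod (s r c p q)) * k
      * l2norm (I \<times> K) w * l2norm (I \<times> K) v"
    by (simp add: sum_distrib_right mult.assoc)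
qed

section \<open>Maps in Kraus form\<close>

text \<open>The coefficients of the map sending \<open>A\<close> to the sum of
  \<open>B t A (B t)*\<close>. Such a map is unital iff the products \<open>B t (B t)*\<close> sum
  to the identity.\<close>

definition kraus :: "'t set \<Rightarrow> ('t \<Rightarrow> 'i \<Rightarrow> 'j \<Rightarrow> complex) \<Rightarrow> 'i \<Rightarrow> 'i \<Rightarrow> 'j \<Rightarrow> 'j \<Rightarrow> complex" where
  "kraus T B = (\<lambda>r c p q. \<Sum>t\<in>T. B t r p * cnj (B t c q))"

text \<open>The vector obtained by applying the adjoint of \<open>B\<close>, tensored with the
  identity of the ancilla, to \<open>v\<close>.\<close>

definition kraus_vec :: "'i set \<Rightarrow> ('i \<Rightarrow> 'j \<Rightarrow> complex) \<Rightarrow> ('i \<times> 'k \<Rightarrow> complex) \<Rightarrow> 'j \<times> 'k \<Rightarrow> complex" where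
  "kraus_vec I B v = (\<lambda>(p,x). \<Sum>c\<in>I. cnj (B c p) * v (c,x))"

lemma sesq_form_kraus:
  "sesq_form (I \<times> K) w (ampl_kernel J (kraus T B) A) v =
     (\<Sum>t\<in>T. sesq_form (J \<times> K) (kraus_vec I (B t) w) A (kraus_vec I (B t) v))"
proof -
  let ?f = "\<lambda>t r c p q x y. cnj (w (r,x)) * B t r p * A (p,x) (q,y) * (cnj (B t c q) * v (c,y))"
  have "sesq_form (I \<times> K) w (ampl_kernel J (kraus T B) A) v =
     (\<Sum>r\<in>I. \<Sum>x\<in>K. \<Sum>c\<in>I. \<Sum>y\<in>K. \<Sum>p\<in>J. \<Sum>q\<in>J. \<Sum>t\<in>T. ?f t r c p q x y)"
    unfolding sesq_form_def ampl_kernel_def kraus_def sum.cartesian_product'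
    by (simp add: sum_distrib_left sum_distrib_right algebra_simps)
  also have "\<dots> = (\<Sum>r\<in>I. \<Sum>x\<in>K. \<Sum>p\<in>J. \<Sum>q\<in>J. \<Sum>c\<in>I. \<Sum>y\<in>K. \<Sum>t\<in>T. ?f t r c p q x y)"
    by ((rule sum.cong[OF refl])+, rule sum_swap_pairs)
  also have "\<dots> = (\<Sum>r\<in>I. \<Sum>x\<in>K. \<Sum>p\<in>J. \<Sum>q\<in>J. \<Sum>t\<in>T. \<Sum>c\<in>I. \<Sum>y\<in>K. ?f t r c p q x y)"
    by ((rule sum.cong[OF refl])+, rule sum_swap_inner)
  also have "\<dots> = (\<Sum>r\<in>I. \<Sum>x\<in>K. \<Sum>t\<in>T. \<Sum>p\<in>J. \<Sum>q\<in>J. \<Sum>c\<in>I. \<Sum>y\<in>K. ?f t r c p q x y)"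
    by ((rule sum.cong[OF refl])+, rule sum_swap_inner)
  also have "\<dots> = (\<Sum>t\<in>T. \<Sum>r\<in>I. \<Sum>x\<in>K. \<Sum>p\<in>J. \<Sum>q\<in>J. \<Sum>c\<in>I. \<Sum>y\<in>K. ?f t r c p q x y)"
    by (rule sum_swap_inner)
  also have "\<dots> = (\<Sum>t\<in>T. sesq_form (J \<times> K) (kraus_vec I (B t) w) A (kraus_vec I (B t) v))"
  proof (rule sum.cong[OF refl])
    fix t
    have "sesq_form (J \<times> K) (kraus_vec I (B t) w) A (kraus_vec I (B t) v) =
       (\<Sum>p\<in>J. \<Sum>x\<in>K. \<Sum>q\<in>J. \<Sum>y\<in>K. \<Sum>r\<in>I. \<Sum>c\<in>I. ?f t r c p q x y)"
      unfolding sesq_form_def kraus_vec_def sum.cartesian_product'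
      by (simp add: sum_distrib_left sum_distrib_right algebra_simps)
    also have "\<dots> = (\<Sum>p\<in>J. \<Sum>x\<in>K. \<Sum>r\<in>I. \<Sum>c\<in>I. \<Sum>q\<in>J. \<Sum>y\<in>K. ?f t r c p q x y)"
      by ((rule sum.cong[OF refl])+, rule sum_swap_pairs)
    also have "\<dots> = (\<Sum>p\<in>J. \<Sum>x\<in>K. \<Sum>r\<in>I. \<Sum>q\<in>J. \<Sum>c\<in>I. \<Sum>y\<in>K. ?f t r c p q x y)"
      by ((rule sum.cong[OF refl])+, rule sum.swap)
    also have "\<dots> = (\<Sum>p\<in>J. \<Sum>r\<in>I. \<Sum>x\<in>K. \<Sum>q\<in>J. \<Sum>c\<in>I. \<Sum>y\<in>K. ?f t r c p q x y)"
      by ((rule sum.cong[OF refl])+, rule sum.swap)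
    also have "\<dots> = (\<Sum>r\<in>I. \<Sum>x\<in>K. \<Sum>p\<in>J. \<Sum>q\<in>J. \<Sum>c\<in>I. \<Sum>y\<in>K. ?f t r c p q x y)"
      by (rule sum_swap_inner[symmetric])
    finally show "(\<Sum>r\<in>I. \<Sum>x\<in>K. \<Sum>p\<in>J. \<Sum>q\<in>J. \<Sum>c\<in>I. \<Sum>y\<in>K. ?f t r c p q x y) =
       sesq_form (J \<times> K) (kraus_vec I (B t) w) A (kraus_vec I (B t) v)" by simp
  qed
  finally show ?thesis .
qed

text \<open>Unitality says that the adjoints of the \<open>B t\<close>, stacked on top of each
  other, form an isometry.\<close>

lemma kraus_vec_norm:
  assumes "finite I" and unital: "\<And>r c. r \<in> I \<Longrightarrow> c \<in> I \<Longrightarrow> (\<Sum>t\<in>T. \<Sum>p\<in>J. B t r p * cnj (B t c p)) = (if r = c then 1 else 0)"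
  shows "(\<Sum>t\<in>T. (l2norm (J \<times> K) (kraus_vec I (B t) v))\<^sup>2) = (l2norm (I \<times> K) v)\<^sup>2"
proof -
  have sq: "complex_of_real ((cmod z)\<^sup>2) = cnj z * z" for z
    by (metis complex_norm_square mult.commute)
  let ?f = "\<lambda>t p x r c. B t r p * cnj (B t c p) * (cnj (v (r,x)) * v (c,x))"
  have "complex_of_real (\<Sum>t\<in>T. (l2norm (J \<times> K) (kraus_vec I (B t) v))\<^sup>2) =
     (\<Sum>t\<in>T. \<Sum>p\<in>J. \<Sum>x\<in>K. \<Sum>c\<in>I. \<Sum>r\<in>I. ?f t p x r c)"
    unfolding l2norm_power2 kraus_vec_def sum.cartesian_product' of_real_sum sq
    by (simp add: sum_distrib_left sum_distrib_right algebra_simps)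
  also have "\<dots> = (\<Sum>t\<in>T. \<Sum>p\<in>J. \<Sum>x\<in>K. \<Sum>r\<in>I. \<Sum>c\<in>I. ?f t p x r c)"
    by (rule sum.cong[OF refl], rule sum.cong[OF refl], rule sum.cong[OF refl], rule sum.swap)
  also have "\<dots> = (\<Sum>x\<in>K. \<Sum>t\<in>T. \<Sum>p\<in>J. \<Sum>r\<in>I. \<Sum>c\<in>I. ?f t p x r c)"
    by (rule sum_swap_inner)
  also have "\<dots> = (\<Sum>x\<in>K. \<Sum>r\<in>I. \<Sum>c\<in>I. \<Sum>t\<in>T. \<Sum>p\<in>J. ?f t p x r c)"
    by ((rule sum.cong[OF refl])+, rule sum_swap_pairs)
  also have "\<dots> = (\<Sum>x\<in>K. \<Sum>r\<in>I. \<Sum>c\<in>I. (if r = c then 1 else 0) * (cnj (v (r,x)) * v (c,x)))"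
    by (simp add: sum_distrib_right[symmetric] unital)
  also have "\<dots> = (\<Sum>x\<in>K. \<Sum>r\<in>I. \<Sum>c\<in>I. if r = c then cnj (v (r,x)) * v (r,x) else 0)"
    by (intro sum.cong) auto
  also have "\<dots> = (\<Sum>x\<in>K. \<Sum>r\<in>I. cnj (v (r,x)) * v (r,x))"
    using assms(1) by (intro sum.cong) auto
  also have "\<dots> = (\<Sum>r\<in>I. \<Sum>x\<in>K. cnj (v (r,x)) * v (r,x))"
    by (rule sum.swap)
  also have "\<dots> = complex_of_real ((l2norm (I \<times> K) v)\<^sup>2)"
    unfolding l2norm_power2 kraus_vec_def sum.cartesian_product' of_real_sum sq ..
  finally show ?thesis by (simp only: of_real_eq_iff)
qed

text \<open>The form splits into forms of \<open>A\<close> at the pieces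
  \<open>kraus_vec I (B t)\<close> of \<open>w\<close> and \<open>v\<close>. The squared norms of
  the pieces sum to those of \<open>w\<close> and \<open>v\<close>, so the Cauchy-Schwarz inequality
  over \<open>t\<close> gives the constant 1.\<close>

lemma cb_bounded_kraus:
  fixes I :: "'a set" and J :: "'b set"
  assumes "finite I" and unital: "\<And>r c. r \<in> I \<Longrightarrow> c \<in> I \<Longrightarrow> (\<Sum>t\<in>T. \<Sum>p\<in>J. B t r p * cnj (B t c p)) = (if r = c then 1 else 0)"
  shows "cb_bounded I J (kraus T B) 1"
  unfolding cb_bounded_def op_bounded_def
proof (intro allI impI, elim conjE)
  fix K :: "nat set" and A :: "'b \<times> nat \<Rightarrow> 'b \<times> nat \<Rightarrow> complex" and k :: real and w v
  assume k: "k > 0"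
    and A: "\<forall>w v. cmod (sesq_form (J \<times> K) w A v) \<le> k * l2norm (J \<times> K) w * l2norm (J \<times> K) v"
  define W V where "W = (\<lambda>t. l2norm (J \<times> K) (kraus_vec I (B t) w))" and "V = (\<lambda>t. l2norm (J \<times> K) (kraus_vec I (B t) v))"
  have nn: "0 \<le> W t" "0 \<le> V t" for t by (auto simp: W_def V_def)
  have "L2_set W T = l2norm (I \<times> K) w" "L2_set V T = l2norm (I \<times> K) v"
    unfolding L2_set_def W_def V_def
    by (simp_all add: kraus_vec_norm[where T=T and J=J and B=B and I=I, OF assms(1) unital])
  then have "(\<Sum>t\<in>T. W t * V t) \<le> l2norm (I \<times> K) w * l2norm (I \<times> K) v"
    using L2_set_mult_ineq[of W V T] nn by simp
  moreover have "cmod (sesq_form (I \<times> K) w (ampl_kernel J (kraus T B) A) v) \<le> (\<Sum>t\<in>T. k * W t * V t)"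
    unfolding sesq_form_kraus W_def V_def using A by (intro sum_norm_le) auto
  ultimately show "cmod (sesq_form (I \<times> K) w (ampl_kernel J (kraus T B) A) v) \<le> 1 * k * l2norm (I \<times> K) w * l2norm (I \<times> K) v"
    using k by (simp add: sum_distrib_left[symmetric] mult.assoc) (meson mult_left_mono less_imp_le order_trans)
qed

section \<open>Matrices, channels and the cb-norm\<close>

definition map_coeff :: "nat \<Rightarrow> (complex mat \<Rightarrow> complex mat) \<Rightarrow> nat \<Rightarrow> nat \<Rightarrow> nat \<Rightarrow> nat \<Rightarrow> complex" where
  "map_coeff n S r c p q = S (munit n p q) $$ (r,c)"

definition coeff_map :: "nat \<Rightarrow> nat \<Rightarrow> (nat \<Rightarrow> nat \<Rightarrow> nat \<Rightarrow> nat \<Rightarrow> complex) \<Rightarrow> complex mat \<Rightarrow> complex mat" where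
  "coeff_map n1 n2 s A = mat n1 n1 (\<lambda>(r,c). \<Sum>p<n2. \<Sum>q<n2. s r c p q * A $$ (p,q))"

abbreviation entries :: "complex mat \<Rightarrow> nat \<Rightarrow> nat \<Rightarrow> complex" where
  "entries A \<equiv> (\<lambda>i j. A $$ (i,j))"

lemma munit_carrier [simp]: "munit n i j \<in> carrier_mat n n"
  by (simp add: munit_def)

lemma munit_entry: "r < n \<Longrightarrow> c < n \<Longrightarrow> munit n i j $$ (r,c) = (if r = i \<and> c = j then 1 else 0)"
  by (simp add: munit_def)

lemma coeff_map_carrier [simp]: "coeff_map n1 n2 s A \<in> carrier_mat n1 n1"
  by (simp add: coeff_map_def)

lemma coeff_map_entry:
  "r < n1 \<Longrightarrow> c < n1 \<Longrightarrow> coeff_map n1 n2 s A $$ (r,c) = (\<Sum>p<n2. \<Sum>q<n2. s r c p q * A $$ (p,q))"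
  by (simp add: coeff_map_def)

lemma lin_map_coeff_map: "lin_map n1 n2 (coeff_map n1 n2 s)"
  unfolding lin_map_def
proof (intro conjI ballI allI)
  fix A B :: "complex mat" and c :: complex
  assume A: "A \<in> carrier_mat n2 n2"
  show "coeff_map n1 n2 s (c \<cdot>\<^sub>m A) = c \<cdot>\<^sub>m coeff_map n1 n2 s A"
    using A by (intro eq_matI) (auto simp: coeff_map_def sum_distrib_left intro!: sum.cong)
  assume B: "B \<in> carrier_mat n2 n2"
  show "coeff_map n1 n2 s (A + B) = coeff_map n1 n2 s A + coeff_map n1 n2 s B"
    using A B by (intro eq_matI) (auto simp: coeff_map_def sum.distrib[symmetric] distrib_left intro!: sum.cong)
qed simp

lemma sum_delta2:
  fixes f :: "nat \<Rightarrow> nat \<Rightarrow> complex"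
  assumes "p < n" "q < m"
  shows "(\<Sum>i<n. \<Sum>j<m. f i j * (if i = p \<and> j = q then 1 else 0)) = f p q"
proof -
  have "(\<Sum>i<n. \<Sum>j<m. f i j * (if i = p \<and> j = q then 1 else 0)) = (\<Sum>i<n. \<Sum>j<m. if j = q then if i = p then f i j else 0 else 0)"
    by (intro sum.cong refl) auto
  also have "\<dots> = f p q" using assms by simp
  finally show ?thesis .
qed

lemma map_coeff_coeff_map:
  assumes "r < n1" "c < n1" "p < n2" "q < n2"
  shows "map_coeff n2 (coeff_map n1 n2 s) r c p q = s r c p q"
  using assms by (simp add: map_coeff_def coeff_map_entry munit_entry sum_delta2)

lemma lin_map_entry:
  assumes S: "lin_map n1 n2 S" and A: "A \<in> carrier_mat n2 n2" and rc: "r < n1" "c < n1"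
  shows "S A $$ (r,c) = (\<Sum>p<n2. \<Sum>q<n2. map_coeff n2 S r c p q * A $$ (p,q))"
proof -
  \<comment> \<open>\<open>A\<close> with only the entries in \<open>P\<close> kept; the induction
    on \<open>P\<close> adds one matrix unit at a time.\<close>
  define AP where "AP = (\<lambda>P. mat n2 n2 (\<lambda>(i,j). if (i,j) \<in> P then A $$ (i,j) else 0))"
  have AP: "AP P \<in> carrier_mat n2 n2" for P by (simp add: AP_def)
  have "S (AP P) $$ (r,c) = (\<Sum>(p,q)\<in>P. map_coeff n2 S r c p q * A $$ (p,q))"
    if "finite P" "P \<subseteq> {..<n2} \<times> {..<n2}" for P
    using that
  proof (induction P rule: finite_induct)
    case empty
    have "AP {} = 0 \<cdot>\<^sub>m AP {}" by (intro eq_matI) (auto simp: AP_def)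
    then have "S (AP {}) = 0 \<cdot>\<^sub>m S (AP {})" using S AP unfolding lin_map_def by metis
    moreover have "S (AP {}) \<in> carrier_mat n1 n1" using S AP by (auto simp: lin_map_def)
    ultimately have "S (AP {}) $$ (r,c) = 0 * S (AP {}) $$ (r,c)" using rc
      by (metis carrier_matD(1,2) index_smult_mat(1))
    then show ?case by simp
  next
    case (insert x P)
    obtain p q where x: "x = (p,q)" by force
    have pq: "p < n2" "q < n2" using insert.prems x by auto
    have "AP (insert x P) = AP P + A $$ (p,q) \<cdot>\<^sub>m munit n2 p q"
      using insert.hyps pq x by (intro eq_matI) (auto simp: AP_def munit_def)
    then have "S (AP (insert x P)) = S (AP P) + A $$ (p,q) \<cdot>\<^sub>m S (munit n2 p q)"
      using S AP unfolding lin_map_def by (metis munit_carrier smult_carrier_mat)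
    moreover have "S (munit n2 p q) \<in> carrier_mat n1 n1" "S (AP P) \<in> carrier_mat n1 n1"
      using S AP by (auto simp: lin_map_def)
    ultimately have "S (AP (insert x P)) $$ (r,c) = S (AP P) $$ (r,c) + A $$ (p,q) * map_coeff n2 S r c p q"
      using rc by (auto simp: map_coeff_def)
    then show ?case using insert x by (simp add: algebra_simps)
  qed
  from this[of "{..<n2} \<times> {..<n2}"]
  have "S (AP ({..<n2} \<times> {..<n2})) $$ (r,c) = (\<Sum>p<n2. \<Sum>q<n2. map_coeff n2 S r c p q * A $$ (p,q))"
    by (simp add: sum.cartesian_product')
  moreover have "AP ({..<n2} \<times> {..<n2}) = A"
    using A by (intro eq_matI) (auto simp: AP_def)
  ultimately show ?thesis by simp
qed

section \<open>The operator norm as a bound on forms\<close>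

lemma vnorm_l2norm: "vnorm v = l2norm {..<dim_vec v} (\<lambda>i. v $ i)"
  by (simp add: vnorm_def l2norm_def L2_set_def)

lemma mult_mat_vec_entry:
  assumes "A \<in> carrier_mat n m" "v \<in> carrier_vec m" "i < n"
  shows "(A *\<^sub>v v) $ i = (\<Sum>j<m. A $$ (i,j) * v $ j)"
  using assms by (auto simp: scalar_prod_def atLeast0LessThan intro!: sum.cong)

lemma cmod_sum_le_l2norm: "cmod (\<Sum>i\<in>I. cnj (w i) * u i) \<le> l2norm I w * l2norm I u"
proof -
  have "cmod (\<Sum>i\<in>I. cnj (w i) * u i) \<le> (\<Sum>i\<in>I. \<bar>cmod (w i)\<bar> * \<bar>cmod (u i)\<bar>)"
    by (intro order_trans[OF norm_sum]) (simp add: norm_mult)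
  then show ?thesis unfolding l2norm_def by (rule order_trans[OF _ L2_set_mult_ineq])
qed

text \<open>Test the form with \<open>w = A v\<close>: this bounds the square of the norm of
  \<open>A v\<close>, and one factor cancels.\<close>

lemma op_bounded_vnorm_le:
  assumes A: "A \<in> carrier_mat n n" and v: "v \<in> carrier_vec n" and "op_bounded {..<n} (entries A) c" "0 \<le> c"
  shows "vnorm (A *\<^sub>v v) \<le> c * vnorm v"
proof -
  let ?u = "\<lambda>i. (A *\<^sub>v v) $ i"
  have d: "dim_vec v = n" "dim_vec (A *\<^sub>v v) = n" using A v by auto
  have "sesq_form {..<n} ?u (entries A) (\<lambda>i. v $ i) = (\<Sum>i<n. cnj (?u i) * ?u i)"
    using A v by (auto simp: sesq_form_def mult_mat_vec_entry sum_distrib_left mult.assoc simp del: index_mult_mat_vec intro!: sum.cong)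
  also have "\<dots> = complex_of_real ((l2norm {..<n} ?u)\<^sup>2)"
    by (simp add: l2norm_power2 complex_norm_square[symmetric] mult.commute)
  finally have "(l2norm {..<n} ?u)\<^sup>2 \<le> c * l2norm {..<n} ?u * l2norm {..<n} (\<lambda>i. v $ i)"
    using assms(3) unfolding op_bounded_def by (metis norm_of_real abs_of_nonneg zero_le_power2)
  then have "l2norm {..<n} ?u * l2norm {..<n} ?u \<le> l2norm {..<n} ?u * (c * l2norm {..<n} (\<lambda>i. v $ i))"
    by (simp add: power2_eq_square mult_ac)
  then have "l2norm {..<n} ?u \<le> c * l2norm {..<n} (\<lambda>i. v $ i)"
    using assms(4) by (cases "l2norm {..<n} ?u = 0") (auto simp: less_le mult_le_cancel_left)
  then show ?thesis by (simp only: vnorm_l2norm d)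
qed

lemma op_bounded_of_vnorm_le:
  assumes A: "A \<in> carrier_mat n n" and b: "\<And>v. v \<in> carrier_vec n \<Longrightarrow> vnorm (A *\<^sub>v v) \<le> c * vnorm v"
  shows "op_bounded {..<n} (entries A) c"
  unfolding op_bounded_def
proof (intro allI)
  fix w v :: "nat \<Rightarrow> complex"
  define v' where "v' = vec n v"
  have v': "v' \<in> carrier_vec n" "dim_vec v' = n" "dim_vec (A *\<^sub>v v') = n" using A by (auto simp: v'_def)
  have n: "vnorm v' = l2norm {..<n} v" unfolding vnorm_l2norm v' by (auto simp: v'_def intro!: l2norm_cong)
  have "sesq_form {..<n} w (entries A) v = (\<Sum>i<n. cnj (w i) * (A *\<^sub>v v') $ i)"
    using A v' by (auto simp: v'_def sesq_form_def mult_mat_vec_entry sum_distrib_left mult.assoc simp del: index_mult_mat_vec intro!: sum.cong)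
  then have "cmod (sesq_form {..<n} w (entries A) v) \<le> l2norm {..<n} w * l2norm {..<n} (\<lambda>i. (A *\<^sub>v v') $ i)"
    using cmod_sum_le_l2norm by auto
  also have "\<dots> \<le> l2norm {..<n} w * (c * l2norm {..<n} v)"
    using b[of v'] v' n by (intro mult_left_mono) (auto simp: vnorm_l2norm)
  finally show "cmod (sesq_form {..<n} w (entries A) v) \<le> c * l2norm {..<n} w * l2norm {..<n} v"
    by (simp add: mult_ac)
qed

lemma op_bounded_crude:
  assumes "finite I"
  shows "op_bounded I A (\<Sum>i\<in>I. \<Sum>j\<in>I. cmod (A i j))"
  unfolding op_bounded_def
proof (intro allI)
  fix w v
  have m: "cmod (u i) \<le> l2norm I u" if "i \<in> I" for u i
    unfolding l2norm_def using member_le_L2_set[OF assms that, of "\<lambda>i. cmod (u i)"] .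
  have "cmod (sesq_form I w A v) \<le> (\<Sum>i\<in>I. \<Sum>j\<in>I. l2norm I w * cmod (A i j) * l2norm I v)"
    unfolding sesq_form_def by (intro order_trans[OF norm_sum] sum_mono) (auto simp: norm_mult intro!: mult_mono m)
  then show "cmod (sesq_form I w A v) \<le> (\<Sum>i\<in>I. \<Sum>j\<in>I. cmod (A i j)) * l2norm I w * l2norm I v"
    by (simp add: sum_distrib_right sum_distrib_left mult_ac)
qed

lemma vnorm_zero [simp]: "vnorm (0\<^sub>v n) = 0"
  by (simp add: vnorm_def)

lemma opnorm_le:
  assumes "A \<in> carrier_mat n n" "op_bounded {..<n} (entries A) c" "0 \<le> c"
  shows "opnorm n A \<le> c"
  unfolding opnorm_def
proof (rule cSup_least)
  show "{vnorm (A *\<^sub>v v) |v. v \<in> carrier_vec n \<and> vnorm v \<le> 1} \<noteq> {}"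
    by (auto intro!: exI[of _ "0\<^sub>v n"])
next
  fix x assume "x \<in> {vnorm (A *\<^sub>v v) |v. v \<in> carrier_vec n \<and> vnorm v \<le> 1}"
  then obtain v where v: "x = vnorm (A *\<^sub>v v)" "v \<in> carrier_vec n" "vnorm v \<le> 1" by auto
  then have "x \<le> c * vnorm v" using op_bounded_vnorm_le assms by auto
  also have "\<dots> \<le> c * 1" using v assms by (intro mult_left_mono) auto
  finally show "x \<le> c" by simp
qed

lemma opnorm_upper:
  assumes A: "A \<in> carrier_mat n n" and v: "v \<in> carrier_vec n" "vnorm v \<le> 1"
  shows "vnorm (A *\<^sub>v v) \<le> opnorm n A"
  unfolding opnorm_def
proof (rule cSup_upper)
  let ?c = "\<Sum>i<n. \<Sum>j<n. cmod (A $$ (i,j))"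
  have c: "?c \<ge> 0" by (intro sum_nonneg) auto
  show "bdd_above {vnorm (A *\<^sub>v v) |v. v \<in> carrier_vec n \<and> vnorm v \<le> 1}"
  proof (rule bdd_aboveI[of _ ?c])
    fix x assume "x \<in> {vnorm (A *\<^sub>v v) |v. v \<in> carrier_vec n \<and> vnorm v \<le> 1}"
    then obtain v where v: "x = vnorm (A *\<^sub>v v)" "v \<in> carrier_vec n" "vnorm v \<le> 1" by auto
    then have "x \<le> ?c * vnorm v" using op_bounded_vnorm_le[OF A v(2) op_bounded_crude] c by auto
    also have "\<dots> \<le> ?c * 1" using v c by (intro mult_left_mono) auto
    finally show "x \<le> ?c" by simp
  qed
qed (use v in auto)

lemma opnorm_nonneg:
  assumes "A \<in> carrier_mat n n" shows "0 \<le> opnorm n A"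
proof -
  have "0 \<le> vnorm (A *\<^sub>v 0\<^sub>v n)" by (simp add: vnorm_l2norm)
  also have "\<dots> \<le> opnorm n A" by (rule opnorm_upper[OF assms]) auto
  finally show ?thesis .
qed

lemma op_bounded_opnorm:
  assumes A: "A \<in> carrier_mat n n"
  shows "op_bounded {..<n} (entries A) (opnorm n A)"
proof (rule op_bounded_of_vnorm_le[OF A])
  fix v :: "complex vec" assume v: "v \<in> carrier_vec n"
  have sc: "vnorm (z \<cdot>\<^sub>v u) = cmod z * vnorm u" for z u
    by (simp add: vnorm_def norm_mult power_mult_distrib sum_distrib_left[symmetric] real_sqrt_mult)
  have Asc: "A *\<^sub>v (z \<cdot>\<^sub>v v) = z \<cdot>\<^sub>v (A *\<^sub>v v)" for z
    using A v by (simp add: mult_mat_vec)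
  have nn: "vnorm v \<ge> 0" by (simp add: vnorm_l2norm)
  show "vnorm (A *\<^sub>v v) \<le> opnorm n A * vnorm v"
  proof (cases "vnorm v = 0")
    \<comment> \<open>\<open>v\<close> cannot be normalised here, but any finite bound forces
      \<open>A v\<close> to have norm 0.\<close>
    case True
    have "vnorm (A *\<^sub>v v) \<le> (\<Sum>i<n. \<Sum>j<n. cmod (A $$ (i,j))) * vnorm v"
      by (rule op_bounded_vnorm_le[OF A v op_bounded_crude]) (auto intro!: sum_nonneg)
    with True show ?thesis by simp
  next
    case False
    let ?z = "complex_of_real (1 / vnorm v)"
    have "vnorm (A *\<^sub>v (?z \<cdot>\<^sub>v v)) \<le> opnorm n A"
      using v False nn by (intro opnorm_upper[OF A]) (auto simp: sc simp del: of_real_divide)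
    then have "vnorm (A *\<^sub>v v) / vnorm v \<le> opnorm n A"
      unfolding Asc sc using nn by (simp del: of_real_divide)
    then show ?thesis using False nn by (simp add: field_simps)
  qed
qed

section \<open>Tensor indices and amplification\<close>

lemma index_bound: "i < a \<Longrightarrow> x < b \<Longrightarrow> i * b + x < a * (b::nat)"
  by (metis add.commute add_less_mono1 less_le_trans mult.commute mult_Suc mult_le_mono2 not_less_eq_eq not_le)

lemma bij_index: "bij_betw (\<lambda>(i,x). i * b + x) ({..<a} \<times> {..<b}) {..<a * (b::nat)}"
proof (cases "b = 0")
  case False
  show ?thesis
    by (rule bij_betwI[where g="\<lambda>u. (u div b, u mod b)"])
       (use False in \<open>auto simp: index_bound less_mult_imp_div_less\<close>)
qed (auto simp: bij_betw_def)

lemma bij_divmod: "bij_betw (\<lambda>u. (u div b, u mod b)) {..<a * (b::nat)} ({..<a} \<times> {..<b})"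
proof (cases "b = 0")
  case False
  show ?thesis
    by (rule bij_betwI[where g="\<lambda>(i,x). i * b + x"])
       (use False in \<open>auto simp: index_bound less_mult_imp_div_less\<close>)
qed (auto simp: bij_betw_def)

lemma sum_index: "(\<Sum>u<a * b. f u) = (\<Sum>i<a. \<Sum>x<b. f (i * b + x :: nat))"
  using sum.reindex_bij_betw[OF bij_index, of f b a] by (simp add: sum.cartesian_product' split_def)

lemma tensor_map_coeff_map:
  assumes S1: "\<And>i j. i < b1 \<Longrightarrow> j < b1 \<Longrightarrow> S1 (munit b1 i j) \<in> carrier_mat a1 a1"
    and S2: "\<And>i j. i < b2 \<Longrightarrow> j < b2 \<Longrightarrow> S2 (munit b2 i j) \<in> carrier_mat a2 a2"
  shows "tensor_map a1 b1 a2 b2 S1 S2 A = coeff_map (a1 * a2) (b1 * b2) (\<lambda>r c p q.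
     map_coeff b1 S1 (r div a2) (c div a2) (p div b2) (q div b2) * map_coeff b2 S2 (r mod a2) (c mod a2) (p mod b2) (q mod b2)) A"
  (is "?L = ?R")
proof (rule eq_matI)
  fix r c assume "r < dim_row ?R" "c < dim_col ?R"
  then have rc: "r < a1 * a2" "c < a1 * a2" by (auto simp: coeff_map_def)
  have "?L $$ (r,c) = (\<Sum>i<b1. \<Sum>j<b1. \<Sum>k<b2. \<Sum>l<b2. A $$ (i * b2 + k, j * b2 + l) *
      (map_coeff b1 S1 (r div a2) (c div a2) i j * map_coeff b2 S2 (r mod a2) (c mod a2) k l))"
  proof -
    have "kron (S1 (munit b1 i j)) (S2 (munit b2 k l)) $$ (r,c) =
       map_coeff b1 S1 (r div a2) (c div a2) i j * map_coeff b2 S2 (r mod a2) (c mod a2) k l"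
      if "i < b1" "j < b1" "k < b2" "l < b2" for i j k l
      using S1[OF that(1,2)] S2[OF that(3,4)] rc by (simp add: kron_def map_coeff_def)
    then show ?thesis using rc by (auto simp: tensor_map_def intro!: sum.cong)
  qed
  also have "\<dots> = (\<Sum>i<b1. \<Sum>k<b2. \<Sum>j<b1. \<Sum>l<b2. A $$ (i * b2 + k, j * b2 + l) *
      (map_coeff b1 S1 (r div a2) (c div a2) i j * map_coeff b2 S2 (r mod a2) (c mod a2) k l))"
    by (rule sum.cong[OF refl], rule sum.swap)
  also have "\<dots> = ?R $$ (r,c)"
    using rc by (auto simp: coeff_map_entry sum_index intro!: sum.cong)
  finally show "?L $$ (r,c) = ?R $$ (r,c)" .
qed (auto simp: tensor_map_def coeff_map_def)

lemma ampl_entry: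
  assumes S: "lin_map n1 n2 S" and "r < n1" "c < n1" "x < k" "y < k"
  shows "ampl n1 n2 k S A $$ (r * k + x, c * k + y) =
    ampl_kernel {..<n2} (map_coeff n2 S) (\<lambda>(p,x) (q,y). A $$ (p * k + x, q * k + y)) (r,x) (c,y)"
proof -
  have "ampl n1 n2 k S A $$ (r * k + x, c * k + y) =
     (\<Sum>i<n2. \<Sum>a<k. \<Sum>j<n2. \<Sum>b<k. map_coeff n2 S r c i j * map_coeff k (\<lambda>X. X) x y a b * A $$ (i * k + a, j * k + b))"
    unfolding ampl_def using S assms(2-)
    by (subst tensor_map_coeff_map) (auto simp: lin_map_def coeff_map_entry index_bound sum_index)
  also have "\<dots> = (\<Sum>i<n2. \<Sum>j<n2. \<Sum>a<k. \<Sum>b<k. map_coeff n2 S r c i j * map_coeff k (\<lambda>X. X) x y a b * A $$ (i * k + a, j * k + b))"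
    by (rule sum.cong[OF refl], rule sum.swap)
  also have "\<dots> = (\<Sum>i<n2. \<Sum>j<n2. map_coeff n2 S r c i j * A $$ (i * k + x, j * k + y))"
  proof (intro sum.cong refl)
    fix i j
    have "(\<Sum>a<k. \<Sum>b<k. map_coeff n2 S r c i j * map_coeff k (\<lambda>X. X) x y a b * A $$ (i * k + a, j * k + b)) =
      (\<Sum>a<k. \<Sum>b<k. (map_coeff n2 S r c i j * A $$ (i * k + a, j * k + b)) * (if a = x \<and> b = y then 1 else 0))"
      using assms by (intro sum.cong) (auto simp: map_coeff_def munit_entry)
    then show "(\<Sum>a<k. \<Sum>b<k. map_coeff n2 S r c i j * map_coeff k (\<lambda>X. X) x y a b * A $$ (i * k + a, j * k + b)) =
       map_coeff n2 S r c i j * A $$ (i * k + x, j * k + y)"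
      using assms by (simp add: sum_delta2)
  qed
  finally show ?thesis by (simp add: ampl_kernel_def)
qed

lemma ampl_carrier [simp]: "ampl n1 n2 k S A \<in> carrier_mat (n1 * k) (n1 * k)"
  by (simp add: ampl_def tensor_map_def)

lemma op_bounded_ampl:
  assumes "lin_map n1 n2 S"
  shows "op_bounded {..<n1 * k} (entries (ampl n1 n2 k S A)) c \<longleftrightarrow>
    op_bounded ({..<n1} \<times> {..<k}) (ampl_kernel {..<n2} (map_coeff n2 S) (\<lambda>(p,x) (q,y). A $$ (p * k + x, q * k + y))) c"
  unfolding op_bounded_reindex[OF bij_index]
  by (rule op_bounded_cong) (auto simp: ampl_entry[OF assms])

lemma op_bounded_pair_index:
  "op_bounded {..<n * k} (entries A) c \<longleftrightarrow> op_bounded ({..<n} \<times> {..<k}) (\<lambda>(p,x) (q,y). A $$ (p * k + x, q * k + y)) c"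
  unfolding op_bounded_reindex[OF bij_index] by (rule op_bounded_cong) auto

section \<open>The cb-norm as a bound for all ancillas\<close>

text \<open>A real \<open>Sup\<close> says nothing about an unbounded set. The crude bound serves
  every ancilla size \<open>k\<close> at once.\<close>

lemma cb_set_bdd:
  assumes S: "lin_map n1 n2 S"
  shows "bdd_above {opnorm (n1 * k) (ampl n1 n2 k S A) | k A.
      k \<ge> 1 \<and> A \<in> carrier_mat (n2 * k) (n2 * k) \<and> opnorm (n2 * k) A \<le> 1}"
    (is "bdd_above ?X")
proof -
  let ?d = "\<Sum>r<n1. \<Sum>c<n1. \<Sum>p<n2. \<Sum>q<n2. cmod (map_coeff n2 S r c p q)"
  have d: "?d \<ge> 0" by (intro sum_nonneg) auto
  show ?thesis
  proof (rule bdd_aboveI[of _ ?d])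
    fix z assume "z \<in> ?X"
    then obtain k A where z: "z = opnorm (n1 * k) (ampl n1 n2 k S A)" "A \<in> carrier_mat (n2 * k) (n2 * k)"
      "opnorm (n2 * k) A \<le> 1" by auto
    have "op_bounded {..<n2 * k} (entries A) 1" by (rule op_bounded_mono[OF op_bounded_opnorm[OF z(2)] z(3)])
    then have "op_bounded ({..<n1} \<times> {..<k}) (ampl_kernel {..<n2} (map_coeff n2 S) (\<lambda>(p,x) (q,y). A $$ (p * k + x, q * k + y))) (?d * 1)"
      unfolding op_bounded_pair_index by (intro cbbD[OF cb_bounded_crude]) auto
    then show "z \<le> ?d" unfolding z(1) using d
      by (intro opnorm_le) (auto simp: op_bounded_ampl[OF S])
  qed
qed

lemma opnorm_zero: "opnorm n (0\<^sub>m n n) \<le> c" if "0 \<le> c"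
  using that by (intro opnorm_le) (auto simp: op_bounded_def sesq_form_def)

lemma cb_set_nonempty:
  "opnorm (n1 * 1) (ampl n1 n2 1 S (0\<^sub>m (n2 * 1) (n2 * 1))) \<in> {opnorm (n1 * k) (ampl n1 n2 k S A) | k A.
      k \<ge> 1 \<and> A \<in> carrier_mat (n2 * k) (n2 * k) \<and> opnorm (n2 * k) A \<le> 1}"
  by (rule CollectI, rule exI[of _ 1], rule exI[of _ "0\<^sub>m (n2 * 1) (n2 * 1)"]) (use opnorm_zero[of 1 "n2"] in auto)

lemma cb_norm_nonneg:
  assumes S: "lin_map n1 n2 S" shows "0 \<le> cb_norm n1 n2 S"
proof -
  have "0 \<le> opnorm (n1 * 1) (ampl n1 n2 1 S (0\<^sub>m (n2 * 1) (n2 * 1)))" by (rule opnorm_nonneg) (rule ampl_carrier)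
  also have "\<dots> \<le> cb_norm n1 n2 S" unfolding cb_norm_def by (rule cSup_upper[OF cb_set_nonempty cb_set_bdd[OF S]])
  finally show ?thesis .
qed

lemma cb_norm_leI:
  assumes S: "lin_map n1 n2 S" and b: "cb_bounded {..<n1} {..<n2} (map_coeff n2 S) \<delta>" and d: "0 \<le> \<delta>"
  shows "cb_norm n1 n2 S \<le> \<delta>"
  unfolding cb_norm_def
proof (rule cSup_least)
  show "{opnorm (n1 * k) (ampl n1 n2 k S A) | k A. k \<ge> 1 \<and> A \<in> carrier_mat (n2 * k) (n2 * k) \<and> opnorm (n2 * k) A \<le> 1} \<noteq> {}"
    using cb_set_nonempty by blast
  fix z assume "z \<in> {opnorm (n1 * k) (ampl n1 n2 k S A) | k A. k \<ge> 1 \<and> A \<in> carrier_mat (n2 * k) (n2 * k) \<and> opnorm (n2 * k) A \<le> 1}"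
  then obtain k A where z: "z = opnorm (n1 * k) (ampl n1 n2 k S A)" "A \<in> carrier_mat (n2 * k) (n2 * k)"
      "opnorm (n2 * k) A \<le> 1" by auto
  have "op_bounded {..<n2 * k} (entries A) 1" by (rule op_bounded_mono[OF op_bounded_opnorm[OF z(2)] z(3)])
  then have "op_bounded ({..<n1} \<times> {..<k}) (ampl_kernel {..<n2} (map_coeff n2 S) (\<lambda>(p,x) (q,y). A $$ (p * k + x, q * k + y))) (\<delta> * 1)"
    unfolding op_bounded_pair_index by (intro cbbD[OF b]) auto
  then show "z \<le> \<delta>" unfolding z(1) using d by (intro opnorm_le) (auto simp: op_bounded_ampl[OF S])
qed

lemma op_bounded_empty: "op_bounded {} A c"
  by (simp add: op_bounded_def sesq_form_def l2norm_def)

text \<open>Relabel the ancilla as \<open>{..<k}\<close>, scale \<open>A\<close> by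
  \<open>1/c\<close> into the unit ball, and undo both after applying \<open>S\<close>. The empty
  ancilla is treated apart because \<open>cb_norm\<close> ranges over
  \<open>k \<ge> 1\<close>.\<close>

lemma cb_bounded_cb_norm:
  assumes S: "lin_map n1 n2 S" and d: "cb_norm n1 n2 S \<le> \<delta>"
  shows "cb_bounded {..<n1} {..<n2} (map_coeff n2 S) \<delta>"
  unfolding cb_bounded_def
proof (intro allI impI, elim conjE)
  fix K :: "nat set" and A :: "nat \<times> nat \<Rightarrow> nat \<times> nat \<Rightarrow> complex" and c :: real
  assume K: "finite K" and c: "c > 0" and A: "op_bounded ({..<n2} \<times> K) A c"
  show "op_bounded ({..<n1} \<times> K) (ampl_kernel {..<n2} (map_coeff n2 S) A) (\<delta> * c)"
  proof (cases "K = {}")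
    case False
    define k where "k = card K"
    have k: "k \<ge> 1" using False K by (simp add: k_def Suc_leI card_gt_0_iff)
    obtain h where h: "bij_betw h {..<k} K"
      using ex_bij_betw_nat_finite[OF K] by (auto simp: k_def atLeast0LessThan)
    have b: "bij_betw (map_prod id h) (X \<times> {..<k}) (X \<times> K)" for X :: "nat set"
      by (rule bij_betw_map_prod) (auto simp: h)
    define B where "B = mat (n2 * k) (n2 * k) (\<lambda>(u,v). complex_of_real (1/c) * A (u div k, h (u mod k)) (v div k, h (v mod k)))"
    have B: "B \<in> carrier_mat (n2 * k) (n2 * k)" by (simp add: B_def)
    have "op_bounded ({..<n2} \<times> {..<k}) (\<lambda>i j. complex_of_real (1/c) * A (map_prod id h i) (map_prod id h j)) (cmod (1/c) * c)"
      using A unfolding op_bounded_reindex[OF b] by (rule op_bounded_scale)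
    then have "op_bounded ({..<n2} \<times> {..<k}) (\<lambda>i j. complex_of_real (1/c) * A (map_prod id h i) (map_prod id h j)) 1"
      using c by (simp add: norm_divide)
    then have "op_bounded {..<n2 * k} (entries B) 1"
      unfolding op_bounded_pair_index using c
      by (subst op_bounded_cong[where A'="\<lambda>i j. complex_of_real (1/c) * A (map_prod id h i) (map_prod id h j)"])
         (auto simp: B_def index_bound)
    then have "opnorm (n2 * k) B \<le> 1" using B by (intro opnorm_le) auto
    then have "opnorm (n1 * k) (ampl n1 n2 k S B) \<le> cb_norm n1 n2 S"
      unfolding cb_norm_def using k B by (intro cSup_upper[OF _ cb_set_bdd[OF S]]) auto
    then have "op_bounded {..<n1 * k} (entries (ampl n1 n2 k S B)) \<delta>"
      using d by (intro op_bounded_mono[OF op_bounded_opnorm[OF ampl_carrier]]) simp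
    then have "op_bounded ({..<n1} \<times> {..<k}) (\<lambda>i j. complex_of_real c * ampl_kernel {..<n2} (map_coeff n2 S) (\<lambda>(p,x) (q,y). B $$ (p * k + x, q * k + y)) i j) (cmod (complex_of_real c) * \<delta>)"
      unfolding op_bounded_ampl[OF S] by (rule op_bounded_scale)
    moreover have "complex_of_real c * ampl_kernel {..<n2} (map_coeff n2 S) (\<lambda>(p,x) (q,y). B $$ (p * k + x, q * k + y)) (r,x) (r',y)
       = ampl_kernel {..<n2} (map_coeff n2 S) A (r, h x) (r', h y)" if "x < k" "y < k" for r r' x y
    proof -
      have key: "map_coeff n2 S r r' p q * A (p, h x) (q, h y) = complex_of_real c * (map_coeff n2 S r r' p q * B $$ (p * k + x, q * k + y))"
        if "p < n2" "q < n2" for p q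
        using that \<open>x < k\<close> \<open>y < k\<close> c by (simp add: B_def index_bound)
      show ?thesis
        unfolding ampl_kernel_def by (simp only: sum_distrib_left split_conv) (intro sum.cong refl key[symmetric], auto)
    qed
    ultimately show ?thesis
      unfolding op_bounded_reindex[OF b] using c
      by (subst op_bounded_cong[where A'="\<lambda>i j. complex_of_real c * ampl_kernel {..<n2} (map_coeff n2 S) (\<lambda>(p,x) (q,y). B $$ (p * k + x, q * k + y)) i j"])
         (auto simp: mult.commute[of c])
  qed (simp add: op_bounded_empty)
qed

section \<open>Positivity and channels from Kraus operators\<close>

lemma psd_iff:
  assumes "M \<in> carrier_mat n n"
  shows "psd n M \<longleftrightarrow> (\<forall>v. Im (sesq_form {..<n} v (entries M) v) = 0 \<and> Re (sesq_form {..<n} v (entries M) v) \<ge> 0)"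
proof -
  have e: "(\<Sum>i<n. cnj (v $ i) * (M *\<^sub>v v) $ i) = sesq_form {..<n} (\<lambda>i. v $ i) (entries M) (\<lambda>i. v $ i)"
    if "v \<in> carrier_vec n" for v
    using assms that by (auto simp: sesq_form_def mult_mat_vec_entry sum_distrib_left mult.assoc simp del: index_mult_mat_vec intro!: sum.cong)
  have e2: "sesq_form {..<n} v (entries M) v = sesq_form {..<n} (\<lambda>i. vec n v $ i) (entries M) (\<lambda>i. vec n v $ i)" for v
    by (rule sesq_form_cong) auto
  show ?thesis
    unfolding psd_def Let_def using assms e e2 by (metis (no_types, lifting) vec_carrier)
qed

text \<open>Complete positivity is visible from \<open>sesq_form_kraus\<close>: with equal vectors
  on both sides, the amplified form is a sum of values of the form of \<open>A\<close>, again with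
  equal vectors on both sides.\<close>

lemma channel_kraus:
  assumes unital: "\<And>r c. r < n1 \<Longrightarrow> c < n1 \<Longrightarrow> (\<Sum>t\<in>T. \<Sum>p<n2. B t r p * cnj (B t c p)) = (if r = c then 1 else 0)"
  shows "channel n1 n2 (coeff_map n1 n2 (kraus T B))"
  unfolding channel_def
proof (intro conjI)
  show lin: "lin_map n1 n2 (coeff_map n1 n2 (kraus T B))" by (rule lin_map_coeff_map)
  show "coeff_map n1 n2 (kraus T B) (1\<^sub>m n2) = 1\<^sub>m n1"
  proof (rule eq_matI)
    fix r c assume "r < dim_row (1\<^sub>m n1 :: complex mat)" "c < dim_col (1\<^sub>m n1 :: complex mat)"
    then have rc: "r < n1" "c < n1" by auto
    have "coeff_map n1 n2 (kraus T B) (1\<^sub>m n2) $$ (r,c) = (\<Sum>p<n2. \<Sum>q<n2. if p = q then kraus T B r c p p else 0)"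
      unfolding coeff_map_entry[OF rc] by (intro sum.cong refl) auto
    also have "\<dots> = (\<Sum>p<n2. kraus T B r c p p)"
      by (intro sum.cong) auto
    also have "\<dots> = (\<Sum>t\<in>T. \<Sum>p<n2. B t r p * cnj (B t c p))"
      unfolding kraus_def by (rule sum.swap)
    also have "\<dots> = (1\<^sub>m n1) $$ (r,c)" using rc unital by auto
    finally show "coeff_map n1 n2 (kraus T B) (1\<^sub>m n2) $$ (r,c) = (1\<^sub>m n1) $$ (r,c)" .
  qed (auto simp: coeff_map_def)
  show "completely_positive n1 n2 (coeff_map n1 n2 (kraus T B))"
    unfolding completely_positive_def
  proof (intro allI impI)
    fix k :: nat and A assume "k \<ge> 1" and A: "psd (n2 * k) A"
    let ?A = "\<lambda>(p,x) (q,y). A $$ (p * k + x, q * k + y)"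
    have Ac: "A \<in> carrier_mat (n2 * k) (n2 * k)" using A by (simp add: psd_def)
    have pos: "Im (sesq_form ({..<n2} \<times> {..<k}) u ?A u) = 0 \<and> Re (sesq_form ({..<n2} \<times> {..<k}) u ?A u) \<ge> 0" for u
    proof -
      have "sesq_form ({..<n2} \<times> {..<k}) u ?A u = sesq_form {..<n2 * k} (\<lambda>i. u (i div k, i mod k)) (entries A) (\<lambda>i. u (i div k, i mod k))"
        unfolding sesq_form_reindex[OF bij_index] by (rule sesq_form_cong) auto
      then show ?thesis using A unfolding psd_iff[OF Ac] by simp
    qed
    have "sesq_form {..<n1 * k} v (entries (ampl n1 n2 k (coeff_map n1 n2 (kraus T B)) A)) v =
       (\<Sum>t\<in>T. sesq_form ({..<n2} \<times> {..<k}) (kraus_vec {..<n1} (B t) (\<lambda>(r,x). v (r * k + x))) ?A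
          (kraus_vec {..<n1} (B t) (\<lambda>(r,x). v (r * k + x))))" for v
    proof -
      have "sesq_form {..<n1 * k} v (entries (ampl n1 n2 k (coeff_map n1 n2 (kraus T B)) A)) v =
        sesq_form ({..<n1} \<times> {..<k}) (\<lambda>(r,x). v (r * k + x)) (ampl_kernel {..<n2} (kraus T B) ?A) (\<lambda>(r,x). v (r * k + x))"
        unfolding sesq_form_reindex[OF bij_index]
        by (rule sesq_form_cong) (auto simp: ampl_entry[OF lin] ampl_kernel_def map_coeff_coeff_map)
      then show ?thesis by (simp only: sesq_form_kraus)
    qed
    then show "psd (n1 * k) (ampl n1 n2 k (coeff_map n1 n2 (kraus T B)) A)"
      unfolding psd_iff[OF ampl_carrier] using pos by (auto simp: Im_sum Re_sum intro!: sum_nonneg)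
  qed
qed

section \<open>Tensor powers in digit coordinates\<close>

text \<open>Digit 0 is the least significant one: under the index convention
  \<open>i * d + k\<close>, the factor that \<open>tensor_pow\<close> adds at \<open>Suc n\<close>
  is the lowest digit, and the earlier factors move up by one.\<close>

definition digit :: "nat \<Rightarrow> nat \<Rightarrow> nat \<Rightarrow> nat" where
  "digit d r i = r div d ^ i mod d"

lemma digit_0: "digit d r 0 = r mod d"
  by (simp add: digit_def)

lemma digit_Suc: "digit d r (Suc i) = digit d (r div d) i"
  by (simp add: digit_def div_mult2_eq)

lemma digit_less: "0 < d \<Longrightarrow> digit d r i < d"
  by (simp add: digit_def)

lemma div_less_power: "r < d ^ Suc n \<Longrightarrow> r div d < (d::nat) ^ n"
  by (simp add: less_mult_imp_div_less mult.commute)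

lemma digit_inject:
  assumes "r < d ^ n" "c < d ^ n" "\<And>i. i < n \<Longrightarrow> digit d r i = digit d c i"
  shows "r = c"
  using assms
proof (induction n arbitrary: r c)
  case (Suc n)
  have "r div d = c div d"
    by (rule Suc.IH) (use Suc.prems div_less_power in \<open>auto simp: digit_Suc[symmetric]\<close>)
  moreover have "r mod d = c mod d" using Suc.prems(3)[of 0] by (simp add: digit_0)
  ultimately show ?case by (metis div_mult_mod_eq)
qed auto

lemma digit_surj:
  assumes "\<And>i. i < n \<Longrightarrow> x i < d"
  shows "\<exists>r<d ^ n. \<forall>i<n. digit d r i = x i"
  using assms
proof (induction n arbitrary: x)
  case (Suc n)
  obtain r where r: "r < d ^ n" "\<forall>i<n. digit d r i = x (Suc i)"
    using Suc.IH[of "\<lambda>i. x (Suc i)"] Suc.prems by auto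
  have x0: "x 0 < d" using Suc.prems by auto
  have "digit d (r * d + x 0) i = x i" if "i < Suc n" for i
    using that x0 r by (cases i) (auto simp: digit_0 digit_Suc)
  moreover have "r * d + x 0 < d ^ Suc n"
    using index_bound[OF r(1) x0] by (simp add: mult.commute)
  ultimately show ?case by blast
qed auto

lemma delta_digits:
  assumes "r < d ^ n" "c < d ^ n"
  shows "(if r = c then 1 else 0 :: complex) = (\<Prod>i<n. if digit d r i = digit d c i then 1 else 0)"
proof (cases "r = c")
  case False
  then obtain i where "i < n" "digit d r i \<noteq> digit d c i" using digit_inject assms by blast
  then have "(\<Prod>i<n. if digit d r i = digit d c i then 1 else 0 :: complex) = 0"
    by (intro prod_zero) auto
  with False show ?thesis by simp
qed simp

text \<open>The distributive law over base-\<open>d\<close> expansions. It makes images of the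
  identity and inner products of graph states factor over sites.\<close>

lemma sum_digits:
  fixes f :: "nat \<Rightarrow> nat \<Rightarrow> complex"
  shows "(\<Sum>p<d ^ n. \<Prod>i<n. f i (digit d p i)) = (\<Prod>i<n. \<Sum>x<d. f i x)"
proof (induction n arbitrary: f)
  case (Suc n)
  have "(\<Sum>p<d ^ Suc n. \<Prod>i<Suc n. f i (digit d p i)) = (\<Sum>u<d ^ n. \<Sum>x<d. \<Prod>i<Suc n. f i (digit d (u * d + x) i))"
    by (simp only: power_Suc2 sum_index)
  also have "\<dots> = (\<Sum>u<d ^ n. \<Sum>x<d. f 0 x * (\<Prod>i<n. f (Suc i) (digit d u i)))"
    by (intro sum.cong refl) (simp add: prod.lessThan_Suc_shift digit_0 digit_Suc del: prod.lessThan_Suc)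
  also have "\<dots> = (\<Sum>x<d. f 0 x) * (\<Sum>u<d ^ n. \<Prod>i<n. f (Suc i) (digit d u i))"
    by (simp add: sum_product sum.swap[of _ "{..<d}" "{..<d^n}"])
  finally show ?case
    by (simp add: Suc.IH[of "\<lambda>i. f (Suc i)"] prod.lessThan_Suc_shift del: prod.lessThan_Suc)
qed simp

section \<open>Site-wise products of coefficients\<close>

type_synonym coeffs = "nat \<Rightarrow> nat \<Rightarrow> nat \<Rightarrow> nat \<Rightarrow> complex"

definition site_tensor :: "nat \<Rightarrow> nat \<Rightarrow> (nat \<Rightarrow> coeffs) \<Rightarrow> coeffs" where
  "site_tensor d n s = (\<lambda>r c p q. \<Prod>i<n. s i (digit d r i) (digit d c i) (digit d p i) (digit d q i))"

definition id_coeff :: coeffs where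
  "id_coeff = (\<lambda>r c p q. if r = p \<and> c = q then 1 else 0)"

lemma site_tensor_Suc: "site_tensor d (Suc n) s r c p q =
    site_tensor d n (\<lambda>i. s (Suc i)) (r div d) (c div d) (p div d) (q div d) * s 0 (r mod d) (c mod d) (p mod d) (q mod d)"
  by (simp add: site_tensor_def prod.lessThan_Suc_shift digit_0 digit_Suc mult.commute del: prod.lessThan_Suc)

lemma cb_bounded_id_coeff: "cb_bounded {..<n} {..<n} id_coeff 1"
proof -
  let ?B = "\<lambda>(t::unit) r p. if r = p then 1 else 0 :: complex"
  have "cb_bounded {..<n} {..<n} (kraus {()} ?B) 1"
  proof (rule cb_bounded_kraus)
    fix r c assume "r \<in> {..<n}" "c \<in> {..<n}"
    have "(\<Sum>p<n. ?B () r p * cnj (?B () c p)) = (\<Sum>p<n. if p = r then if r = c then 1 else 0 else 0)"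
      by (intro sum.cong) auto
    then show "(\<Sum>t\<in>{()}. \<Sum>p\<in>{..<n}. ?B t r p * cnj (?B t c p)) = (if r = c then 1 else 0)"
      using \<open>r \<in> {..<n}\<close> by simp
  qed simp
  then show ?thesis
    by (subst cb_bounded_cong[of _ _ _ "kraus {()} ?B"]) (auto simp: kraus_def id_coeff_def)
qed

text \<open>Splitting off the lowest digit exhibits the product as a \<open>pair_tensor\<close>, so
  the bounds multiply one site at a time.\<close>

lemma cb_bounded_site_tensor:
  assumes "\<And>i. i < n \<Longrightarrow> cb_bounded {..<d} {..<d} (s i) (\<delta> i)" "\<And>i. i < n \<Longrightarrow> \<delta> i > 0"
  shows "cb_bounded {..<d ^ n} {..<d ^ n} (site_tensor d n s) (\<Prod>i<n. \<delta> i)"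
  using assms
proof (induction n arbitrary: s \<delta>)
  case 0
  show ?case using cb_bounded_id_coeff[of 1] by (subst cb_bounded_cong[of _ _ _ id_coeff]) (auto simp: site_tensor_def id_coeff_def)
next
  case (Suc n)
  let ?f = "\<lambda>u. (u div d, u mod d)"
  have b: "bij_betw ?f {..<d ^ Suc n} ({..<d ^ n} \<times> {..<d})"
    using bij_divmod[of d "d ^ n"] by (simp add: mult.commute)
  have "cb_bounded {..<d ^ n} {..<d ^ n} (site_tensor d n (\<lambda>i. s (Suc i))) (\<Prod>i<n. \<delta> (Suc i))"
    using Suc.prems by (intro Suc.IH) auto
  then have "cb_bounded ({..<d ^ n} \<times> {..<d}) ({..<d ^ n} \<times> {..<d}) (pair_tensor (site_tensor d n (\<lambda>i. s (Suc i))) (s 0)) ((\<Prod>i<n. \<delta> (Suc i)) * \<delta> 0)"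
    using Suc.prems by (intro cb_bounded_tensor) auto
  from cb_bounded_reindex[OF b b this]
  have "cb_bounded {..<d ^ Suc n} {..<d ^ Suc n} (site_tensor d (Suc n) s) ((\<Prod>i<n. \<delta> (Suc i)) * \<delta> 0)"
    by (simp add: site_tensor_Suc pair_tensor_def fun_eq_iff[symmetric] cong: cb_bounded_cong)
  then show ?case by (simp add: prod.lessThan_Suc_shift mult.commute del: prod.lessThan_Suc power_Suc)
qed

lemma coeff_map_cong:
  assumes "\<And>r c p q. r < n1 \<Longrightarrow> c < n1 \<Longrightarrow> p < n2 \<Longrightarrow> q < n2 \<Longrightarrow> s r c p q = s' r c p q"
  shows "coeff_map n1 n2 s A = coeff_map n1 n2 s' A"
  by (intro eq_matI) (auto simp: coeff_map_def assms intro!: sum.cong)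

lemma coeff_map_id_coeff:
  assumes "A \<in> carrier_mat n n"
  shows "coeff_map n n id_coeff A = A"
proof (rule eq_matI)
  fix r c assume "r < dim_row A" "c < dim_col A"
  then have rc: "r < n" "c < n" using assms by auto
  have "coeff_map n n id_coeff A $$ (r,c) = (\<Sum>p<n. \<Sum>q<n. A $$ (p,q) * (if p = r \<and> q = c then 1 else 0))"
    unfolding coeff_map_entry[OF rc] by (intro sum.cong refl) (auto simp: id_coeff_def)
  then show "coeff_map n n id_coeff A $$ (r,c) = A $$ (r,c)" using rc by (simp add: sum_delta2)
qed (use assms in \<open>auto simp: coeff_map_def\<close>)

lemma tensor_pow_coeff_map:
  assumes T: "lin_map d d T" and A: "A \<in> carrier_mat (d ^ n) (d ^ n)"
  shows "tensor_pow d T n A = coeff_map (d ^ n) (d ^ n) (site_tensor d n (\<lambda>_. map_coeff d T)) A"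
  using A
proof (induction n arbitrary: A)
  case 0
  have "coeff_map 1 1 (site_tensor d 0 (\<lambda>_. map_coeff d T)) A = coeff_map 1 1 id_coeff A"
    by (rule coeff_map_cong) (auto simp: site_tensor_def id_coeff_def)
  then show ?case using 0 coeff_map_id_coeff[of A 1] by simp
next
  case (Suc n)
  have car: "tensor_pow d T n (munit (d ^ n) i j) \<in> carrier_mat (d ^ n) (d ^ n)" for i j
    by (subst Suc.IH) auto
  have cfe: "map_coeff (d ^ n) (tensor_pow d T n) r c p q = site_tensor d n (\<lambda>_. map_coeff d T) r c p q"
    if "r < d ^ n" "c < d ^ n" "p < d ^ n" "q < d ^ n" for r c p q
  proof -
    have "map_coeff (d ^ n) (tensor_pow d T n) r c p q = map_coeff (d ^ n) (coeff_map (d ^ n) (d ^ n) (site_tensor d n (\<lambda>_. map_coeff d T))) r c p q"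
      unfolding map_coeff_def[of "d ^ n"] by (subst Suc.IH) auto
    then show ?thesis using map_coeff_coeff_map[OF that] by simp
  qed
  have "tensor_pow d T (Suc n) A = coeff_map (d ^ n * d) (d ^ n * d) (\<lambda>r c p q.
     map_coeff (d ^ n) (tensor_pow d T n) (r div d) (c div d) (p div d) (q div d) * map_coeff d T (r mod d) (c mod d) (p mod d) (q mod d)) A"
    unfolding tensor_pow.simps using car T by (intro tensor_map_coeff_map) (auto simp: lin_map_def)
  also have "\<dots> = coeff_map (d ^ n * d) (d ^ n * d) (site_tensor d (Suc n) (\<lambda>_. map_coeff d T)) A"
    by (rule coeff_map_cong) (simp add: site_tensor_Suc cfe less_mult_imp_div_less)
  finally show ?case by (simp add: mult.commute)
qed

lemma site_tensor_expand:
  assumes "0 < d" "\<And>r c p q. r < d \<Longrightarrow> c < d \<Longrightarrow> p < d \<Longrightarrow> q < d \<Longrightarrow> t r c p q = \<rho> r c p q + id_coeff r c p q"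
  shows "site_tensor d n (\<lambda>_. t) r c p q = (\<Sum>S\<in>Pow {..<n}. site_tensor d n (\<lambda>i. if i \<in> S then \<rho> else id_coeff) r c p q)"
proof -
  have "site_tensor d n (\<lambda>_. t) r c p q = (\<Prod>i<n. \<rho> (digit d r i) (digit d c i) (digit d p i) (digit d q i) + id_coeff (digit d r i) (digit d c i) (digit d p i) (digit d q i))"
    unfolding site_tensor_def by (intro prod.cong refl) (auto simp: assms digit_less)
  also have "\<dots> = (\<Sum>S\<in>Pow {..<n}. (\<Prod>i\<in>S. \<rho> (digit d r i) (digit d c i) (digit d p i) (digit d q i)) *
      (\<Prod>i\<in>{..<n} - S. id_coeff (digit d r i) (digit d c i) (digit d p i) (digit d q i)))"
    by (rule prod_add) simp
  also have "\<dots> = (\<Sum>S\<in>Pow {..<n}. site_tensor d n (\<lambda>i. if i \<in> S then \<rho> else id_coeff) r c p q)"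
  proof (rule sum.cong[OF refl])
    fix S assume "S \<in> Pow {..<n}"
    then have S: "{..<n} \<inter> S = S" "{..<n} \<inter> - S = {..<n} - S" by auto
    have "site_tensor d n (\<lambda>i. if i \<in> S then \<rho> else id_coeff) r c p q =
       (\<Prod>i<n. if i \<in> S then \<rho> (digit d r i) (digit d c i) (digit d p i) (digit d q i) else id_coeff (digit d r i) (digit d c i) (digit d p i) (digit d q i))"
      unfolding site_tensor_def by (intro prod.cong) auto
    then show "(\<Prod>i\<in>S. \<rho> (digit d r i) (digit d c i) (digit d p i) (digit d q i)) *
      (\<Prod>i\<in>{..<n} - S. id_coeff (digit d r i) (digit d c i) (digit d p i) (digit d q i)) = site_tensor d n (\<lambda>i. if i \<in> S then \<rho> else id_coeff) r c p q"
      by (simp add: prod.If_cases S)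
  qed
  finally show ?thesis .
qed

section \<open>Decoding a pure code\<close>

definition coeff_comp :: "nat \<Rightarrow> coeffs \<Rightarrow> coeffs \<Rightarrow> coeffs" where
  "coeff_comp N s t = (\<lambda>r c p q. \<Sum>a<N. \<Sum>b<N. s r c a b * t a b p q)"

lemma coeff_comp_assoc:
  "coeff_comp N s (coeff_comp N' t u) r c p q = coeff_comp N' (coeff_comp N s t) u r c p q"
proof -
  have "coeff_comp N s (coeff_comp N' t u) r c p q = (\<Sum>a<N. \<Sum>b<N. \<Sum>a'<N'. \<Sum>b'<N'. s r c a b * t a b a' b' * u a' b' p q)"
    by (simp add: coeff_comp_def sum_distrib_left mult.assoc)
  also have "\<dots> = (\<Sum>a'<N'. \<Sum>b'<N'. \<Sum>a<N. \<Sum>b<N. s r c a b * t a b a' b' * u a' b' p q)"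
    by (rule sum_swap_pairs)
  finally show ?thesis by (simp add: coeff_comp_def sum_distrib_right)
qed

lemma coeff_map_comp:
  "coeff_map n1 n2 s (coeff_map n2 n3 t A) = coeff_map n1 n3 (coeff_comp n2 s t) A"
proof (rule eq_matI)
  fix r c assume "r < dim_row (coeff_map n1 n3 (coeff_comp n2 s t) A)" "c < dim_col (coeff_map n1 n3 (coeff_comp n2 s t) A)"
  then have rc: "r < n1" "c < n1" by (auto simp: coeff_map_def)
  have "coeff_map n1 n2 s (coeff_map n2 n3 t A) $$ (r,c) = (\<Sum>a<n2. \<Sum>b<n2. s r c a b * (\<Sum>p<n3. \<Sum>q<n3. t a b p q * A $$ (p,q)))"
    unfolding coeff_map_entry[OF rc] by (intro sum.cong refl) (simp add: coeff_map_entry)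
  also have "\<dots> = (\<Sum>a<n2. \<Sum>b<n2. \<Sum>p<n3. \<Sum>q<n3. s r c a b * t a b p q * A $$ (p,q))"
    by (simp add: sum_distrib_left mult.assoc)
  also have "\<dots> = (\<Sum>p<n3. \<Sum>q<n3. \<Sum>a<n2. \<Sum>b<n2. s r c a b * t a b p q * A $$ (p,q))"
    by (rule sum_swap_pairs)
  also have "\<dots> = coeff_map n1 n3 (coeff_comp n2 s t) A $$ (r,c)"
    unfolding coeff_map_entry[OF rc] by (simp add: coeff_comp_def sum_distrib_right)
  finally show "coeff_map n1 n2 s (coeff_map n2 n3 t A) $$ (r,c) = coeff_map n1 n3 (coeff_comp n2 s t) A $$ (r,c)" .
qed (auto simp: coeff_map_def)

text \<open>The columns of \<open>K s\<close> are the codewords after the error \<open>s\<close>.  Purity means that distinct errors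
  map the code space to orthogonal subspaces, so that measuring which subspace occurs identifies the error.\<close>

locale pure_code =
  fixes N M :: nat and \<E> :: "'e set" and K :: "'e \<Rightarrow> nat \<Rightarrow> nat \<Rightarrow> complex" and e0 :: 'e
  assumes fin: "finite \<E>" and e0: "e0 \<in> \<E>" and M: "0 < M"
    and orth: "\<And>s t p q. s \<in> \<E> \<Longrightarrow> t \<in> \<E> \<Longrightarrow> p < M \<Longrightarrow> q < M \<Longrightarrow>
      (\<Sum>r<N. cnj (K s r p) * K t r q) = (if s = t \<and> p = q then 1 else 0)"
begin

text \<open>By \<open>orth\<close> the columns of all \<open>K s\<close> together are orthonormal,
  so this is the orthogonal projection onto the span of all error spaces.\<close>

definition proj :: "nat \<Rightarrow> nat \<Rightarrow> complex" where
  "proj r c = (\<Sum>s\<in>\<E>. \<Sum>p<M. K s r p * cnj (K s c p))"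

definition coproj :: "nat \<Rightarrow> nat \<Rightarrow> complex" where
  "coproj r c = (if r = c then 1 else 0) - proj r c"

lemma cnj_proj: "cnj (proj r c) = proj c r"
  by (simp add: proj_def mult.commute)

lemma cnj_coproj: "cnj (coproj r c) = coproj c r"
  by (simp add: coproj_def cnj_proj)

lemma proj_fix:
  assumes "s \<in> \<E>" "p < M"
  shows "(\<Sum>t<N. proj r t * K s t p) = K s r p"
proof -
  have "(\<Sum>t<N. proj r t * K s t p) = (\<Sum>t<N. \<Sum>u\<in>\<E>. \<Sum>q<M. K u r q * (cnj (K u t q) * K s t p))"
    by (simp add: proj_def sum_distrib_right mult.assoc)
  also have "\<dots> = (\<Sum>u\<in>\<E>. \<Sum>q<M. \<Sum>t<N. K u r q * (cnj (K u t q) * K s t p))"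
    by (rule sum_swap_inner[symmetric])
  also have "\<dots> = (\<Sum>u\<in>\<E>. \<Sum>q<M. K u r q * (if u = s \<and> q = p then 1 else 0))"
    unfolding sum_distrib_left[symmetric] using assms by (intro sum.cong refl) (simp add: orth)
  also have "\<dots> = (\<Sum>u\<in>\<E>. \<Sum>q<M. if q = p then if u = s then K u r q else 0 else 0)"
    by (intro sum.cong refl) auto
  also have "\<dots> = K s r p" using assms fin by simp
  finally show ?thesis .
qed

lemma coproj_kill:
  assumes "s \<in> \<E>" "p < M" "r < N"
  shows "(\<Sum>t<N. coproj r t * K s t p) = 0"
proof -
  have "(\<Sum>t<N. coproj r t * K s t p) = (\<Sum>t<N. if r = t then K s t p else 0) - (\<Sum>t<N. proj r t * K s t p)"
    unfolding sum_subtractf[symmetric] by (intro sum.cong refl) (auto simp: coproj_def algebra_simps)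
  then show ?thesis using assms by (simp add: proj_fix)
qed

lemma coproj_idem:
  assumes "r < N" "c < N"
  shows "(\<Sum>t<N. coproj r t * coproj t c) = coproj r c"
proof -
  have "(\<Sum>t<N. coproj r t * proj t c) = (\<Sum>t<N. \<Sum>u\<in>\<E>. \<Sum>q<M. (coproj r t * K u t q) * cnj (K u c q))"
    by (simp add: proj_def sum_distrib_left mult.assoc)
  also have "\<dots> = (\<Sum>u\<in>\<E>. \<Sum>q<M. \<Sum>t<N. (coproj r t * K u t q) * cnj (K u c q))"
    by (rule sum_swap_inner[symmetric])
  also have "\<dots> = 0"
    unfolding sum_distrib_right[symmetric] using assms by (simp add: coproj_kill)
  finally have "(\<Sum>t<N. coproj r t * proj t c) = 0" .
  moreover have "(\<Sum>t<N. coproj r t * coproj t c) = (\<Sum>t<N. if t = c then coproj r t else 0) - (\<Sum>t<N. coproj r t * proj t c)"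
    unfolding sum_subtractf[symmetric]
    by (intro sum.cong refl) (auto simp: coproj_def[of _ c] algebra_simps)
  ultimately show ?thesis using assms by simp
qed

text \<open>The operators indexed by \<open>Inr\<close> only serve to make the decoder unital; they act on the complement of all
  error spaces.\<close>

definition dec_ops :: "'e + nat \<Rightarrow> nat \<Rightarrow> nat \<Rightarrow> complex" where
  "dec_ops u r p = (case u of Inl s \<Rightarrow> K s r p | Inr t \<Rightarrow> (if p = 0 then coproj r t else 0))"

text \<open>In the Heisenberg picture encoding compresses observables: \<open>X\<close> goes to
  \<open>V* X V\<close>, where the columns of \<open>V\<close> are the codewords \<open>K e0\<close>
  after the trivial error.\<close>

definition enc_ops :: "unit \<Rightarrow> nat \<Rightarrow> nat \<Rightarrow> complex" where
  "enc_ops u p r = cnj (K e0 r p)"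

definition dec :: coeffs where "dec = kraus (\<E> <+> {..<N}) dec_ops"
definition enc :: coeffs where "enc = kraus {()} enc_ops"

text \<open>The \<open>Inl\<close> operators contribute \<open>proj\<close>; the \<open>Inr\<close>
  operators contribute the square of \<open>coproj\<close>, which is \<open>coproj\<close>
  itself.\<close>

lemma dec_unital:
  assumes "r < N" "c < N"
  shows "(\<Sum>u\<in>\<E> <+> {..<N}. \<Sum>p<M. dec_ops u r p * cnj (dec_ops u c p)) = (if r = c then 1 else 0)"
proof -
  have i: "(\<Sum>p<M. dec_ops (Inr t) r p * cnj (dec_ops (Inr t) c p)) = coproj r t * coproj t c" for t
  proof -
    have "(\<Sum>p<M. dec_ops (Inr t) r p * cnj (dec_ops (Inr t) c p)) = (\<Sum>p<M. if p = 0 then coproj r t * coproj t c else 0)"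
      by (intro sum.cong) (auto simp: dec_ops_def cnj_coproj)
    then show ?thesis using M by simp
  qed
  have "(\<Sum>u\<in>\<E> <+> {..<N}. \<Sum>p<M. dec_ops u r p * cnj (dec_ops u c p)) = proj r c + (\<Sum>t<N. coproj r t * coproj t c)"
    using fin by (simp add: sum.Plus i) (simp add: dec_ops_def proj_def)
  also have "\<dots> = (if r = c then 1 else 0)"
    using coproj_idem[OF assms] by (simp add: coproj_def)
  finally show ?thesis .
qed

lemma enc_unital:
  assumes "r < M" "c < M"
  shows "(\<Sum>u\<in>{()}. \<Sum>p<N. enc_ops u r p * cnj (enc_ops u c p)) = (if r = c then 1 else 0)"
  using orth[OF e0 e0 assms] by (simp add: enc_ops_def)

text \<open>Summing coefficients over equal last indices evaluates a map at the identity, so this is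
  unitality once more.\<close>

lemma dec_trace:
  assumes "r < N" "c < N" shows "(\<Sum>p<M. dec r c p p) = (if r = c then 1 else 0)"
  unfolding dec_def kraus_def by (subst sum.swap) (rule dec_unital[OF assms])

text \<open>The assumption on \<open>F\<close> says that it sends \<open>X\<close> to a combination
  of \<open>W (\<sigma> j)* X W (\<tau> j)\<close>. Encoding replaces each \<open>W\<close> by the
  corrupted codewords \<open>K\<close>. By orthogonality the decoder returns \<open>X\<close> if
  both labels agree and 0 otherwise, while its \<open>Inr\<close> operators annihilate every error
  space.\<close>

lemma enc_errors_dec:
  assumes F: "\<And>r c p q. r < N \<Longrightarrow> c < N \<Longrightarrow> p < N \<Longrightarrow> q < N \<Longrightarrow>
      F r c p q = (\<Sum>j\<in>J. f j * (cnj (W (\<sigma> j) p r) * W (\<tau> j) q c))"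
    and J: "finite J" "\<And>j. j \<in> J \<Longrightarrow> \<sigma> j \<in> \<E>" "\<And>j. j \<in> J \<Longrightarrow> \<tau> j \<in> \<E>"
    and W: "\<And>s r p. s \<in> \<E> \<Longrightarrow> r < N \<Longrightarrow> p < M \<Longrightarrow> K s r p = (\<Sum>c<N. W s r c * K e0 c p)"
    and ab: "a < M" "b < M" "m < M" "l < M"
  shows "coeff_comp N enc (coeff_comp N F dec) a b m l = (\<Sum>j\<in>J. if \<sigma> j = \<tau> j then f j else 0) * id_coeff a b m l"
proof -
  have EF: "coeff_comp N enc F a b p q = (\<Sum>j\<in>J. f j * (cnj (K (\<sigma> j) p a) * K (\<tau> j) q b))"
    if "p < N" "q < N" for p q
  proof -
    have "coeff_comp N enc F a b p q = (\<Sum>r<N. \<Sum>c<N. \<Sum>j\<in>J. f j * (cnj (W (\<sigma> j) p r * K e0 r a) * (W (\<tau> j) q c * K e0 c b)))"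
      unfolding coeff_comp_def using that
      by (intro sum.cong refl) (simp add: F enc_def kraus_def enc_ops_def sum_distrib_left mult_ac)
    also have "\<dots> = (\<Sum>j\<in>J. \<Sum>r<N. \<Sum>c<N. f j * (cnj (W (\<sigma> j) p r * K e0 r a) * (W (\<tau> j) q c * K e0 c b)))"
      by (rule sum_swap_inner)
    also have "\<dots> = (\<Sum>j\<in>J. f j * (cnj (\<Sum>r<N. W (\<sigma> j) p r * K e0 r a) * (\<Sum>c<N. W (\<tau> j) q c * K e0 c b)))"
      unfolding sum_product cnj_sum by (simp add: sum_distrib_left)
    also have "\<dots> = (\<Sum>j\<in>J. f j * (cnj (K (\<sigma> j) p a) * K (\<tau> j) q b))"
      using that ab J by (intro sum.cong refl) (simp add: W[symmetric])
    finally show ?thesis .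
  qed
  have KD: "(\<Sum>p<N. \<Sum>q<N. (cnj (K s p a) * K t q b) * dec p q m l) = (if s = t then id_coeff a b m l else 0)"
    if st: "s \<in> \<E>" "t \<in> \<E>" for s t
  proof -
    have ipl: "(\<Sum>p<N. cnj (K s' p a') * dec_ops (Inl u) p m') = (if s' = u \<and> a' = m' then 1 else 0)"
      if "s' \<in> \<E>" "u \<in> \<E>" "a' < M" "m' < M" for s' a' u m'
      using that by (simp add: dec_ops_def orth)
    have ipr: "(\<Sum>p<N. cnj (K s' p a') * dec_ops (Inr u) p m') = 0"
      if "s' \<in> \<E>" "a' < M" "u < N" for s' a' u m'
    proof -
      have "(\<Sum>p<N. cnj (K s' p a') * coproj p u) = cnj (\<Sum>p<N. coproj u p * K s' p a')"
        by (simp add: cnj_coproj mult.commute)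
      then show ?thesis using that by (cases "m' = 0") (simp_all add: dec_ops_def coproj_kill)
    qed
    have "(\<Sum>p<N. \<Sum>q<N. (cnj (K s p a) * K t q b) * dec p q m l) =
       (\<Sum>p<N. \<Sum>q<N. \<Sum>u\<in>\<E> <+> {..<N}. (cnj (K s p a) * dec_ops u p m) * cnj (cnj (K t q b) * dec_ops u q l))"
      by (simp add: dec_def kraus_def sum_distrib_left mult_ac)
    also have "\<dots> = (\<Sum>u\<in>\<E> <+> {..<N}. \<Sum>p<N. \<Sum>q<N. (cnj (K s p a) * dec_ops u p m) * cnj (cnj (K t q b) * dec_ops u q l))"
      by (rule sum_swap_inner)
    also have "\<dots> = (\<Sum>u\<in>\<E> <+> {..<N}. (\<Sum>p<N. cnj (K s p a) * dec_ops u p m) * cnj (\<Sum>q<N. cnj (K t q b) * dec_ops u q l))"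
      by (simp only: sum_product cnj_sum)
    also have "\<dots> = (\<Sum>u\<in>\<E>. (if s = u \<and> a = m then 1 else 0) * cnj (if t = u \<and> b = l then 1 else 0))"
      using fin st ab by (simp add: sum.Plus ipl ipr del: cnj_sum complex_cnj_mult)
    also have "\<dots> = (\<Sum>u\<in>\<E>. if u = s then if s = t then id_coeff a b m l else 0 else 0)"
      by (intro sum.cong refl) (auto simp: id_coeff_def)
    also have "\<dots> = (if s = t then id_coeff a b m l else 0)"
      using fin st by simp
    finally show ?thesis .
  qed
  have "coeff_comp N enc (coeff_comp N F dec) a b m l = (\<Sum>p<N. \<Sum>q<N. coeff_comp N enc F a b p q * dec p q m l)"
    unfolding coeff_comp_assoc by (simp add: coeff_comp_def[of N _ dec])
  also have "\<dots> = (\<Sum>p<N. \<Sum>q<N. \<Sum>j\<in>J. f j * ((cnj (K (\<sigma> j) p a) * K (\<tau> j) q b) * dec p q m l))"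
    by (intro sum.cong refl) (simp add: EF sum_distrib_right mult.assoc)
  also have "\<dots> = (\<Sum>j\<in>J. \<Sum>p<N. \<Sum>q<N. f j * ((cnj (K (\<sigma> j) p a) * K (\<tau> j) q b) * dec p q m l))"
    by (rule sum_swap_inner)
  also have "\<dots> = (\<Sum>j\<in>J. f j * (if \<sigma> j = \<tau> j then id_coeff a b m l else 0))"
    using J by (intro sum.cong refl) (simp add: sum_distrib_left[symmetric] KD)
  also have "\<dots> = (\<Sum>j\<in>J. if \<sigma> j = \<tau> j then f j else 0) * id_coeff a b m l"
    unfolding sum_distrib_right by (intro sum.cong) auto
  finally show ?thesis .
qed

text \<open>Both sides are the image of the identity. As the decoder is unital, that image depends
  on \<open>F\<close> only through its value at the identity.\<close>

lemma trace_enc_dec: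
  assumes "a < M" "b < M"
  shows "(\<Sum>m<M. coeff_comp N enc (coeff_comp N F dec) a b m m) = (\<Sum>r<N. \<Sum>c<N. enc a b r c * (\<Sum>p<N. F r c p p))"
proof -
  have "(\<Sum>m<M. coeff_comp N enc (coeff_comp N F dec) a b m m) = (\<Sum>r<N. \<Sum>c<N. \<Sum>m<M. enc a b r c * coeff_comp N F dec r c m m)"
    unfolding coeff_comp_def[of N enc] by (rule sum_swap_inner[symmetric])
  also have "\<dots> = (\<Sum>r<N. \<Sum>c<N. enc a b r c * (\<Sum>p<N. F r c p p))"
  proof (intro sum.cong refl)
    fix r c
    have "(\<Sum>m<M. coeff_comp N F dec r c m m) = (\<Sum>p<N. \<Sum>q<N. \<Sum>m<M. F r c p q * dec p q m m)"
      unfolding coeff_comp_def[of N F] by (rule sum_swap_inner[symmetric])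
    also have "\<dots> = (\<Sum>p<N. \<Sum>q<N. if p = q then F r c p q else 0)"
      unfolding sum_distrib_left[symmetric] by (intro sum.cong refl) (simp add: dec_trace)
    also have "\<dots> = (\<Sum>p<N. F r c p p)"
      by (intro sum.cong refl) simp
    finally show "(\<Sum>m<M. enc a b r c * coeff_comp N F dec r c m m) = enc a b r c * (\<Sum>p<N. F r c p p)"
      by (simp add: sum_distrib_left[symmetric])
  qed
  finally show ?thesis .
qed

lemma trace_enc_dec_unital:
  assumes tr: "\<And>r c. r < N \<Longrightarrow> c < N \<Longrightarrow> (\<Sum>p<N. F r c p p) = (if r = c then \<kappa> else 0)"
    and ab: "a < M" "b < M"
  shows "(\<Sum>m<M. coeff_comp N enc (coeff_comp N F dec) a b m m) = (if a = b then \<kappa> else 0)"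
proof -
  have "(\<Sum>m<M. coeff_comp N enc (coeff_comp N F dec) a b m m) = (\<Sum>r<N. \<Sum>c<N. if c = r then enc a b r c * \<kappa> else 0)"
    unfolding trace_enc_dec[OF ab] by (intro sum.cong refl) (auto simp: tr)
  also have "\<dots> = (\<Sum>r<N. enc a b r r * \<kappa>)" by (intro sum.cong refl) simp
  also have "\<dots> = (\<Sum>p<N. enc_ops () a p * cnj (enc_ops () b p)) * \<kappa>"
    by (simp add: enc_def kraus_def sum_distrib_right)
  also have "\<dots> = (if a = b then \<kappa> else 0)" using enc_unital[OF ab] by simp
  finally show ?thesis .
qed

text \<open>\<open>enc_errors_dec\<close> leaves an unknown scalar, a sum over coefficients
  \<open>f j\<close> that come from an expansion. Evaluation at the identity determines it without
  computing any of them.\<close>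

lemma enc_errors_dec_trace:
  assumes F: "\<And>r c p q. r < N \<Longrightarrow> c < N \<Longrightarrow> p < N \<Longrightarrow> q < N \<Longrightarrow>
      F r c p q = (\<Sum>j\<in>J. f j * (cnj (W (\<sigma> j) p r) * W (\<tau> j) q c))"
    and J: "finite J" "\<And>j. j \<in> J \<Longrightarrow> \<sigma> j \<in> \<E>" "\<And>j. j \<in> J \<Longrightarrow> \<tau> j \<in> \<E>"
    and W: "\<And>s r p. s \<in> \<E> \<Longrightarrow> r < N \<Longrightarrow> p < M \<Longrightarrow> K s r p = (\<Sum>c<N. W s r c * K e0 c p)"
    and tr: "\<And>r c. r < N \<Longrightarrow> c < N \<Longrightarrow> (\<Sum>p<N. F r c p p) = (if r = c then \<kappa> else 0)"
    and ab: "a < M" "b < M" "m < M" "l < M"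
  shows "coeff_comp N enc (coeff_comp N F dec) a b m l = \<kappa> * id_coeff a b m l"
proof -
  let ?z = "\<Sum>j\<in>J. if \<sigma> j = \<tau> j then f j else 0"
  have *: "coeff_comp N enc (coeff_comp N F dec) a b m l = ?z * id_coeff a b m l"
    if "a < M" "b < M" "m < M" "l < M" for a b m l
    by (rule enc_errors_dec[OF F J W that])
  have "\<kappa> = (\<Sum>m<M. coeff_comp N enc (coeff_comp N F dec) 0 0 m m)"
    using trace_enc_dec_unital[where F=F and \<kappa>=\<kappa> and a=0 and b=0, OF tr] M by simp
  also have "\<dots> = (\<Sum>m<M. if m = 0 then ?z else 0)"
    using M by (intro sum.cong refl) (auto simp: * id_coeff_def)
  also have "\<dots> = ?z" using M by simp
  finally show ?thesis using *[OF ab] by simp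
qed

end

section \<open>Counting graphs and codewords\<close>

text \<open>Labels \<open>(a,b)\<close> of the Weyl operators on \<open>n\<close> sites that act non-trivially on at most \<open>w\<close> of them.\<close>

definition weyl_labels :: "nat \<Rightarrow> nat \<Rightarrow> nat \<Rightarrow> (nat \<Rightarrow> nat \<times> nat) set" where
  "weyl_labels d n w = {\<sigma> \<in> {..<n} \<rightarrow>\<^sub>E {..<d} \<times> {..<d}. card {i. i < n \<and> \<sigma> i \<noteq> (0,0)} \<le> w}"

text \<open>Restricted to \<open>{..<n}\<close> so that it belongs to the finite function space
  behind \<open>weyl_labels\<close>.\<close>

definition zero_label :: "nat \<Rightarrow> nat \<Rightarrow> nat \<times> nat" where
  "zero_label n = (\<lambda>i\<in>{..<n}. (0,0))"

definition syndrome :: "nat \<Rightarrow> (nat \<Rightarrow> nat \<Rightarrow> int) \<Rightarrow> (nat \<Rightarrow> nat \<times> nat) \<Rightarrow> nat \<Rightarrow> int" where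
  "syndrome n G \<sigma> i = int (snd (\<sigma> i)) - (\<Sum>j<n. G i j * int (fst (\<sigma> j)))"

lemma zero_label_weyl_labels: "0 < d \<Longrightarrow> zero_label n \<in> weyl_labels d n w"
proof -
  assume "0 < d"
  have "{i. i < n \<and> zero_label n i \<noteq> (0,0)} = {}" by (auto simp: zero_label_def)
  then show ?thesis using \<open>0 < d\<close> by (auto simp: weyl_labels_def zero_label_def)
qed

lemma finite_weyl_labels: "finite (weyl_labels d n w)"
  unfolding weyl_labels_def by (rule finite_subset[OF _ finite_PiE[of "{..<n}" "\<lambda>_. {..<d} \<times> {..<d}"]]) auto

lemma int_dvd_diff_eq:
  assumes "int d dvd int x - int y" "x < d" "y < d"
  shows "x = y"
  using assms by (metis mod_eq_dvd_iff mod_pos_pos_trivial of_nat_0_le_iff of_nat_eq_iff of_nat_less_iff)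

definition edges :: "nat \<Rightarrow> (nat \<times> nat) set" where
  "edges n = {(i,j). j < i \<and> i < n}"

text \<open>Edge weights are stored once, for \<open>j < i\<close>, and mirrored, so symmetry and a
  zero diagonal hold by construction and graphs are easy to count.\<close>

definition adj :: "(nat \<times> nat \<Rightarrow> nat) \<Rightarrow> nat \<Rightarrow> nat \<Rightarrow> int" where
  "adj \<Gamma> i j = (if j < i then int (\<Gamma> (i,j)) else if i < j then int (\<Gamma> (j,i)) else 0)"

lemma finite_edges: "finite (edges n)"
  by (rule finite_subset[of _ "{..<n} \<times> {..<n}"]) (auto simp: edges_def)

text \<open>If \<open>fst (\<sigma> k) \<noteq> 0\<close>, the condition \<open>syndrome = 0\<close> determines the \<open>n - 1\<close> edges at \<open>k\<close> from all other edges.\<close>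

lemma card_bad_graphs:
  assumes d: "prime d" and \<sigma>: "\<sigma> \<in> weyl_labels d n w" "\<sigma> \<noteq> zero_label n"
  shows "card {\<Gamma> \<in> edges n \<rightarrow>\<^sub>E {..<d}. \<forall>i<n. int d dvd syndrome n (adj \<Gamma>) \<sigma> i} * d ^ (n - 1) \<le> d ^ card (edges n)"
    (is "card ?B * _ \<le> _")
proof -
  have rng: "fst (\<sigma> i) < d" "snd (\<sigma> i) < d" if "i < n" for i
    using \<sigma>(1) that by (auto simp: weyl_labels_def PiE_iff mem_Times_iff)
  show ?thesis
  proof (cases "\<exists>k<n. fst (\<sigma> k) \<noteq> 0")
    \<comment> \<open>Without a shift part the syndrome is \<open>snd \<sigma>\<close>, which
      vanishes mod \<open>d\<close> for the zero label only.\<close>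
    case False
    have B0: "?B = {}"
    proof (rule ccontr)
      assume "?B \<noteq> {}"
      then obtain \<Gamma> where "\<forall>i<n. int d dvd syndrome n (adj \<Gamma>) \<sigma> i" by auto
      then have "int d dvd int (snd (\<sigma> i))" if "i < n" for i
        using False that by (auto simp: syndrome_def)
      then have "snd (\<sigma> i) = 0" if "i < n" for i
        using rng(2)[OF that] that by (metis dvd_imp_le int_dvd_int_iff linorder_not_less neq0_conv)
      then have "\<sigma> i = (0,0)" if "i < n" for i
        using False that by (metis prod.collapse)
      then have "\<sigma> = zero_label n"
        using \<sigma>(1) by (auto simp: weyl_labels_def zero_label_def fun_eq_iff PiE_iff extensional_def)
      with \<sigma>(2) show False by simp
    qed
    show ?thesis unfolding B0 by simp
  next
    case True
    then obtain k where k: "k < n" "fst (\<sigma> k) \<noteq> 0" by auto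
    define Q where "Q = {(i,j) \<in> edges n. i \<noteq> k \<and> j \<noteq> k}"
    define R where "R = (\<lambda>i. (max i k, min i k)) ` ({..<n} - {k})"
    have Q: "Q \<subseteq> edges n" "finite Q" using finite_edges[of n] by (auto simp: Q_def intro: finite_subset)
    have "inj_on (\<lambda>i. (max i k, min i k)) ({..<n} - {k})"
      by (auto simp: inj_on_def max_def min_def split: if_splits)
    then have cR: "card R = n - 1" using k by (simp add: R_def card_image)
    have "edges n = Q \<union> R"
    proof
      show "edges n \<subseteq> Q \<union> R"
      proof
        fix x assume x: "x \<in> edges n"
        obtain i j where ij: "x = (i,j)" "j < i" "i < n" using x by (auto simp: edges_def)
        consider "i = k" | "j = k" | "i \<noteq> k" "j \<noteq> k" by blast
        then show "x \<in> Q \<union> R"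
        proof cases
          case 1 then show ?thesis using ij by (auto simp: R_def intro!: image_eqI[of _ _ j])
        next
          case 2 then show ?thesis using ij by (auto simp: R_def intro!: image_eqI[of _ _ i])
        next
          case 3 then show ?thesis using x ij by (auto simp: Q_def)
        qed
      qed
      show "Q \<union> R \<subseteq> edges n" using k by (auto simp: Q_def R_def edges_def max_def min_def)
    qed
    moreover have "Q \<inter> R = {}" by (auto simp: Q_def R_def max_def min_def split: if_splits)
    moreover have "finite R" by (simp add: R_def)
    ultimately have cP: "card (edges n) = card Q + (n - 1)"
      using Q cR by (simp add: card_Un_disjoint)
    have inj: "inj_on (\<lambda>\<Gamma>. restrict \<Gamma> Q) ?B"
    proof (rule inj_onI)
      fix \<Gamma> \<Gamma>' assume G: "\<Gamma> \<in> ?B" and G': "\<Gamma>' \<in> ?B" and eq: "restrict \<Gamma> Q = restrict \<Gamma>' Q"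
      have eqQ: "\<Gamma> x = \<Gamma>' x" if "x \<in> Q" for x using eq that by (metis restrict_apply')
      have adj_eq: "adj \<Gamma> i j = adj \<Gamma>' i j" if "i < n" "j < n" "i \<noteq> k" "j \<noteq> k" for i j
        using eqQ that by (auto simp: adj_def Q_def edges_def)
      \<comment> \<open>In row \<open>i\<close> the only entry not yet known to agree is the one in
        column \<open>k\<close>, and its coefficient \<open>fst (\<sigma> k)\<close> is invertible
        mod \<open>d\<close> because \<open>d\<close> is prime.\<close>
      have adj_k: "adj \<Gamma> i k = adj \<Gamma>' i k" if i: "i < n" "i \<noteq> k" for i
      proof -
        have "int d dvd syndrome n (adj \<Gamma>') \<sigma> i - syndrome n (adj \<Gamma>) \<sigma> i" using G G' i by auto
        also have "syndrome n (adj \<Gamma>') \<sigma> i - syndrome n (adj \<Gamma>) \<sigma> i = (\<Sum>j<n. (adj \<Gamma> i j - adj \<Gamma>' i j) * int (fst (\<sigma> j)))"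
          by (simp add: syndrome_def sum_subtractf left_diff_distrib)
        also have "\<dots> = (\<Sum>j<n. if j = k then (adj \<Gamma> i k - adj \<Gamma>' i k) * int (fst (\<sigma> k)) else 0)"
          using adj_eq i by (intro sum.cong) auto
        also have "\<dots> = (adj \<Gamma> i k - adj \<Gamma>' i k) * int (fst (\<sigma> k))" using k by simp
        finally have "int d dvd adj \<Gamma> i k - adj \<Gamma>' i k \<or> int d dvd int (fst (\<sigma> k))"
          using d by (simp add: prime_dvd_mult_iff)
        moreover have "\<not> int d dvd int (fst (\<sigma> k))"
          using k rng(1)[OF k(1)] by (auto dest: dvd_imp_le)
        ultimately have dv: "int d dvd adj \<Gamma> i k - adj \<Gamma>' i k" by simp
        have ex: "\<exists>x<d. adj H i k = int x" if "H \<in> ?B" for H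
          using that i k unfolding adj_def by (auto simp: PiE_iff edges_def)
        obtain x y where "x < d" "adj \<Gamma> i k = int x" "y < d" "adj \<Gamma>' i k = int y"
          using ex[OF G] ex[OF G'] by blast
        then show ?thesis using dv int_dvd_diff_eq[of d x y] by simp
      qed
      show "\<Gamma> = \<Gamma>'"
      proof (rule PiE_ext[of _ "edges n" "\<lambda>_. {..<d}"])
        fix x assume x: "x \<in> edges n"
        obtain i j where ij: "x = (i,j)" "j < i" "i < n" using x by (auto simp: edges_def)
        consider "i = k" | "j = k" | "i \<noteq> k" "j \<noteq> k" by blast
        then show "\<Gamma> x = \<Gamma>' x"
        proof cases
          case 1 then show ?thesis using adj_k[of j] ij by (simp add: adj_def)
        next
          case 2 then show ?thesis using adj_k[of i] ij by (simp add: adj_def)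
        next
          case 3 then show ?thesis using adj_eq[of i j] ij by (simp add: adj_def)
        qed
      qed (use G G' in auto)
    qed
    have "(\<lambda>\<Gamma>. restrict \<Gamma> Q) ` ?B \<subseteq> Q \<rightarrow>\<^sub>E {..<d}" using Q by (auto simp: PiE_iff)
    then have "card ?B \<le> card (Q \<rightarrow>\<^sub>E {..<d})"
      using inj Q by (intro card_inj_on_le) (auto intro: finite_PiE)
    then have "card ?B \<le> d ^ card Q" using Q by (simp add: card_PiE)
    then show ?thesis unfolding cP power_add by (rule mult_right_mono) simp
  qed
qed

text \<open>Each non-zero label spoils at most a fraction \<open>1 / d ^ (n - 1)\<close> of the
  graphs, and there are fewer than \<open>d ^ (n - 1)\<close> labels.\<close>

lemma graph_exists:
  assumes d: "prime d" and N: "card (weyl_labels d n w) * d < d ^ n"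
  shows "\<exists>\<Gamma>. \<forall>\<sigma>\<in>weyl_labels d n w. \<sigma> \<noteq> zero_label n \<longrightarrow> (\<exists>i<n. \<not> int d dvd syndrome n (adj \<Gamma>) \<sigma> i)"
proof (rule ccontr)
  assume neg: "\<not> ?thesis"
  let ?B = "\<lambda>\<sigma>. {\<Gamma> \<in> edges n \<rightarrow>\<^sub>E {..<d}. \<forall>i<n. int d dvd syndrome n (adj \<Gamma>) \<sigma> i}"
  let ?E = "weyl_labels d n w - {zero_label n}"
  have d0: "0 < d" using d prime_gt_0_nat by auto
  \<comment> \<open>Needed at the end for \<open>d ^ (n - 1) * d = d ^ n\<close>.\<close>
  have n: "n > 0"
    using N d0 zero_label_weyl_labels[OF d0, of n w] finite_weyl_labels[of d n w] by (cases n) (auto simp: card_gt_0_iff)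
  have fE: "finite ?E" using finite_weyl_labels by simp
  have fin: "finite (edges n \<rightarrow>\<^sub>E {..<d})" using finite_edges by (intro finite_PiE) auto
  have "edges n \<rightarrow>\<^sub>E {..<d} \<subseteq> (\<Union>\<sigma>\<in>?E. ?B \<sigma>)"
  proof
    fix \<Gamma> assume "\<Gamma> \<in> edges n \<rightarrow>\<^sub>E {..<d}"
    moreover obtain \<sigma> where "\<sigma> \<in> weyl_labels d n w" "\<sigma> \<noteq> zero_label n" "\<forall>i<n. int d dvd syndrome n (adj \<Gamma>) \<sigma> i"
      using neg by blast
    ultimately show "\<Gamma> \<in> (\<Union>\<sigma>\<in>?E. ?B \<sigma>)" by blast
  qed
  then have "card (edges n \<rightarrow>\<^sub>E {..<d}) \<le> card (\<Union>\<sigma>\<in>?E. ?B \<sigma>)"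
    using fin fE by (intro card_mono) auto
  also have "\<dots> \<le> (\<Sum>\<sigma>\<in>?E. card (?B \<sigma>))" by (rule card_UN_le[OF fE])
  finally have "d ^ card (edges n) * d ^ (n - 1) \<le> (\<Sum>\<sigma>\<in>?E. card (?B \<sigma>)) * d ^ (n - 1)"
    using finite_edges by (simp add: card_PiE)
  also have "\<dots> \<le> (\<Sum>\<sigma>\<in>?E. d ^ card (edges n))"
    unfolding sum_distrib_right by (intro sum_mono card_bad_graphs[OF d]) auto
  also have "\<dots> \<le> card (weyl_labels d n w) * d ^ card (edges n)"
    using finite_weyl_labels by (simp add: card_mono)
  finally have "d ^ (n - 1) \<le> card (weyl_labels d n w)" using d0 by (simp add: mult.commute)
  then have "d ^ (n - 1) * d \<le> card (weyl_labels d n w) * d" by (rule mult_right_mono) simp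
  moreover have "d ^ (n - 1) * d = d ^ n" using n by (cases n) auto
  ultimately show False using N by linarith
qed

text \<open>The condition is imposed on both orders of a pair, so each old word and each label
  forbid two vectors, \<open>u p - f \<sigma>\<close> and \<open>u p + f \<sigma>\<close> mod
  \<open>d\<close>. This is the factor 2 in the assumption.\<close>

lemma greedy_code:
  fixes f :: "'e \<Rightarrow> nat \<Rightarrow> int"
  assumes d: "0 < d" and fin: "finite E" and "2 * M * card E < d ^ n"
  shows "\<exists>u. (\<forall>p<M. u p \<in> {..<n} \<rightarrow>\<^sub>E {..<d}) \<and>
    (\<forall>p<M. \<forall>q<M. p \<noteq> q \<longrightarrow> (\<forall>\<sigma>\<in>E. \<exists>i<n. \<not> int d dvd int (u q i) - int (u p i) + f \<sigma> i))"
  using assms(3)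
proof (induction M)
  case (Suc M)
  have "2 * M * card E < d ^ n" using Suc.prems by auto
  then obtain u where u: "\<forall>p<M. u p \<in> {..<n} \<rightarrow>\<^sub>E {..<d}"
    "\<forall>p<M. \<forall>q<M. p \<noteq> q \<longrightarrow> (\<forall>\<sigma>\<in>E. \<exists>i<n. \<not> int d dvd int (u q i) - int (u p i) + f \<sigma> i)"
    using Suc.IH by auto
  define v1 v2 where "v1 = (\<lambda>(p,\<sigma>). \<lambda>i\<in>{..<n}. nat ((int (u p i) - f \<sigma> i) mod int d))"
    and "v2 = (\<lambda>(p,\<sigma>). \<lambda>i\<in>{..<n}. nat ((int (u p i) + f \<sigma> i) mod int d))"
  let ?X = "{..<M} \<times> E" and ?Z = "{..<n} \<rightarrow>\<^sub>E {..<d}"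
  have fX: "finite ?X" using fin by simp
  have "card (v1 ` ?X \<union> v2 ` ?X) \<le> card (v1 ` ?X) + card (v2 ` ?X)" by (rule card_Un_le)
  also have "\<dots> \<le> card ?X + card ?X" by (intro add_mono card_image_le fX)
  also have "\<dots> < d ^ n" using Suc.prems by (simp add: card_cartesian_product algebra_simps)
  also have "d ^ n = card ?Z" by (simp add: card_PiE)
  finally have "card (v1 ` ?X \<union> v2 ` ?X) < card ?Z" .
  then obtain z where z: "z \<in> ?Z" "z \<notin> v1 ` ?X" "z \<notin> v2 ` ?X"
    using card_mono[of "v1 ` ?X \<union> v2 ` ?X" ?Z] fX by fastforce
  have key: "z i = nat (y mod int d)" if "int d dvd int (z i) - y" "i < n" for i y
  proof -
    have "z i < d" using z(1) that by auto
    moreover have "int (z i) mod int d = y mod int d" using that(1) by (simp add: mod_eq_dvd_iff)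
    ultimately show ?thesis by (metis mod_pos_pos_trivial nat_int of_nat_0_le_iff of_nat_less_iff)
  qed
  have ext: "z = (\<lambda>i\<in>{..<n}. g i)" if "\<And>i. i < n \<Longrightarrow> z i = g i" for g
    using z(1) that by (auto simp: fun_eq_iff PiE_iff extensional_def)
  have n1: "\<exists>i<n. \<not> int d dvd int (z i) - int (u p i) + f \<sigma> i" if "p < M" "\<sigma> \<in> E" for p \<sigma>
  proof (rule ccontr)
    assume "\<not> ?thesis"
    then have "z = v1 (p,\<sigma>)" unfolding v1_def prod.case
      by (intro ext key) (auto simp: algebra_simps)
    with z(2) that show False by auto
  qed
  have n2: "\<exists>i<n. \<not> int d dvd int (u p i) - int (z i) + f \<sigma> i" if "p < M" "\<sigma> \<in> E" for p \<sigma>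
  proof (rule ccontr)
    assume "\<not> ?thesis"
    then have "int d dvd int (u p i) - int (z i) + f \<sigma> i" if "i < n" for i using that by auto
    then have "int d dvd - (int (u p i) - int (z i) + f \<sigma> i)" if "i < n" for i using that dvd_minus_iff by blast
    then have "z = v2 (p,\<sigma>)" unfolding v2_def prod.case
      by (intro ext key) (auto simp: algebra_simps)
    with z(3) that show False by auto
  qed
  show ?case
  proof (intro exI[of _ "u(M := z)"] conjI allI impI ballI)
    fix p q \<sigma> assume "p < Suc M" "q < Suc M" "p \<noteq> q" "\<sigma> \<in> E"
    then show "\<exists>i<n. \<not> int d dvd int ((u(M := z)) q i) - int ((u(M := z)) p i) + f \<sigma> i"
      using u(2) n1 n2 by (cases "p = M"; cases "q = M") auto
  qed (use u(1) z(1) in \<open>auto simp: less_Suc_eq\<close>)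
qed simp

section \<open>Weyl operators and graph states\<close>

definition root_char :: "nat \<Rightarrow> int \<Rightarrow> complex" where
  "root_char d z = cis (2 * pi * real_of_int z / real d)"

lemma root_char_add: "root_char d (a + b) = root_char d a * root_char d b"
  by (simp add: root_char_def cis_mult ring_distribs add_divide_distrib)

lemma root_char_0 [simp]: "root_char d 0 = 1"
  by (simp add: root_char_def)

lemma cnj_root_char: "cnj (root_char d a) = root_char d (- a)"
  by (simp add: root_char_def cis_cnj)

lemma root_char_sum: "root_char d (\<Sum>i\<in>I. f i) = (\<Prod>i\<in>I. root_char d (f i))"
  by (induction I rule: infinite_finite_induct) (auto simp: root_char_add)

lemma root_char_multiple: "0 < d \<Longrightarrow> root_char d (int d * k) = 1"
  using cis_multiple_2pi[of "real_of_int k"] by (simp add: root_char_def mult.assoc)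

lemma root_char_cong: "0 < d \<Longrightarrow> [a = b] (mod int d) \<Longrightarrow> root_char d a = root_char d b"
proof -
  assume d: "0 < d" and "[a = b] (mod int d)"
  then obtain k where "a = b + int d * k" by (metis cong_iff_lin cong_sym)
  then show ?thesis using root_char_multiple[OF d] by (simp add: root_char_add)
qed

lemma root_char_eq_1:
  assumes "0 < d" "root_char d a = 1" shows "int d dvd a"
proof -
  have "cos (2 * pi * real_of_int a / real d) = 1"
    using arg_cong[OF assms(2), of Re] by (simp add: root_char_def)
  then obtain k :: int where "2 * pi * real_of_int a / real d = of_int k * 2 * pi"
    using cos_one_2pi_int by auto
  then have "real_of_int a = real_of_int (k * int d)"
    using assms(1) by (simp add: field_simps)
  then have "a = k * int d" by (simp only: of_int_eq_iff)
  then show ?thesis by simp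
qed

lemma sum_root_char:
  assumes "0 < d"
  shows "(\<Sum>x<d. root_char d (z * int x)) = (if int d dvd z then of_nat d else 0)"
proof (cases "int d dvd z")
  case True
  then obtain k where "z = int d * k" by auto
  then have "root_char d (z * int x) = 1" for x
    using root_char_multiple[OF assms, of "k * int x"] by (simp add: mult.assoc)
  then show ?thesis using True by simp
next
  case False
  have pow: "root_char d (z * int x) = root_char d z ^ x" for x
    by (induction x) (auto simp: root_char_add ring_distribs)
  have "root_char d z ^ d = 1" using root_char_multiple[OF assms, of z] pow[of d] by (simp add: mult.commute)
  moreover have "root_char d z \<noteq> 1" using root_char_eq_1[OF assms] False by auto
  ultimately show ?thesis using False by (simp add: pow geometric_sum)
qed

text \<open>The generalised Pauli matrix \<open>X^a Z^b\<close> for \<open>\<alpha> = (a,b)\<close>: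
  first the phase with exponent \<open>b\<close>, then the cyclic shift by \<open>a\<close>.\<close>

definition site_weyl :: "nat \<Rightarrow> nat \<times> nat \<Rightarrow> nat \<Rightarrow> nat \<Rightarrow> complex" where
  "site_weyl d \<alpha> x y = (if x = (y + fst \<alpha>) mod d then root_char d (int (snd \<alpha>) * int y) else 0)"

lemma site_weyl_zero: "x < d \<Longrightarrow> y < d \<Longrightarrow> site_weyl d (0,0) x y = (if x = y then 1 else 0)"
  by (simp add: site_weyl_def)

text \<open>The conjugate of \<open>site_weyl d \<alpha> x0 y0\<close> divided by \<open>d\<close>,
  that is, the coefficient of the Weyl matrix \<open>\<alpha>\<close> in the matrix unit at
  \<open>(x0,y0)\<close>.\<close>

definition site_weyl_coeff :: "nat \<Rightarrow> nat \<Rightarrow> nat \<Rightarrow> nat \<times> nat \<Rightarrow> complex" where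
  "site_weyl_coeff d x0 y0 \<alpha> = (if x0 = (y0 + fst \<alpha>) mod d then root_char d (- (int (snd \<alpha>) * int y0)) / of_nat d else 0)"

lemma add_mod_unique:
  assumes "0 < d" "x < d" "y < (d::nat)"
  shows "\<exists>!a. a < d \<and> x = (y + a) mod d"
proof (rule ex1I[of _ "(x + d - y) mod d"])
  have "(y + (x + d - y) mod d) mod d = (y + (x + d - y)) mod d" by (rule mod_add_right_eq)
  then show "(x + d - y) mod d < d \<and> x = (y + (x + d - y) mod d) mod d" using assms by simp
  fix a assume a: "a < d \<and> x = (y + a) mod d"
  show "a = (x + d - y) mod d"
  proof (cases "y + a < d")
    case True then show ?thesis using a by simp
  next
    case False
    moreover have "y + a - d < d" using a assms by linarith
    ultimately have "(y + a) mod d = y + a - d" by (simp add: le_mod_geq)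
    then have "x = y + a - d" using a by simp
    then show ?thesis using a assms False by simp
  qed
qed

text \<open>The character sum over \<open>b\<close> forces \<open>y = y0\<close>; then exactly one
  shift \<open>a\<close> carries \<open>y\<close> to \<open>x\<close>.\<close>

lemma matrix_unit_site_weyl:
  assumes "0 < d" "x < d" "y < d" "x0 < d" "y0 < d"
  shows "(\<Sum>\<alpha>\<in>{..<d} \<times> {..<d}. site_weyl_coeff d x0 y0 \<alpha> * site_weyl d \<alpha> x y) = (if x = x0 \<and> y = y0 then 1 else 0)"
proof -
  have dv: "int d dvd int y - int y0 \<longleftrightarrow> y = y0" using assms int_dvd_diff_eq by auto
  have "(\<Sum>\<alpha>\<in>{..<d} \<times> {..<d}. site_weyl_coeff d x0 y0 \<alpha> * site_weyl d \<alpha> x y) =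
     (\<Sum>a<d. \<Sum>b<d. if x0 = (y0 + a) mod d \<and> x = (y + a) mod d then root_char d ((int y - int y0) * int b) / of_nat d else 0)"
    unfolding sum.cartesian_product'
    by (intro sum.cong refl) (auto simp: site_weyl_coeff_def site_weyl_def root_char_add[symmetric] algebra_simps)
  also have "\<dots> = (\<Sum>a<d. if x0 = (y0 + a) mod d \<and> x = (y + a) mod d then (if y = y0 then 1 else 0) else 0)"
  proof (intro sum.cong refl)
    fix a
    have "(\<Sum>b<d. root_char d ((int y - int y0) * int b) / of_nat d) = (if y = y0 then 1 else 0)"
      unfolding sum_divide_distrib[symmetric] sum_root_char[OF assms(1)] dv using assms by simp
    then show "(\<Sum>b<d. if x0 = (y0 + a) mod d \<and> x = (y + a) mod d then root_char d ((int y - int y0) * int b) / of_nat d else 0)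
      = (if x0 = (y0 + a) mod d \<and> x = (y + a) mod d then (if y = y0 then 1 else 0) else 0)" by auto
  qed
  also have "\<dots> = (if x = x0 \<and> y = y0 then 1 else 0)"
  proof (cases "x = x0 \<and> y = y0")
    case True
    obtain a where a0: "a < d \<and> x = (y + a) mod d" and a1: "\<forall>a'. a' < d \<and> x = (y + a') mod d \<longrightarrow> a' = a"
      using add_mod_unique[OF assms(1-3)] by (rule ex1E)
    have iff: "x0 = (y0 + a') mod d \<and> x = (y + a') mod d \<longleftrightarrow> a' = a" if "a' < d" for a'
      using True a0 a1 that by metis
    have "(\<Sum>a<d. if x0 = (y0 + a) mod d \<and> x = (y + a) mod d then (if y = y0 then 1 else 0) else 0) = (\<Sum>a'<d. if a' = a then 1 else 0 :: complex)"
    proof (rule sum.cong[OF refl])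
      fix a' assume "a' \<in> {..<d}"
      then have "a' < d" by simp
      show "(if x0 = (y0 + a') mod d \<and> x = (y + a') mod d then (if y = y0 then 1 else 0) else 0) = (if a' = a then 1 else 0 :: complex)"
        unfolding iff[OF \<open>a' < d\<close>] using True by simp
    qed
    also have "\<dots> = 1" using a0 by simp
    finally show ?thesis using True by (simp only: simp_thms if_True)
  next
    case False
    then show ?thesis by (intro trans[OF sum.neutral]) auto
  qed
  finally show ?thesis .
qed

text \<open>Write \<open>\<rho>\<close> in products of a matrix unit in \<open>(p,r)\<close> and one
  in \<open>(q,c)\<close> and expand both in Weyl matrices. The labels on the two sides are
  independent because \<open>\<rho>\<close> will be a difference of channels, which need not be
  completely positive.\<close>

lemma site_weyl_expansion:
  fixes \<rho> :: coeffs
  assumes d: "0 < d"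
  shows "\<exists>g. \<forall>r c p q. r < d \<longrightarrow> c < d \<longrightarrow> p < d \<longrightarrow> q < d \<longrightarrow>
    \<rho> r c p q = (\<Sum>j\<in>({..<d} \<times> {..<d}) \<times> ({..<d} \<times> {..<d}). g j * (cnj (site_weyl d (fst j) p r) * site_weyl d (snd j) q c))"
proof (intro exI allI impI)
  let ?L = "{..<d} \<times> {..<d}"
  let ?g = "(\<lambda>j. \<Sum>r0<d. \<Sum>p0<d. \<Sum>c0<d. \<Sum>q0<d. \<rho> r0 c0 p0 q0 * (cnj (site_weyl_coeff d p0 r0 (fst j)) * site_weyl_coeff d q0 c0 (snd j)))"
  fix r c p q assume rc: "r < d" "c < d" "p < d" "q < d"
  let ?f = "\<lambda>r0 p0 c0 q0 \<alpha> \<beta>. \<rho> r0 c0 p0 q0 * ((cnj (site_weyl_coeff d p0 r0 \<alpha> * site_weyl d \<alpha> p r)) * (site_weyl_coeff d q0 c0 \<beta> * site_weyl d \<beta> q c))"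
  have "(\<Sum>j\<in>?L \<times> ?L. ?g j * (cnj (site_weyl d (fst j) p r) * site_weyl d (snd j) q c)) =
     (\<Sum>\<alpha>\<in>?L. \<Sum>\<beta>\<in>?L. \<Sum>r0<d. \<Sum>p0<d. \<Sum>c0<d. \<Sum>q0<d. ?f r0 p0 c0 q0 \<alpha> \<beta>)"
    unfolding sum.cartesian_product'[of _ ?L ?L] sum_distrib_right by (simp add: mult_ac)
  also have "\<dots> = (\<Sum>r0<d. \<Sum>p0<d. \<Sum>\<alpha>\<in>?L. \<Sum>\<beta>\<in>?L. \<Sum>c0<d. \<Sum>q0<d. ?f r0 p0 c0 q0 \<alpha> \<beta>)"
    by (rule sum_swap_pairs)
  also have "\<dots> = (\<Sum>r0<d. \<Sum>p0<d. \<Sum>c0<d. \<Sum>q0<d. \<Sum>\<alpha>\<in>?L. \<Sum>\<beta>\<in>?L. ?f r0 p0 c0 q0 \<alpha> \<beta>)"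
    by (rule sum.cong[OF refl], rule sum.cong[OF refl], rule sum_swap_pairs)
  also have "\<dots> = (\<Sum>r0<d. \<Sum>p0<d. \<Sum>c0<d. \<Sum>q0<d. \<rho> r0 c0 p0 q0 * (cnj (\<Sum>\<alpha>\<in>?L. site_weyl_coeff d p0 r0 \<alpha> * site_weyl d \<alpha> p r) * (\<Sum>\<beta>\<in>?L. site_weyl_coeff d q0 c0 \<beta> * site_weyl d \<beta> q c)))"
    unfolding cnj_sum sum_product by (simp only: sum_distrib_left)
  also have "\<dots> = (\<Sum>r0<d. \<Sum>p0<d. \<Sum>c0<d. \<Sum>q0<d. if q0 = q then if c0 = c then if p0 = p then if r0 = r then \<rho> r0 c0 p0 q0 else 0 else 0 else 0 else 0)"
    using rc d by (intro sum.cong refl) (simp add: matrix_unit_site_weyl)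
  also have "\<dots> = \<rho> r c p q" using rc by simp
  finally show "\<rho> r c p q = (\<Sum>j\<in>?L \<times> ?L. ?g j * (cnj (site_weyl d (fst j) p r) * site_weyl d (snd j) q c))" by simp
qed

definition weyl :: "nat \<Rightarrow> nat \<Rightarrow> (nat \<Rightarrow> nat \<times> nat) \<Rightarrow> nat \<Rightarrow> nat \<Rightarrow> complex" where
  "weyl d n \<sigma> r c = (\<Prod>i<n. site_weyl d (\<sigma> i) (digit d r i) (digit d c i))"

text \<open>Supplies the expansion demanded by \<open>enc_errors_dec\<close>. Labels can be non-zero
  only at sites in \<open>S\<close>, which bounds their weight by \<open>card S\<close>.\<close>

lemma site_tensor_weyl:
  fixes \<rho> :: coeffs
  assumes d: "0 < d" and S: "S \<subseteq> {..<n}" "card S \<le> w"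
  obtains J f \<sigma> \<tau> where "finite (J :: (nat \<Rightarrow> (nat \<times> nat) \<times> (nat \<times> nat)) set)"
    "\<And>j. j \<in> J \<Longrightarrow> \<sigma> j \<in> weyl_labels d n w" "\<And>j. j \<in> J \<Longrightarrow> \<tau> j \<in> weyl_labels d n w"
    "\<And>r c p q. site_tensor d n (\<lambda>i. if i \<in> S then \<rho> else id_coeff) r c p q =
       (\<Sum>j\<in>J. f j * (cnj (weyl d n (\<sigma> j) p r) * weyl d n (\<tau> j) q c))"
proof -
  let ?L = "{..<d} \<times> {..<d}"
  obtain g where "\<forall>r c p q. r < d \<longrightarrow> c < d \<longrightarrow> p < d \<longrightarrow> q < d \<longrightarrow>
    \<rho> r c p q = (\<Sum>j\<in>?L \<times> ?L. g j * (cnj (site_weyl d (fst j) p r) * site_weyl d (snd j) q c))"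
    using site_weyl_expansion[OF d, of \<rho>] by (rule exE)
  note g = this[rule_format]
  \<comment> \<open>Outside \<open>S\<close> the identity is the single term with both labels zero
    and coefficient 1.\<close>
  define B where "B = (\<lambda>i::nat. if i \<in> S then ?L \<times> ?L else {((0::nat,0::nat),(0::nat,0::nat))})"
  define h where "h = (\<lambda>(i::nat) j. if i \<in> S then g j else 1)"
  define J where "J = PiE {..<n} B"
  define \<sigma> where "\<sigma> = (\<lambda>j::nat \<Rightarrow> (nat \<times> nat) \<times> (nat \<times> nat). \<lambda>i\<in>{..<n}. fst (j i))"
  define \<tau> where "\<tau> = (\<lambda>j::nat \<Rightarrow> (nat \<times> nat) \<times> (nat \<times> nat). \<lambda>i\<in>{..<n}. snd (j i))"
  have fB: "finite (B i)" for i by (simp add: B_def)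
  have site: "(if i \<in> S then \<rho> else id_coeff) r c p q = (\<Sum>j\<in>B i. h i j * (cnj (site_weyl d (fst j) p r) * site_weyl d (snd j) q c))"
    if "r < d" "c < d" "p < d" "q < d" for i r c p q
  proof (cases "i \<in> S")
    case True
    then show ?thesis using g[OF that] by (simp add: B_def h_def)
  next
    case False
    then show ?thesis using that by (auto simp: B_def h_def site_weyl_zero id_coeff_def)
  qed
  have err: "\<sigma> j \<in> weyl_labels d n w" "\<tau> j \<in> weyl_labels d n w" if j: "j \<in> J" for j
  proof -
    have jB: "j i \<in> B i" if "i < n" for i using j that by (auto simp: J_def PiE_iff)
    have "{i. i < n \<and> \<sigma> j i \<noteq> (0,0)} \<subseteq> S" "{i. i < n \<and> \<tau> j i \<noteq> (0,0)} \<subseteq> S"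
      using jB by (fastforce simp: \<sigma>_def \<tau>_def B_def split: if_splits)+
    then have "card {i. i < n \<and> \<sigma> j i \<noteq> (0,0)} \<le> w" "card {i. i < n \<and> \<tau> j i \<noteq> (0,0)} \<le> w"
      using S by (meson card_mono finite_lessThan finite_subset order_trans)+
    moreover have "fst (j i) \<in> ?L" "snd (j i) \<in> ?L" if "i < n" for i
      using jB[OF that] d by (auto simp: B_def split: if_splits)
    ultimately show "\<sigma> j \<in> weyl_labels d n w" "\<tau> j \<in> weyl_labels d n w"
      by (auto simp: weyl_labels_def \<sigma>_def \<tau>_def PiE_iff)
  qed
  have main: "site_tensor d n (\<lambda>i. if i \<in> S then \<rho> else id_coeff) r c p q =
       (\<Sum>j\<in>J. (\<Prod>i<n. h i (j i)) * (cnj (weyl d n (\<sigma> j) p r) * weyl d n (\<tau> j) q c))" for r c p q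
  proof -
    have "site_tensor d n (\<lambda>i. if i \<in> S then \<rho> else id_coeff) r c p q =
       (\<Prod>i<n. \<Sum>j\<in>B i. h i j * (cnj (site_weyl d (fst j) (digit d p i) (digit d r i)) * site_weyl d (snd j) (digit d q i) (digit d c i)))"
      unfolding site_tensor_def by (rule prod.cong[OF refl], rule site) (simp_all add: digit_less d)
    also have "\<dots> = (\<Sum>j\<in>J. \<Prod>i<n. h i (j i) * (cnj (site_weyl d (fst (j i)) (digit d p i) (digit d r i)) * site_weyl d (snd (j i)) (digit d q i) (digit d c i)))"
      unfolding J_def by (rule prod_sum_PiE) (auto simp: fB)
    also have "\<dots> = (\<Sum>j\<in>J. (\<Prod>i<n. h i (j i)) * (cnj (weyl d n (\<sigma> j) p r) * weyl d n (\<tau> j) q c))"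
      by (intro sum.cong refl) (simp add: weyl_def prod.distrib \<sigma>_def \<tau>_def)
    finally show ?thesis .
  qed
  have fJ: "finite J" unfolding J_def by (intro finite_PiE) (auto simp: fB)
  show ?thesis by (rule that[OF fJ err main])
qed

section \<open>Graph states\<close>

text \<open>Summing over \<open>j < i\<close> avoids the factor 1/2 of the symmetric form, which
  makes no sense mod 2 when \<open>d = 2\<close>.\<close>

definition quad :: "nat \<Rightarrow> (nat \<Rightarrow> nat \<Rightarrow> int) \<Rightarrow> (nat \<Rightarrow> int) \<Rightarrow> int" where
  "quad n G x = (\<Sum>i<n. \<Sum>j<i. G i j * (x i * x j))"

text \<open>Polarisation. The mixed term is linear in \<open>x\<close> with coefficient vector
  \<open>G a\<close>: on a graph state a shift by \<open>a\<close> acts like a phase, which is the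
  origin of the syndrome \<open>b - G a\<close>.\<close>

lemma quad_diff:
  assumes sym: "\<And>i j. G i j = G j i" and diag: "\<And>i. G i i = 0"
  shows "quad n G (\<lambda>i. x i - a i) = quad n G x + quad n G a - (\<Sum>i<n. x i * (\<Sum>j<n. G i j * a j))"
proof (induction n)
  case (Suc n)
  have "(\<Sum>j<n. G n j * ((x n - a n) * (x j - a j))) = (\<Sum>j<n. G n j * (x n * x j)) + (\<Sum>j<n. G n j * (a n * a j))
     - x n * (\<Sum>j<n. G n j * a j) - (\<Sum>j<n. x j * (G j n * a n))"
    by (simp add: sum_distrib_left sum_subtractf sum.distrib algebra_simps sym[of _ n])
  then show ?case using Suc.IH diag
    by (simp add: quad_def sum.distrib algebra_simps)
qed (simp add: quad_def)

definition graph_phase :: "nat \<Rightarrow> (nat \<Rightarrow> nat \<Rightarrow> int) \<Rightarrow> (nat \<Rightarrow> nat) \<Rightarrow> (nat \<Rightarrow> nat \<times> nat) \<Rightarrow> (nat \<Rightarrow> int) \<Rightarrow> int" where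
  "graph_phase n G u \<sigma> y = (\<Sum>i<n. (int (snd (\<sigma> i)) + int (u i)) * y i) + quad n G y"

text \<open>The graph basis vector \<open>u\<close> after applying the Weyl operator with label \<open>\<sigma>\<close>.\<close>

definition graph_state :: "nat \<Rightarrow> nat \<Rightarrow> (nat \<Rightarrow> nat \<Rightarrow> int) \<Rightarrow> (nat \<Rightarrow> nat) \<Rightarrow> (nat \<Rightarrow> nat \<times> nat) \<Rightarrow> nat \<Rightarrow> complex" where
  "graph_state d n G u \<sigma> r = root_char d (graph_phase n G u \<sigma> (\<lambda>i. int (digit d r i) - int (fst (\<sigma> i)))) / complex_of_real (sqrt (real (d ^ n)))"

lemma graph_phase_cong:
  assumes "\<And>i. i < n \<Longrightarrow> [x i = y i] (mod m)"
  shows "[graph_phase n G u \<sigma> x = graph_phase n G u \<sigma> y] (mod m)"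
  unfolding graph_phase_def quad_def using assms
  by (intro cong_add cong_sum cong_mult cong_refl) auto

lemma graph_phase_shift:
  assumes sym: "\<And>i j. G i j = G j i" and diag: "\<And>i. G i i = 0"
  shows "\<exists>C. \<forall>x. graph_phase n G u \<sigma> (\<lambda>i. x i - int (fst (\<sigma> i))) = C + quad n G x + (\<Sum>i<n. (int (u i) + syndrome n G \<sigma> i) * x i)"
proof (intro exI allI)
  fix x
  show "graph_phase n G u \<sigma> (\<lambda>i. x i - int (fst (\<sigma> i))) =
     (quad n G (\<lambda>i. int (fst (\<sigma> i))) - (\<Sum>i<n. (int (snd (\<sigma> i)) + int (u i)) * int (fst (\<sigma> i)))) + quad n G x + (\<Sum>i<n. (int (u i) + syndrome n G \<sigma> i) * x i)"
    unfolding graph_phase_def quad_diff[OF sym diag] syndrome_def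
    by (simp add: sum_subtractf sum.distrib algebra_simps)
qed

text \<open>The quadratic parts cancel, leaving up to a constant a product over sites of complete
  character sums. A site where the linear coefficients differ mod \<open>d\<close> contributes the
  factor 0.\<close>

lemma graph_state_inner:
  assumes d: "0 < d" and sym: "\<And>i j. G i j = G j i" and diag: "\<And>i. G i i = 0"
    and neq: "\<exists>i<n. \<not> int d dvd int (u' i) - int (u i) + (syndrome n G \<tau> i - syndrome n G \<sigma> i)"
  shows "(\<Sum>r<d ^ n. cnj (graph_state d n G u \<sigma> r) * graph_state d n G u' \<tau> r) = 0"
proof -
  obtain C where C: "\<And>x. graph_phase n G u \<sigma> (\<lambda>i. x i - int (fst (\<sigma> i))) = C + quad n G x + (\<Sum>i<n. (int (u i) + syndrome n G \<sigma> i) * x i)"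
    using graph_phase_shift[where G=G and u=u and \<sigma>=\<sigma>, OF sym diag] by metis
  obtain C' where C': "\<And>x. graph_phase n G u' \<tau> (\<lambda>i. x i - int (fst (\<tau> i))) = C' + quad n G x + (\<Sum>i<n. (int (u' i) + syndrome n G \<tau> i) * x i)"
    using graph_phase_shift[where G=G and u=u' and \<sigma>=\<tau>, OF sym diag] by metis
  define z where "z = (\<lambda>i. int (u' i) - int (u i) + (syndrome n G \<tau> i - syndrome n G \<sigma> i))"
  define D where "D = complex_of_real (sqrt (real (d ^ n)))"
  have "cnj (graph_state d n G u \<sigma> r) * graph_state d n G u' \<tau> r = root_char d (C' - C) / (cnj D * D) * (\<Prod>i<n. root_char d (z i * int (digit d r i)))" for r
  proof -
    have gen: "cnj (root_char d X / D) * (root_char d Y / D) = root_char d (- X + Y) / (cnj D * D)" for X Y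
      unfolding root_char_add[of d "- X" Y] by (simp add: cnj_root_char)
    have eq: "- (C + quad n G (\<lambda>i. int (digit d r i)) + (\<Sum>i<n. (int (u i) + syndrome n G \<sigma> i) * int (digit d r i))) +
       (C' + quad n G (\<lambda>i. int (digit d r i)) + (\<Sum>i<n. (int (u' i) + syndrome n G \<tau> i) * int (digit d r i)))
       = (C' - C) + (\<Sum>i<n. z i * int (digit d r i))"
      by (simp add: z_def sum_subtractf sum.distrib algebra_simps)
    show ?thesis
      unfolding graph_state_def C C' D_def[symmetric] gen eq by (simp add: root_char_add root_char_sum)
  qed
  then have "(\<Sum>r<d ^ n. cnj (graph_state d n G u \<sigma> r) * graph_state d n G u' \<tau> r) =
      root_char d (C' - C) / (cnj D * D) * (\<Sum>r<d ^ n. \<Prod>i<n. root_char d (z i * int (digit d r i)))"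
    by (simp add: sum_distrib_left)
  also have "(\<Sum>r<d ^ n. \<Prod>i<n. root_char d (z i * int (digit d r i))) = (\<Prod>i<n. \<Sum>x<d. root_char d (z i * int x))"
    by (rule sum_digits)
  also have "\<dots> = 0"
    using neq by (auto simp: sum_root_char[OF d] z_def)
  finally show ?thesis by simp
qed

lemma graph_state_norm:
  assumes "0 < d"
  shows "(\<Sum>r<d ^ n. cnj (graph_state d n G u \<sigma> r) * graph_state d n G u \<sigma> r) = 1"
proof -
  have "cnj (graph_state d n G u \<sigma> r) * graph_state d n G u \<sigma> r = 1 / of_nat (d ^ n)" for r
  proof -
    have "complex_of_real (sqrt (real (d ^ n))) * complex_of_real (sqrt (real (d ^ n))) = of_nat (d ^ n)"
      unfolding of_real_mult[symmetric] by simp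
    then show ?thesis by (simp add: graph_state_def cnj_root_char root_char_add[symmetric])
  qed
  then show ?thesis using assms by simp
qed

text \<open>Row \<open>r\<close> of the Weyl operator has a single non-zero column
  \<open>c0\<close>, namely \<open>r\<close> shifted back by \<open>fst \<sigma>\<close> at each
  site. This provides the link between \<open>W\<close> and \<open>K\<close> in
  \<open>enc_errors_dec\<close>.\<close>

lemma weyl_graph_state:
  assumes d: "0 < d" and r: "r < d ^ n" and \<sigma>: "\<And>i. i < n \<Longrightarrow> fst (\<sigma> i) < d"
  shows "(\<Sum>c<d ^ n. weyl d n \<sigma> r c * graph_state d n G u (zero_label n) c) = graph_state d n G u \<sigma> r"
proof -
  have "\<exists>y. \<forall>i<n. y i < d \<and> digit d r i = (y i + fst (\<sigma> i)) mod d"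
  proof -
    have "\<exists>y. i < n \<longrightarrow> y < d \<and> digit d r i = (y + fst (\<sigma> i)) mod d" for i
      using add_mod_unique[OF d digit_less[OF d, of r i] \<sigma>[of i]] by (metis add.commute)
    then show ?thesis by metis
  qed
  then obtain y where y: "\<And>i. i < n \<Longrightarrow> y i < d" "\<And>i. i < n \<Longrightarrow> digit d r i = (y i + fst (\<sigma> i)) mod d" by blast
  obtain c0 where c0: "c0 < d ^ n" "\<And>i. i < n \<Longrightarrow> digit d c0 i = y i" using digit_surj[of n y d] y(1) by blast
  have W0: "weyl d n \<sigma> r c0 = root_char d (\<Sum>i<n. int (snd (\<sigma> i)) * int (digit d c0 i))"
    unfolding weyl_def root_char_sum by (intro prod.cong refl) (simp add: site_weyl_def y(2) c0(2))
  have W1: "weyl d n \<sigma> r c = 0" if c: "c < d ^ n" "c \<noteq> c0" for c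
  proof -
    obtain i where i: "i < n" "digit d c i \<noteq> digit d c0 i" using digit_inject[OF c(1) c0(1)] c(2) by blast
    have "digit d r i \<noteq> (digit d c i + fst (\<sigma> i)) mod d"
    proof
      assume "digit d r i = (digit d c i + fst (\<sigma> i)) mod d"
      then have "digit d r i = (fst (\<sigma> i) + digit d c i) mod d" "digit d r i = (fst (\<sigma> i) + digit d c0 i) mod d"
        using y(2)[OF i(1)] c0(2)[OF i(1)] by (simp_all add: add.commute)
      then show False
        using add_mod_unique[OF d digit_less[OF d, of r i] \<sigma>[OF i(1)]] digit_less[OF d] i(2) by blast
    qed
    then show ?thesis unfolding weyl_def using i(1) by (intro prod_zero) (auto simp: site_weyl_def intro!: bexI[of _ i])
  qed
  have "(\<Sum>c<d ^ n. weyl d n \<sigma> r c * graph_state d n G u (zero_label n) c) = (\<Sum>c<d ^ n. if c = c0 then weyl d n \<sigma> r c0 * graph_state d n G u (zero_label n) c0 else 0)"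
    by (intro sum.cong refl) (auto simp: W1)
  also have "\<dots> = weyl d n \<sigma> r c0 * graph_state d n G u (zero_label n) c0" using c0 by simp
  also have "\<dots> = root_char d (graph_phase n G u \<sigma> (\<lambda>i. int (digit d c0 i))) / complex_of_real (sqrt (real (d ^ n)))"
  proof -
    have q: "quad n G (\<lambda>i. int (digit d c0 i) - int (fst (zero_label n i))) = quad n G (\<lambda>i. int (digit d c0 i))"
      unfolding quad_def by (intro sum.cong refl) (auto simp: zero_label_def)
    have "(\<Sum>i<n. int (snd (\<sigma> i)) * int (digit d c0 i)) + graph_phase n G u (zero_label n) (\<lambda>i. int (digit d c0 i) - int (fst (zero_label n i)))
       = graph_phase n G u \<sigma> (\<lambda>i. int (digit d c0 i))"
      unfolding graph_phase_def q by (simp add: zero_label_def sum.distrib algebra_simps)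
    then show ?thesis unfolding W0 graph_state_def by (simp add: root_char_add[symmetric])
  qed
  also have "\<dots> = graph_state d n G u \<sigma> r"
  proof -
    \<comment> \<open>The difference on the right may be negative, so it equals the digit of
      \<open>c0\<close> only modulo \<open>d\<close>; the phase sees nothing but residues.\<close>
    have "[int (digit d c0 i) = int (digit d r i) - int (fst (\<sigma> i))] (mod int d)" if "i < n" for i
    proof -
      have "int (digit d r i) = (int (digit d c0 i) + int (fst (\<sigma> i))) mod int d"
        using y(2)[OF that] c0(2)[OF that] by (simp add: zmod_int)
      then have "[int (digit d r i) = int (digit d c0 i) + int (fst (\<sigma> i))] (mod int d)"
        by (simp add: cong_def)
      then have "[int (digit d r i) - int (fst (\<sigma> i)) = int (digit d c0 i) + int (fst (\<sigma> i)) - int (fst (\<sigma> i))] (mod int d)"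
        by (intro cong_diff cong_refl)
      then show ?thesis by (simp add: cong_sym)
    qed
    then have "[graph_phase n G u \<sigma> (\<lambda>i. int (digit d c0 i)) = graph_phase n G u \<sigma> (\<lambda>i. int (digit d r i) - int (fst (\<sigma> i)))] (mod int d)"
      by (rule graph_phase_cong)
    then show ?thesis unfolding graph_state_def by (simp add: root_char_cong[OF d])
  qed
  finally show ?thesis .
qed

section \<open>Codes correcting small errors\<close>

lemma adj_sym: "adj \<Gamma> i j = adj \<Gamma> j i"
  by (simp add: adj_def)

lemma adj_diag: "adj \<Gamma> i i = 0"
  by (simp add: adj_def)

lemma weyl_labels_fst_less: "\<sigma> \<in> weyl_labels d n w \<Longrightarrow> i < n \<Longrightarrow> fst (\<sigma> i) < d"
  by (auto simp: weyl_labels_def PiE_iff mem_Times_iff)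

definition err_diff :: "nat \<Rightarrow> nat \<Rightarrow> (nat \<Rightarrow> nat \<times> nat) \<Rightarrow> (nat \<Rightarrow> nat \<times> nat) \<Rightarrow> nat \<Rightarrow> nat \<times> nat" where
  "err_diff d n t s = (\<lambda>i\<in>{..<n}. (nat ((int (fst (t i)) - int (fst (s i))) mod int d), nat ((int (snd (t i)) - int (snd (s i))) mod int d)))"

text \<open>The support of a difference lies in the union of both supports. This doubling is why
  labels are counted up to weight \<open>2 * e\<close>.\<close>

lemma err_diff_weyl_labels:
  assumes d: "0 < d" and s: "s \<in> weyl_labels d n w" and t: "t \<in> weyl_labels d n w"
  shows "err_diff d n t s \<in> weyl_labels d n (2 * w)"
proof -
  have "nat (z mod int d) < d" for z using d by (simp add: nat_less_iff)
  moreover have "card {i. i < n \<and> err_diff d n t s i \<noteq> (0,0)} \<le> 2 * w"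
  proof -
    have "{i. i < n \<and> err_diff d n t s i \<noteq> (0,0)} \<subseteq> {i. i < n \<and> s i \<noteq> (0,0)} \<union> {i. i < n \<and> t i \<noteq> (0,0)}"
      by (auto simp: err_diff_def)
    then have "card {i. i < n \<and> err_diff d n t s i \<noteq> (0,0)} \<le> card ({i. i < n \<and> s i \<noteq> (0,0)} \<union> {i. i < n \<and> t i \<noteq> (0,0)})"
      by (rule card_mono[rotated]) simp
    also have "\<dots> \<le> card {i. i < n \<and> s i \<noteq> (0,0)} + card {i. i < n \<and> t i \<noteq> (0,0)}" by (rule card_Un_le)
    also have "\<dots> \<le> 2 * w" using s t by (simp add: weyl_labels_def)
    finally show ?thesis .
  qed
  ultimately show ?thesis by (auto simp: weyl_labels_def err_diff_def)
qed

lemma err_diff_zero: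
  assumes s: "s \<in> weyl_labels d n w" and t: "t \<in> weyl_labels d n w" and z: "err_diff d n t s = zero_label n" and d: "0 < d"
  shows "s = t"
proof
  fix i
  show "s i = t i"
  proof (cases "i < n")
    case True
    have "nat ((int (fst (t i)) - int (fst (s i))) mod int d) = 0" "nat ((int (snd (t i)) - int (snd (s i))) mod int d) = 0"
      using fun_cong[OF z, of i] True by (auto simp: err_diff_def zero_label_def)
    moreover have "x mod int d \<ge> 0" for x using d by simp
    ultimately have "(int (fst (t i)) - int (fst (s i))) mod int d = 0" "(int (snd (t i)) - int (snd (s i))) mod int d = 0"
      by (metis nat_eq_iff2 of_nat_0)+
    then have "int d dvd int (fst (t i)) - int (fst (s i))" "int d dvd int (snd (t i)) - int (snd (s i))"
      by (auto simp: dvd_eq_mod_eq_0)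
    moreover have "fst (s i) < d" "snd (s i) < d" "fst (t i) < d" "snd (t i) < d"
      using s t True by (auto simp: weyl_labels_def PiE_iff mem_Times_iff)
    ultimately show ?thesis using int_dvd_diff_eq by (metis prod_eqI)
  next
    case False
    then show ?thesis using s t by (simp add: weyl_labels_def PiE_iff extensional_def)
  qed
qed

lemma syndrome_err_diff:
  assumes "i < n" "0 < d"
  shows "[syndrome n G (err_diff d n t s) i = syndrome n G t i - syndrome n G s i] (mod int d)"
proof -
  have "[syndrome n G (err_diff d n t s) i =
     (int (snd (t i)) - int (snd (s i))) - (\<Sum>j<n. G i j * (int (fst (t j)) - int (fst (s j))))] (mod int d)"
    unfolding syndrome_def using assms
    by (intro cong_diff cong_sum cong_mult cong_refl) (auto simp: err_diff_def cong_def)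
  also have "(int (snd (t i)) - int (snd (s i))) - (\<Sum>j<n. G i j * (int (fst (t j)) - int (fst (s j)))) = syndrome n G t i - syndrome n G s i"
    by (simp add: syndrome_def sum_subtractf right_diff_distrib)
  finally show ?thesis .
qed

lemma code_exists:
  assumes d: "prime d" and M: "0 < M"
    and N1: "card (weyl_labels d n (2 * e)) * d < d ^ n" and N2: "2 * M * card (weyl_labels d n (2 * e)) < d ^ n"
  shows "\<exists>G u. pure_code (d ^ n) M (weyl_labels d n e) (\<lambda>\<sigma> r p. graph_state d n G (u p) \<sigma> r) (zero_label n)"
proof -
  have d0: "0 < d" using d prime_gt_0_nat by auto
  obtain \<Gamma> where G: "\<forall>\<sigma>\<in>weyl_labels d n (2 * e). \<sigma> \<noteq> zero_label n \<longrightarrow> (\<exists>i<n. \<not> int d dvd syndrome n (adj \<Gamma>) \<sigma> i)"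
    using graph_exists[OF d N1] by (rule exE)
  obtain u where u: "\<forall>p<M. \<forall>q<M. p \<noteq> q \<longrightarrow> (\<forall>\<sigma>\<in>weyl_labels d n (2 * e). \<exists>i<n. \<not> int d dvd int (u q i) - int (u p i) + syndrome n (adj \<Gamma>) \<sigma> i)"
    using greedy_code[OF d0 finite_weyl_labels N2, of "syndrome n (adj \<Gamma>)"] by (elim exE conjE)
  show ?thesis
  proof (intro exI[of _ "adj \<Gamma>"] exI[of _ u], unfold_locales)
    show "finite (weyl_labels d n e)" by (rule finite_weyl_labels)
    show "zero_label n \<in> weyl_labels d n e" by (rule zero_label_weyl_labels[OF d0])
    fix s t p q assume st: "s \<in> weyl_labels d n e" "t \<in> weyl_labels d n e" and pq: "p < M" "q < M"
    show "(\<Sum>r<d ^ n. cnj (graph_state d n (adj \<Gamma>) (u p) s r) * graph_state d n (adj \<Gamma>) (u q) t r) = (if s = t \<and> p = q then 1 else 0)"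
    proof (cases "s = t \<and> p = q")
      case True
      then show ?thesis by (simp add: graph_state_norm[OF d0])
    next
      case False
      let ?f = "err_diff d n t s"
      have f: "?f \<in> weyl_labels d n (2 * e)" by (rule err_diff_weyl_labels[OF d0 st])
      have "\<exists>i<n. \<not> int d dvd int (u q i) - int (u p i) + syndrome n (adj \<Gamma>) ?f i"
      proof (cases "p = q")
        case True
        then have "?f \<noteq> zero_label n" using False err_diff_zero[OF st _ d0] by blast
        then show ?thesis using G f True by simp
      next
        \<comment> \<open>This includes \<open>s = t\<close>: the zero label, with syndrome 0, is
          among those avoided by the greedy choice, so distinct codewords are orthogonal
          too.\<close>
        case False
        then show ?thesis using u f pq by blast
      qed
      then obtain i where i: "i < n" "\<not> int d dvd int (u q i) - int (u p i) + syndrome n (adj \<Gamma>) ?f i" by blast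
      have "[int (u q i) - int (u p i) + syndrome n (adj \<Gamma>) ?f i = int (u q i) - int (u p i) + (syndrome n (adj \<Gamma>) t i - syndrome n (adj \<Gamma>) s i)] (mod int d)"
        by (intro cong_add cong_refl syndrome_err_diff i d0)
      then have "\<not> int d dvd int (u q i) - int (u p i) + (syndrome n (adj \<Gamma>) t i - syndrome n (adj \<Gamma>) s i)"
        using i(2) cong_dvd_iff by blast
      then have "(\<Sum>r<d ^ n. cnj (graph_state d n (adj \<Gamma>) (u p) s r) * graph_state d n (adj \<Gamma>) (u q) t r) = 0"
        using i(1) by (intro graph_state_inner[OF d0 adj_sym adj_diag]) blast
      then show ?thesis using False by simp
    qed
  qed (rule M)
qed

section \<open>Linearity, and bounds on \<open>Delta\<close>\<close>

lemma lin_map_cong: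
  assumes "lin_map n1 n2 S" "\<And>A. A \<in> carrier_mat n2 n2 \<Longrightarrow> S' A = S A"
  shows "lin_map n1 n2 S'"
  using assms unfolding lin_map_def by simp

lemma lin_map_tensor_pow: "lin_map d d T \<Longrightarrow> lin_map (d ^ n) (d ^ n) (tensor_pow d T n)"
  by (rule lin_map_cong[OF lin_map_coeff_map tensor_pow_coeff_map])

lemma lin_map_comp:
  assumes "lin_map n1 n2 S" "lin_map n2 n3 T" shows "lin_map n1 n3 (\<lambda>X. S (T X))"
  using assms unfolding lin_map_def by simp

lemma lin_map_diff:
  assumes "lin_map n1 n2 S" "lin_map n1 n2 T" shows "lin_map n1 n2 (\<lambda>X. S X - T X)"
  unfolding lin_map_def
proof (intro conjI ballI allI)
  fix A B :: "complex mat" and c :: complex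
  assume A: "A \<in> carrier_mat n2 n2"
  have SA: "S A \<in> carrier_mat n1 n1" "T A \<in> carrier_mat n1 n1" using assms A by (auto simp: lin_map_def)
  show "S A - T A \<in> carrier_mat n1 n1" using SA by (intro minus_carrier_mat)
  have "S (c \<cdot>\<^sub>m A) = c \<cdot>\<^sub>m S A" "T (c \<cdot>\<^sub>m A) = c \<cdot>\<^sub>m T A" using assms A by (auto simp: lin_map_def)
  then show "S (c \<cdot>\<^sub>m A) - T (c \<cdot>\<^sub>m A) = c \<cdot>\<^sub>m (S A - T A)"
    using SA by (intro eq_matI) (auto simp: algebra_simps)
  assume B: "B \<in> carrier_mat n2 n2"
  have SB: "S B \<in> carrier_mat n1 n1" "T B \<in> carrier_mat n1 n1" using assms B by (auto simp: lin_map_def)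
  have "S (A + B) = S A + S B" "T (A + B) = T A + T B" using assms A B by (auto simp: lin_map_def)
  then show "S (A + B) - T (A + B) = S A - T A + (S B - T B)"
    using SA SB by (intro eq_matI) auto
qed

lemma lin_map_id: "lin_map n n (\<lambda>X. X)"
  by (simp add: lin_map_def)

lemma lin_map_error:
  assumes "lin_map M n1 E" "lin_map n1 n2 T" "lin_map n2 M D"
  shows "lin_map M M (\<lambda>X. E (T (D X)) - X)"
  by (rule lin_map_diff[OF lin_map_comp[OF assms(1) lin_map_comp[OF assms(2,3)]] lin_map_id])

text \<open>Non-negativity of all cb-norms bounded here serves twice: the real \<open>Inf\<close>
  needs a lower bound, and the limit argument needs 0 from below.\<close>

lemma Delta_bounds:
  assumes T: "lin_map n1 n2 T" and D: "channel n2 M D" and E: "channel M n1 E"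
    and b: "cb_norm M M (\<lambda>X. E (T (D X)) - X) \<le> \<beta>"
  shows "0 \<le> Delta n1 n2 T M" "Delta n1 n2 T M \<le> \<beta>"
proof -
  let ?X = "{cb_norm M M (\<lambda>X. E (T (D X)) - X) | E D. channel n2 M D \<and> channel M n1 E}"
  have nn: "0 \<le> x" if mem: "x \<in> ?X" for x
  proof -
    obtain E' D' where x: "x = cb_norm M M (\<lambda>X. E' (T (D' X)) - X)" "channel n2 M D'" "channel M n1 E'"
      using mem by blast
    show ?thesis unfolding x(1) using x(2,3) T
      by (intro cb_norm_nonneg lin_map_error[where T=T]) (auto simp: channel_def)
  qed
  have mem: "cb_norm M M (\<lambda>X. E (T (D X)) - X) \<in> ?X" using D E by blast
  show "0 \<le> Delta n1 n2 T M" unfolding Delta_def by (rule cInf_greatest) (use mem nn in auto)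
  have "Delta n1 n2 T M \<le> cb_norm M M (\<lambda>X. E (T (D X)) - X)"
    unfolding Delta_def by (rule cInf_lower[OF mem]) (use nn in \<open>auto intro!: bdd_belowI[of _ 0]\<close>)
  with b show "Delta n1 n2 T M \<le> \<beta>" by simp
qed

lemma map_coeff_trace:
  assumes "lin_map n1 n2 T" "r < n1" "c < n1" "T (1\<^sub>m n2) = 1\<^sub>m n1"
  shows "(\<Sum>p<n2. map_coeff n2 T r c p p) = (if r = c then 1 else 0)"
proof -
  have "T (1\<^sub>m n2) $$ (r,c) = (\<Sum>p<n2. \<Sum>q<n2. if q = p then map_coeff n2 T r c p p else 0)"
    unfolding lin_map_entry[OF assms(1) one_carrier_mat assms(2,3)] by (intro sum.cong refl) auto
  also have "\<dots> = (\<Sum>p<n2. map_coeff n2 T r c p p)" by (intro sum.cong refl) simp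
  finally show ?thesis using assms by simp
qed

lemma map_coeff_id_minus:
  assumes "lin_map d d T" "r < d" "c < d" "p < d" "q < d"
  shows "map_coeff d (\<lambda>X. X - T X) r c p q = id_coeff r c p q - map_coeff d T r c p q"
proof -
  have "T (munit d p q) \<in> carrier_mat d d" using assms(1) by (simp add: lin_map_def)
  then show ?thesis using assms by (simp add: map_coeff_def id_coeff_def munit_entry)
qed

lemma id_coeff_trace: "r < d \<Longrightarrow> (\<Sum>x<d. id_coeff r c x x) = (if r = c then 1 else 0)"
proof -
  assume "r < d"
  have "(\<Sum>x<d. id_coeff r c x x) = (\<Sum>x<d. if x = r then if r = c then 1 else 0 else 0)"
    by (intro sum.cong refl) (auto simp: id_coeff_def)
  then show ?thesis using \<open>r < d\<close> by simp
qed

lemma coeff_comp_sum: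
  "coeff_comp N s (coeff_comp N (\<lambda>r c p q. \<Sum>S\<in>P. F S r c p q) t) a b m l = (\<Sum>S\<in>P. coeff_comp N s (coeff_comp N (F S) t) a b m l)"
proof -
  have "coeff_comp N (\<lambda>r c p q. \<Sum>S\<in>P. F S r c p q) t r c m l = (\<Sum>S\<in>P. coeff_comp N (F S) t r c m l)" for r c
    unfolding coeff_comp_def sum_distrib_right by (rule sum_swap_inner)
  then show ?thesis
    unfolding coeff_comp_def[of N s] by (simp add: sum_distrib_left) (rule sum_swap_inner)
qed

context pure_code
begin

lemma dec_channel: "channel N M (coeff_map N M dec)"
  unfolding dec_def by (rule channel_kraus) (rule dec_unital)

lemma enc_channel: "channel M N (coeff_map M N enc)"
  unfolding enc_def by (rule channel_kraus) (rule enc_unital)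

lemma cb_bounded_dec: "cb_bounded {..<N} {..<M} dec 1"
  unfolding dec_def by (rule cb_bounded_kraus, simp, rule dec_unital) auto

lemma cb_bounded_enc: "cb_bounded {..<M} {..<N} enc 1"
  unfolding enc_def by (rule cb_bounded_kraus) (use enc_unital in auto)

lemma cb_bounded_enc_dec:
  assumes "cb_bounded {..<N} {..<N} F \<delta>" "0 < \<delta>"
  shows "cb_bounded {..<M} {..<M} (coeff_comp N enc (coeff_comp N F dec)) \<delta>"
proof -
  have "cb_bounded {..<N} {..<M} (coeff_comp N F dec) (\<delta> * 1)"
    unfolding coeff_comp_def by (rule cb_bounded_comp[OF assms(1) cb_bounded_dec]) simp
  then have "cb_bounded {..<M} {..<M} (coeff_comp N enc (coeff_comp N F dec)) (1 * (\<delta> * 1))"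
    unfolding coeff_comp_def[of N enc] using assms(2) by (intro cb_bounded_comp[OF cb_bounded_enc]) auto
  then show ?thesis by simp
qed

lemma cb_norm_error_le:
  assumes T: "\<And>A. A \<in> carrier_mat N N \<Longrightarrow> T A = coeff_map N N t A"
    and k: "\<And>a b m l. a < M \<Longrightarrow> b < M \<Longrightarrow> m < M \<Longrightarrow> l < M \<Longrightarrow>
      coeff_comp N enc (coeff_comp N t dec) a b m l = id_coeff a b m l + \<kappa> a b m l"
    and cb: "cb_bounded {..<M} {..<M} \<kappa> \<beta>" "0 \<le> \<beta>"
  shows "cb_norm M M (\<lambda>X. coeff_map M N enc (T (coeff_map N M dec X)) - X) \<le> \<beta>"
proof -
  have eq: "coeff_map M N enc (T (coeff_map N M dec X)) - X = coeff_map M M \<kappa> X" if X: "X \<in> carrier_mat M M" for X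
  proof -
    have "coeff_map M N enc (T (coeff_map N M dec X)) = coeff_map M M (coeff_comp N enc (coeff_comp N t dec)) X"
      by (simp add: T coeff_map_comp)
    also have "\<dots> = coeff_map M M (\<lambda>a b m l. id_coeff a b m l + \<kappa> a b m l) X"
      by (rule coeff_map_cong) (rule k)
    also have "\<dots> = coeff_map M M id_coeff X + coeff_map M M \<kappa> X"
      by (intro eq_matI) (auto simp: coeff_map_def sum.distrib[symmetric] distrib_right)
    also have "\<dots> = X + coeff_map M M \<kappa> X" using coeff_map_id_coeff[OF X] by simp
    finally show ?thesis using X by (intro eq_matI) (auto simp: coeff_map_def)
  qed
  have lin: "lin_map M M (\<lambda>X. coeff_map M N enc (T (coeff_map N M dec X)) - X)"
    by (rule lin_map_cong[OF lin_map_coeff_map eq])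
  have "cb_bounded {..<M} {..<M} (map_coeff M (\<lambda>X. coeff_map M N enc (T (coeff_map N M dec X)) - X)) \<beta>"
    using cb(1)
  proof (subst cb_bounded_cong)
    fix r c p q assume "r \<in> {..<M}" "c \<in> {..<M}" "p \<in> {..<M}" "q \<in> {..<M}"
    then show "map_coeff M (\<lambda>X. coeff_map M N enc (T (coeff_map N M dec X)) - X) r c p q = \<kappa> r c p q"
      using map_coeff_coeff_map[of r M c p M q \<kappa>] by (simp add: map_coeff_def eq)
  qed
  then show ?thesis by (rule cb_norm_leI[OF lin _ cb(2)])
qed

end

lemma code_bound:
  assumes d: "prime d" and T: "channel d d T" and M: "0 < M"
    and N1: "card (weyl_labels d n (2 * e)) * d < d ^ n" and N2: "2 * M * card (weyl_labels d n (2 * e)) < d ^ n"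
    and cb: "cb_norm d d (\<lambda>X. X - T X) \<le> \<delta>" and \<delta>: "0 < \<delta>"
  shows "\<exists>E D. channel (d ^ n) M D \<and> channel M (d ^ n) E \<and>
     cb_norm M M (\<lambda>X. E (tensor_pow d T n (D X)) - X) \<le> (\<Sum>S\<in>{S \<in> Pow {..<n}. e < card S}. \<delta> ^ card S)"
proof -
  have d0: "0 < d" using d prime_gt_0_nat by auto
  have lT: "lin_map d d T" using T by (simp add: channel_def)
  obtain G u where "pure_code (d ^ n) M (weyl_labels d n e) (\<lambda>\<sigma> r p. graph_state d n G (u p) \<sigma> r) (zero_label n)"
    using code_exists[OF d M N1 N2] by blast
  then interpret pure_code "d ^ n" M "weyl_labels d n e" "\<lambda>\<sigma> r p. graph_state d n G (u p) \<sigma> r" "zero_label n" .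
  \<comment> \<open>The expansion uses \<open>T = id + \<rho>\<close>, the hypothesis bounds
    \<open>id - T\<close>; cb bounds do not see the sign.\<close>
  define \<rho> where "\<rho> = (\<lambda>r c p q. - map_coeff d (\<lambda>X. X - T X) r c p q)"
  define F where "F = (\<lambda>S. site_tensor d n (\<lambda>i. if i \<in> S then \<rho> else id_coeff))"
  define k where "k = (\<lambda>S. coeff_comp (d ^ n) enc (coeff_comp (d ^ n) (F S) dec))"
  have \<rho>: "map_coeff d T r c p q = \<rho> r c p q + id_coeff r c p q" if "r < d" "c < d" "p < d" "q < d" for r c p q
    using map_coeff_id_minus[OF lT that] by (simp add: \<rho>_def)
  have \<rho>_trace: "(\<Sum>x<d. \<rho> r c x x) = 0" if "r < d" "c < d" for r c
  proof -
    have "(\<Sum>x<d. \<rho> r c x x) = (\<Sum>x<d. map_coeff d T r c x x) - (\<Sum>x<d. id_coeff r c x x)"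
      unfolding sum_subtractf[symmetric] using that by (intro sum.cong refl) (simp add: \<rho>)
    then show ?thesis using map_coeff_trace[OF lT that] id_coeff_trace[OF that(1)] T by (simp add: channel_def)
  qed
  \<comment> \<open>The image of the identity under \<open>F S\<close>. A single site in
    \<open>S\<close> makes it vanish, since \<open>T\<close> and the identity map agree at the
    identity.\<close>
  have F_trace: "(\<Sum>p<d ^ n. F S r c p p) = (if r = c then if S = {} then 1 else 0 else 0)"
    if S: "S \<subseteq> {..<n}" and rc: "r < d ^ n" "c < d ^ n" for S r c
  proof -
    have F1: "(\<Sum>p<d ^ n. F S r c p p) = (\<Prod>i<n. \<Sum>x<d. (if i \<in> S then \<rho> else id_coeff) (digit d r i) (digit d c i) x x)"
      unfolding F_def site_tensor_def by (rule sum_digits)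
    show ?thesis
    proof (cases "S = {}")
      case True
      then show ?thesis unfolding F1 by (simp add: id_coeff_trace digit_less d0 delta_digits[OF rc, symmetric])
    next
      case False
      then obtain i where i: "i \<in> S" by auto
      have "(\<Sum>p<d ^ n. F S r c p p) = 0"
        unfolding F1 by (rule prod_zero) (use i S in \<open>auto simp: \<rho>_trace digit_less d0 intro!: bexI[of _ i]\<close>)
      then show ?thesis using False by simp
    qed
  qed
  have k_small: "k S a b m l = (if S = {} then 1 else 0) * id_coeff a b m l"
    if S: "S \<subseteq> {..<n}" "card S \<le> e" and ab: "a < M" "b < M" "m < M" "l < M" for S a b m l
  proof (rule site_tensor_weyl[OF d0 S, where \<rho>=\<rho>])
    fix J :: "(nat \<Rightarrow> (nat \<times> nat) \<times> (nat \<times> nat)) set" and f \<sigma> \<tau>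
    assume J: "finite J"
      and st: "\<And>j. j \<in> J \<Longrightarrow> \<sigma> j \<in> weyl_labels d n e" "\<And>j. j \<in> J \<Longrightarrow> \<tau> j \<in> weyl_labels d n e"
      and FJ: "\<And>r c p q. site_tensor d n (\<lambda>i. if i \<in> S then \<rho> else id_coeff) r c p q =
       (\<Sum>j\<in>J. f j * (cnj (weyl d n (\<sigma> j) p r) * weyl d n (\<tau> j) q c))"
    show ?thesis
      unfolding k_def
    proof (rule enc_errors_dec_trace[where W="weyl d n" and J=J and f=f and \<sigma>=\<sigma> and \<tau>=\<tau>])
      show "F S r c p q = (\<Sum>j\<in>J. f j * (cnj (weyl d n (\<sigma> j) p r) * weyl d n (\<tau> j) q c))" for r c p q
        unfolding F_def by (rule FJ)
      show "graph_state d n G (u p) s r = (\<Sum>c<d ^ n. weyl d n s r c * graph_state d n G (u p) (zero_label n) c)"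
        if "s \<in> weyl_labels d n e" "r < d ^ n" for s r p
        using weyl_graph_state[OF d0 that(2) weyl_labels_fst_less[OF that(1)]] by simp
      show "(\<Sum>p<d ^ n. F S r c p p) = (if r = c then if S = {} then 1 else 0 else 0)"
        if "r < d ^ n" "c < d ^ n" for r c
        by (rule F_trace[OF S(1) that])
    qed (use J st ab in auto)
  qed
  have cbF: "cb_bounded {..<d ^ n} {..<d ^ n} (F S) (\<delta> ^ card S)" if S: "S \<subseteq> {..<n}" for S
  proof -
    have "cb_bounded {..<d} {..<d} \<rho> \<delta>"
      unfolding \<rho>_def by (rule cb_bounded_uminus, rule cb_bounded_cb_norm[OF lin_map_diff[OF lin_map_id lT] cb])
    then have "cb_bounded {..<d ^ n} {..<d ^ n} (F S) (\<Prod>i<n. if i \<in> S then \<delta> else 1)"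
      unfolding F_def using \<delta> cb_bounded_id_coeff by (intro cb_bounded_site_tensor) auto
    moreover have "(\<Prod>i<n. if i \<in> S then \<delta> else 1) = \<delta> ^ card S"
      using S by (simp add: prod.If_cases Int_absorb1)
    ultimately show ?thesis by simp
  qed
  let ?P = "{S \<in> Pow {..<n}. e < card S}"
  have "cb_norm M M (\<lambda>X. coeff_map M (d ^ n) enc (tensor_pow d T n (coeff_map (d ^ n) M dec X)) - X) \<le> (\<Sum>S\<in>?P. \<delta> ^ card S)"
  proof (rule cb_norm_error_le)
    show "tensor_pow d T n A = coeff_map (d ^ n) (d ^ n) (site_tensor d n (\<lambda>_. map_coeff d T)) A"
      if "A \<in> carrier_mat (d ^ n) (d ^ n)" for A by (rule tensor_pow_coeff_map[OF lT that])
    show "cb_bounded {..<M} {..<M} (\<lambda>a b m l. \<Sum>S\<in>?P. k S a b m l) (\<Sum>S\<in>?P. \<delta> ^ card S)"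
      unfolding k_def using \<delta> cbF by (intro cb_bounded_sum cb_bounded_enc_dec) auto
    show "0 \<le> (\<Sum>S\<in>?P. \<delta> ^ card S)" using \<delta> by (intro sum_nonneg) auto
    fix a b m l assume ab: "a < M" "b < M" "m < M" "l < M"
    have "coeff_comp (d ^ n) enc (coeff_comp (d ^ n) (site_tensor d n (\<lambda>_. map_coeff d T)) dec) a b m l = (\<Sum>S\<in>Pow {..<n}. k S a b m l)"
    proof -
      have "site_tensor d n (\<lambda>_. map_coeff d T) = (\<lambda>r c p q. \<Sum>S\<in>Pow {..<n}. F S r c p q)"
        unfolding F_def by (intro ext site_tensor_expand[OF d0 \<rho>])
      then show ?thesis unfolding k_def by (simp only: coeff_comp_sum)
    qed
    also have "\<dots> = (\<Sum>S\<in>?P. k S a b m l) + (\<Sum>S\<in>Pow {..<n} - ?P. k S a b m l)"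
      by (subst add.commute, rule sum.subset_diff) auto
    \<comment> \<open>Of all correctable sets only the empty one survives, and it yields exactly the
      identity.\<close>
    also have "(\<Sum>S\<in>Pow {..<n} - ?P. k S a b m l) = (\<Sum>S\<in>Pow {..<n} - ?P. if S = {} then id_coeff a b m l else 0)"
    proof (rule sum.cong[OF refl])
      fix S assume "S \<in> Pow {..<n} - ?P"
      then have "S \<subseteq> {..<n}" "card S \<le> e" by auto
      from k_small[OF this ab] show "k S a b m l = (if S = {} then id_coeff a b m l else 0)" by simp
    qed
    also have "\<dots> = id_coeff a b m l" by (subst sum.delta) auto
    finally show "coeff_comp (d ^ n) enc (coeff_comp (d ^ n) (site_tensor d n (\<lambda>_. map_coeff d T)) dec) a b m l = id_coeff a b m l + (\<Sum>S\<in>?P. k S a b m l)"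
      by simp
  qed
  then show ?thesis using dec_channel enc_channel by blast
qed

section \<open>Asymptotics\<close>

text \<open>Take one basis vector as the only codeword and correct nothing. A linear unital map on
  \<open>1 \<times> 1\<close> matrices is the identity.\<close>

lemma rate_zero_exists:
  assumes d: "0 < d" and T: "channel d d T"
  shows "\<exists>E D. channel (d ^ n) 1 D \<and> channel 1 (d ^ n) E \<and>
     cb_norm 1 1 (\<lambda>X. E (tensor_pow d T n (D X)) - X) \<le> 0"
proof -
  have lT: "lin_map d d T" using T by (simp add: channel_def)
  let ?K = "\<lambda>(s::unit) (r::nat) (p::nat). if r = 0 then 1 else 0 :: complex"
  interpret pure_code "d ^ n" 1 "{()}" ?K "()"
  proof
    have "(\<Sum>r<d ^ n. cnj (?K () r 0) * ?K () r 0) = (\<Sum>r<d ^ n. if r = 0 then 1 else 0)"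
      by (intro sum.cong refl) auto
    also have "\<dots> = 1" using d by simp
    finally show "(\<Sum>r<d ^ n. cnj (?K s r p) * ?K t r q) = (if s = t \<and> p = q then 1 else 0)"
      if "p < 1" "q < 1" for s t and p q :: nat using that by simp
  qed auto
  let ?t = "site_tensor d n (\<lambda>_. map_coeff d T)"
  have tr: "(\<Sum>p<d ^ n. ?t r c p p) = (if r = c then 1 else 0)" if rc: "r < d ^ n" "c < d ^ n" for r c
  proof -
    have "(\<Sum>p<d ^ n. ?t r c p p) = (\<Prod>i<n. \<Sum>x<d. map_coeff d T (digit d r i) (digit d c i) x x)"
      unfolding site_tensor_def by (rule sum_digits)
    also have "\<dots> = (\<Prod>i<n. if digit d r i = digit d c i then 1 else 0)"
      using T d by (intro prod.cong refl map_coeff_trace[OF lT]) (auto simp: channel_def digit_less)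
    finally show ?thesis by (simp only: delta_digits[OF rc])
  qed
  have "cb_norm 1 1 (\<lambda>X. coeff_map 1 (d ^ n) enc (tensor_pow d T n (coeff_map (d ^ n) 1 dec X)) - X) \<le> 0"
  proof (rule cb_norm_error_le)
    show "tensor_pow d T n A = coeff_map (d ^ n) (d ^ n) ?t A"
      if "A \<in> carrier_mat (d ^ n) (d ^ n)" for A by (rule tensor_pow_coeff_map[OF lT that])
    \<comment> \<open>The zero remainder is written as an empty sum, so that
      \<open>cb_bounded_sum\<close> yields the bound 0.\<close>
    show "cb_bounded {..<1::nat} {..<1::nat} (\<lambda>a b m l. \<Sum>S\<in>({}::nat set). 0) 0"
      using cb_bounded_sum[of "{}::nat set" "{..<1::nat}" "{..<1::nat}" "\<lambda>_ _ _ _ _. 0" "\<lambda>_. 0"] by simp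
    fix a b m l :: nat assume "a < 1" "b < 1" "m < 1" "l < 1"
    then show "coeff_comp (d ^ n) enc (coeff_comp (d ^ n) ?t dec) a b m l = id_coeff a b m l + (\<Sum>S\<in>({}::nat set). 0)"
      using trace_enc_dec_unital[where F="?t" and \<kappa>=1 and a=0 and b=0, OF tr] by (simp add: id_coeff_def)
  qed simp
  then show ?thesis using dec_channel enc_channel by blast
qed

text \<open>Some rate must be achievable, since the supremum of the empty set in
  \<open>ereal\<close> is minus infinity. This settles a non-positive claimed bound.\<close>

lemma achievable_zero:
  assumes d: "0 < d" and T: "channel d d T"
  shows "achievable_rate d T 0"
proof -
  have lT: "lin_map d d T" using T by (simp add: channel_def)
  have "Delta (d ^ n) (d ^ n) (tensor_pow d T n) 1 = 0" for n
  proof -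
    obtain E D where "channel (d ^ n) 1 D" "channel 1 (d ^ n) E" "cb_norm 1 1 (\<lambda>X. E (tensor_pow d T n (D X)) - X) \<le> 0"
      using rate_zero_exists[OF assms] by blast
    from Delta_bounds[OF lin_map_tensor_pow[OF lT] this] show ?thesis by simp
  qed
  then show ?thesis by (simp add: achievable_rate_def)
qed

section \<open>Chernoff bounds for subsets\<close>

lemma sum_Pow_power_card:
  fixes x :: real
  shows "(\<Sum>U\<in>Pow {..<n}. x ^ card U) = (1 + x) ^ n"
  using prod_add[of "{..<n}" "\<lambda>_. x" "\<lambda>_. 1"] by (simp add: add.commute)

text \<open>The Chernoff expression at its optimal parameter \<open>\<mu> / (1 - \<mu>)\<close>;
  both subset estimates below end in it.\<close>

lemma entropy_identity:
  assumes "0 < \<mu>" "\<mu> < 1"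
  shows "(1 + \<mu> / (1 - \<mu>)) ^ n * (\<mu> / (1 - \<mu>)) powr (- (\<mu> * real n)) = 2 powr (real n * H2 \<mu>)"
proof -
  have "1 + \<mu> / (1 - \<mu>) = inverse (1 - \<mu>)"
    using assms by (simp add: field_simps)
  then have "(1 + \<mu> / (1 - \<mu>)) ^ n = (1 - \<mu>) powr (- real n)"
    using assms by (simp add: power_inverse powr_minus powr_realpow)
  also have "\<dots> = 2 powr (- real n * log 2 (1 - \<mu>))"
    using assms by (simp add: powr_def log_def)
  finally have 1: "(1 + \<mu> / (1 - \<mu>)) ^ n = 2 powr (- real n * log 2 (1 - \<mu>))" .
  have 2: "(\<mu> / (1 - \<mu>)) powr (- (\<mu> * real n)) = 2 powr (- (\<mu> * real n) * (log 2 \<mu> - log 2 (1 - \<mu>)))"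
    using assms by (simp add: powr_def log_def ln_div diff_divide_distrib[symmetric])
  show ?thesis
    unfolding 1 2 powr_add[symmetric] H2_def by (simp add: algebra_simps)
qed

text \<open>\<open>\<mu> \<le> 1/2\<close> gives \<open>l \<le> 1\<close>, so \<open>l\<close> to
  the power \<open>card U - \<mu> * n\<close>, an exponent that is not positive, is at least 1 for
  every counted set.\<close>

lemma card_small_subsets:
  assumes \<mu>: "0 < \<mu>" "\<mu> \<le> 1/2" and w: "real w \<le> \<mu> * real n"
  shows "real (card {U \<in> Pow {..<n}. card U \<le> w}) \<le> 2 powr (real n * H2 \<mu>)"
proof -
  \<comment> \<open>the Chernoff parameter that minimises \<open>(1 + l) ^ n * l powr (- \<mu> n)\<close>\<close>
  define l where "l = \<mu> / (1 - \<mu>)"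
  have l: "0 < l" "l \<le> 1" using \<mu> by (auto simp: l_def)
  have "real (card {U \<in> Pow {..<n}. card U \<le> w}) = (\<Sum>U\<in>{U \<in> Pow {..<n}. card U \<le> w}. 1)" by simp
  also have "\<dots> \<le> (\<Sum>U\<in>{U \<in> Pow {..<n}. card U \<le> w}. l ^ card U * l powr (- (\<mu> * real n)))"
  proof (rule sum_mono)
    fix U assume "U \<in> {U \<in> Pow {..<n}. card U \<le> w}"
    then have "real (card U) \<le> \<mu> * real n" using w by auto
    then have "1 \<le> l powr (real (card U) - \<mu> * real n)"
      using l by (metis diff_le_0_iff_le powr_mono' powr_zero_eq_one less_le order_less_irrefl)
    then show "1 \<le> l ^ card U * l powr (- (\<mu> * real n))"
      using l by (simp add: powr_realpow[symmetric] powr_add[symmetric])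
  qed
  also have "\<dots> \<le> (\<Sum>U\<in>Pow {..<n}. l ^ card U * l powr (- (\<mu> * real n)))"
    using l by (intro sum_mono2) auto
  also have "\<dots> = (1 + l) ^ n * l powr (- (\<mu> * real n))"
    by (simp add: sum_distrib_right[symmetric] sum_Pow_power_card)
  also have "\<dots> = 2 powr (real n * H2 \<mu>)"
    unfolding l_def using \<mu> by (intro entropy_identity) auto
  finally show ?thesis .
qed

text \<open>The same parameter in the other direction: \<open>l / \<delta>\<close> is at least 1, so
  its power \<open>card S - \<epsilon> * n\<close> is at least 1 for every large \<open>S\<close>.
  This trades \<open>\<delta> ^ card S\<close> for \<open>l ^ card S\<close> times a factor
  independent of \<open>S\<close>.\<close>

lemma sum_large_subsets:
  assumes \<epsilon>: "0 < \<epsilon>" "\<epsilon> < 1" and \<delta>: "0 < \<delta>" "\<delta> \<le> \<epsilon> / (1 - \<epsilon>)" and e: "\<epsilon> * real n \<le> real e + 1"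
  shows "(\<Sum>S\<in>{S \<in> Pow {..<n}. e < card S}. \<delta> ^ card S) \<le> (2 powr H2 \<epsilon> * \<delta> powr \<epsilon>) ^ n"
proof -
  define l where "l = \<epsilon> / (1 - \<epsilon>)"
  have "0 < l" using \<epsilon> by (simp add: l_def)
  moreover have "1 \<le> l / \<delta>" using \<delta> unfolding l_def[symmetric] by simp
  ultimately have l: "0 < l" "1 \<le> l / \<delta>" .
  have "(\<Sum>S\<in>{S \<in> Pow {..<n}. e < card S}. \<delta> ^ card S) \<le> (\<Sum>S\<in>{S \<in> Pow {..<n}. e < card S}. l ^ card S * (l powr (- (\<epsilon> * real n)) * \<delta> powr (\<epsilon> * real n)))"
  proof (rule sum_mono)
    fix S assume "S \<in> {S \<in> Pow {..<n}. e < card S}"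
    \<comment> \<open>\<open>e\<close> is \<open>\<epsilon> * n\<close> rounded down, but
      \<open>card S > e\<close> means \<open>card S \<ge> e + 1\<close>.\<close>
    then have "\<epsilon> * real n \<le> real (card S)" using e by auto
    then have "1 \<le> (l / \<delta>) powr (real (card S) - \<epsilon> * real n)"
      using l by (intro ge_one_powr_ge_zero) auto
    also have "\<dots> = l ^ card S * l powr (- (\<epsilon> * real n)) * \<delta> powr (\<epsilon> * real n) / \<delta> ^ card S"
      using l(1) \<delta>(1) by (simp add: powr_divide powr_diff powr_realpow powr_minus field_simps)
    finally show "\<delta> ^ card S \<le> l ^ card S * (l powr (- (\<epsilon> * real n)) * \<delta> powr (\<epsilon> * real n))"
      using \<delta>(1) by (simp add: field_simps)
  qed
  also have "\<dots> \<le> (\<Sum>S\<in>Pow {..<n}. l ^ card S * (l powr (- (\<epsilon> * real n)) * \<delta> powr (\<epsilon> * real n)))"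
    using l by (intro sum_mono2) auto
  also have "\<dots> = (1 + l) ^ n * l powr (- (\<epsilon> * real n)) * \<delta> powr (\<epsilon> * real n)"
    by (simp add: sum_distrib_right[symmetric] sum_Pow_power_card mult.assoc)
  also have "(1 + l) ^ n * l powr (- (\<epsilon> * real n)) = 2 powr (real n * H2 \<epsilon>)"
    unfolding l_def using \<epsilon> by (intro entropy_identity) auto
  also have "2 powr (real n * H2 \<epsilon>) * \<delta> powr (\<epsilon> * real n) = (2 powr H2 \<epsilon> * \<delta> powr \<epsilon>) ^ n"
    using \<delta> by (simp add: power_mult_distrib powr_realpow[symmetric] powr_powr mult.commute)
  finally show ?thesis .
qed

section \<open>The number of Weyl labels\<close>

lemma card_weyl_labels_le:
  "card (weyl_labels d n w) \<le> card {U \<in> Pow {..<n}. card U \<le> w} * (d * d) ^ w" if d: "0 < d"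
proof -
  let ?V = "\<lambda>U. PiE {..<n} (\<lambda>i. if i \<in> U then {..<d} \<times> {..<d} else {(0,0)})"
  have "weyl_labels d n w \<subseteq> (\<Union>U\<in>{U \<in> Pow {..<n}. card U \<le> w}. ?V U)"
  proof
    fix \<sigma> assume s: "\<sigma> \<in> weyl_labels d n w"
    let ?U = "{i. i < n \<and> \<sigma> i \<noteq> (0,0)}"
    have "?U \<in> {U \<in> Pow {..<n}. card U \<le> w}" using s by (auto simp: weyl_labels_def)
    moreover have "\<sigma> \<in> ?V ?U" using s by (auto simp: weyl_labels_def PiE_iff)
    ultimately show "\<sigma> \<in> (\<Union>U\<in>{U \<in> Pow {..<n}. card U \<le> w}. ?V U)" by blast
  qed
  then have "card (weyl_labels d n w) \<le> card (\<Union>U\<in>{U \<in> Pow {..<n}. card U \<le> w}. ?V U)"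
    by (rule card_mono[rotated]) (auto intro!: finite_PiE)
  also have "\<dots> \<le> (\<Sum>U\<in>{U \<in> Pow {..<n}. card U \<le> w}. card (?V U))"
    by (rule card_UN_le) auto
  also have "\<dots> \<le> (\<Sum>U\<in>{U \<in> Pow {..<n}. card U \<le> w}. (d * d) ^ w)"
  proof (rule sum_mono)
    fix U assume U: "U \<in> {U \<in> Pow {..<n}. card U \<le> w}"
    have "card (?V U) = (\<Prod>i<n. if i \<in> U then d * d else 1)"
      by (simp add: card_PiE if_distrib[of card] card_cartesian_product cong: if_cong)
    also have "\<dots> = (d * d) ^ card U" using U by (simp add: prod.If_cases Int_absorb1)
    also have "\<dots> \<le> (d * d) ^ w" using U d by (intro power_increasing) auto
    finally show "card (?V U) \<le> (d * d) ^ w" .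
  qed
  finally show ?thesis by simp
qed

lemma card_weyl_labels_bound:
  assumes d: "0 < d" and \<epsilon>: "0 < \<epsilon>" "\<epsilon> \<le> 1/4" and e: "real e \<le> \<epsilon> * real n"
  shows "real (card (weyl_labels d n (2 * e))) \<le> 2 powr (real n * (4 * \<epsilon> * log 2 (real d) + H2 (2 * \<epsilon>)))"
proof -
  have "real (card (weyl_labels d n (2 * e))) \<le> real (card {U \<in> Pow {..<n}. card U \<le> 2 * e}) * real ((d * d) ^ (2 * e))"
    using card_weyl_labels_le[OF d, of n "2 * e"] by (simp only: of_nat_mult[symmetric] of_nat_le_iff)
  also have "\<dots> \<le> 2 powr (real n * H2 (2 * \<epsilon>)) * 2 powr (real n * (4 * \<epsilon> * log 2 (real d)))"
  proof (rule mult_mono)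
    show "real (card {U \<in> Pow {..<n}. card U \<le> 2 * e}) \<le> 2 powr (real n * H2 (2 * \<epsilon>))"
      by (rule card_small_subsets) (use \<epsilon> e in auto)
    have "real ((d * d) ^ (2 * e)) = real d powr (4 * real e)"
    proof -
      have "(d * d) ^ (2 * e) = d ^ (4 * e)"
        by (simp add: power2_eq_square[symmetric] power_mult[symmetric])
      then show ?thesis using d by (simp add: powr_realpow[symmetric])
    qed
    also have "\<dots> \<le> real d powr (4 * (\<epsilon> * real n))"
      using d e by (intro powr_mono) auto
    also have "\<dots> = 2 powr (real n * (4 * \<epsilon> * log 2 (real d)))"
      using d by (simp add: powr_def log_def)
    finally show "real ((d * d) ^ (2 * e)) \<le> 2 powr (real n * (4 * \<epsilon> * log 2 (real d)))" .
  qed auto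
  finally show ?thesis by (simp add: powr_add[symmetric] algebra_simps)
qed

section \<open>Choice of parameters\<close>

lemma H2_nonneg:
  assumes "0 < x" "x < 1" shows "0 \<le> H2 x"
  using assms mult_nonneg_nonpos[of x "log 2 x"] mult_nonneg_nonpos[of "1 - x" "log 2 (1 - x)"]
  by (simp add: H2_def)

lemma achievable_rate_below:
  assumes d: "prime d" and T: "channel d d T" and \<epsilon>: "0 < \<epsilon>" "\<epsilon> < 1/2"
    and cb: "cb_norm d d (\<lambda>X. X - T X) < 2 powr (- H2 \<epsilon> / \<epsilon>)"
    and c: "0 \<le> c" "c < (1 - 4 * \<epsilon>) * log 2 (real d) - H2 (2 * \<epsilon>)"
  shows "achievable_rate d T c"
proof -
  have d2: "2 \<le> d" using d by (rule prime_ge_2_nat)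
  have lT: "lin_map d d T" using T by (simp add: channel_def)
  have logd: "0 < log 2 (real d)" using d2 by simp
  \<comment> \<open>For larger \<open>\<epsilon>\<close> the bound on \<open>c\<close> would not be
    positive. The label count needs \<open>2 * \<epsilon> \<le> 1/2\<close>.\<close>
  have \<epsilon>4: "\<epsilon> < 1/4"
  proof (rule ccontr)
    assume "\<not> \<epsilon> < 1/4"
    then have "(1 - 4 * \<epsilon>) * log 2 (real d) \<le> 0" using logd by (intro mult_nonpos_nonneg) auto
    moreover have "0 \<le> H2 (2 * \<epsilon>)" using \<epsilon> by (intro H2_nonneg) auto
    ultimately show False using c by linarith
  qed
  define B where "B = 2 powr (- H2 \<epsilon> / \<epsilon>)"
  \<comment> \<open>The midpoint is still strictly below \<open>B\<close>, and it is positive even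
    when \<open>T\<close> is the identity.\<close>
  define \<delta> where "\<delta> = (cb_norm d d (\<lambda>X. X - T X) + B) / 2"
  have cb0: "0 \<le> cb_norm d d (\<lambda>X. X - T X)"
    by (rule cb_norm_nonneg[OF lin_map_diff[OF lin_map_id lT]])
  have B0: "0 < B" by (simp add: B_def)
  have \<delta>: "0 < \<delta>" "\<delta> < B" "cb_norm d d (\<lambda>X. X - T X) \<le> \<delta>"
    using cb[folded B_def] cb0 B0 by (auto simp: \<delta>_def)
  \<comment> \<open>Since \<open>H2 \<epsilon>\<close> is at least
    \<open>- \<epsilon> * log 2 \<epsilon>\<close>. With this, \<open>\<delta>\<close> does not
    exceed the Chernoff parameter \<open>\<epsilon> / (1 - \<epsilon>)\<close>.\<close>
  have "B \<le> \<epsilon>"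
  proof -
    have "(1 - \<epsilon>) * log 2 (1 - \<epsilon>) \<le> 0" using \<epsilon> by (intro mult_nonneg_nonpos) auto
    then have "- H2 \<epsilon> \<le> log 2 \<epsilon> * \<epsilon>" by (simp add: H2_def mult.commute)
    then have "- H2 \<epsilon> / \<epsilon> \<le> log 2 \<epsilon>" by (simp only: pos_divide_le_eq[OF \<epsilon>(1)])
    then have "B \<le> 2 powr (log 2 \<epsilon>)" unfolding B_def by (intro powr_mono) auto
    then show ?thesis using \<epsilon> by simp
  qed
  moreover have "\<epsilon> \<le> \<epsilon> / (1 - \<epsilon>)" using \<epsilon> by (simp add: field_simps)
  ultimately have \<delta>\<epsilon>: "\<delta> \<le> \<epsilon> / (1 - \<epsilon>)" using \<delta>(2) by linarith
  define \<gamma> where "\<gamma> = 2 powr H2 \<epsilon> * \<delta> powr \<epsilon>"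
  have \<gamma>: "0 \<le> \<gamma>" "\<gamma> < 1"
  proof -
    show "0 \<le> \<gamma>" by (simp add: \<gamma>_def)
    have "\<delta> powr \<epsilon> < B powr \<epsilon>" using \<delta> \<epsilon> by (intro powr_less_mono2) auto
    also have "\<dots> = 2 powr (- H2 \<epsilon>)" using \<epsilon> by (simp add: B_def powr_powr)
    finally have "\<gamma> < 2 powr H2 \<epsilon> * 2 powr (- H2 \<epsilon>)" unfolding \<gamma>_def by simp
    then show "\<gamma> < 1" by (simp add: powr_add[symmetric])
  qed
  define h where "h = 4 * \<epsilon> * log 2 (real d) + H2 (2 * \<epsilon>)"
  \<comment> \<open>The slack in the rate. Once \<open>n * g\<close> exceeds both 1 and
    \<open>log 2 d\<close>, it absorbs the factor 2 of the greedy choice and the factor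
    \<open>d\<close> of the graph count.\<close>
  define g where "g = log 2 (real d) - h - c"
  have g: "0 < g" using c(2) by (simp add: g_def h_def algebra_simps)
  define M where "M = (\<lambda>n. nat \<lfloor>2 powr (c * real n)\<rfloor>)"
  have bounds: "0 \<le> Delta (d ^ n) (d ^ n) (tensor_pow d T n) (M n) \<and> Delta (d ^ n) (d ^ n) (tensor_pow d T n) (M n) \<le> \<gamma> ^ n"
    if n: "real n > max (1 / g) (log 2 (real d) / g)" for n
  proof -
    have n1: "1 < real n * g" "log 2 (real d) < real n * g" using n g by (auto simp: field_simps)
    define e where "e = nat \<lfloor>\<epsilon> * real n\<rfloor>"
    have e: "real e \<le> \<epsilon> * real n" "\<epsilon> * real n \<le> real e + 1"
      using \<epsilon> by (auto simp: e_def intro: less_imp_le)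
    have N: "real (card (weyl_labels d n (2 * e))) \<le> 2 powr (real n * h)"
      unfolding h_def using d2 \<epsilon> \<epsilon>4 e by (intro card_weyl_labels_bound) auto
    have dn: "real (d ^ n) = 2 powr (real n * log 2 (real d))"
      using d2 by (simp add: powr_def log_def ln_realpow[symmetric])
    have cn: "0 \<le> c * real n" using c by simp
    have M1: "1 \<le> M n"
    proof -
      have "1 \<le> 2 powr (c * real n)" using cn by (simp add: ge_one_powr_ge_zero)
      then have "1 \<le> \<lfloor>2 powr (c * real n)\<rfloor>" by (simp add: le_floor_iff)
      then show ?thesis unfolding M_def by linarith
    qed
    have M2: "real (M n) \<le> 2 powr (c * real n)"
      by (simp add: M_def)
    have "real (card (weyl_labels d n (2 * e)) * d) \<le> 2 powr (real n * h) * 2 powr (log 2 (real d))"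
      using N d2 by (simp add: mult_right_mono)
    also have "\<dots> = 2 powr (real n * h + log 2 (real d))" by (simp add: powr_add)
    also have "\<dots> < 2 powr (real n * log 2 (real d))"
    proof (rule powr_less_mono)
      have "real n * log 2 (real d) = real n * g + real n * h + c * real n" by (simp add: g_def algebra_simps)
      then show "real n * h + log 2 (real d) < real n * log 2 (real d)" using n1 cn by linarith
    qed simp
    finally have N1: "card (weyl_labels d n (2 * e)) * d < d ^ n" unfolding dn[symmetric] of_nat_less_iff .
    have "real (2 * M n * card (weyl_labels d n (2 * e))) \<le> 2 * 2 powr (c * real n) * 2 powr (real n * h)"
      using N M2 by (simp add: mult_mono)
    also have "\<dots> = 2 powr (1 + c * real n + real n * h)" by (simp add: powr_add)
    also have "\<dots> < 2 powr (real n * log 2 (real d))"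
    proof (rule powr_less_mono)
      have "real n * log 2 (real d) = real n * g + real n * h + c * real n" by (simp add: g_def algebra_simps)
      then show "1 + c * real n + real n * h < real n * log 2 (real d)" using n1 by linarith
    qed simp
    finally have N2: "2 * M n * card (weyl_labels d n (2 * e)) < d ^ n" unfolding dn[symmetric] of_nat_less_iff .
    have "0 < M n" using M1 by simp
    from code_bound[OF d T this N1 N2 \<delta>(3,1)]
    obtain E D where ED: "channel (d ^ n) (M n) D" "channel (M n) (d ^ n) E"
      "cb_norm (M n) (M n) (\<lambda>X. E (tensor_pow d T n (D X)) - X) \<le> (\<Sum>S\<in>{S \<in> Pow {..<n}. e < card S}. \<delta> ^ card S)"
      by blast
    have "(\<Sum>S\<in>{S \<in> Pow {..<n}. e < card S}. \<delta> ^ card S) \<le> \<gamma> ^ n"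
      unfolding \<gamma>_def using \<epsilon> \<delta> \<delta>\<epsilon> e by (intro sum_large_subsets) auto
    with ED(3) have "cb_norm (M n) (M n) (\<lambda>X. E (tensor_pow d T n (D X)) - X) \<le> \<gamma> ^ n" by linarith
    from Delta_bounds[OF lin_map_tensor_pow[OF lT] ED(1,2) this] show ?thesis by simp
  qed
  have ev: "\<forall>\<^sub>F n in sequentially. real n > max (1 / g) (log 2 (real d) / g)"
    using filterlim_real_sequentially unfolding filterlim_at_top_dense by (rule spec)
  have "(\<lambda>n. Delta (d ^ n) (d ^ n) (tensor_pow d T n) (M n)) \<longlonglongrightarrow> 0"
  proof (rule tendsto_sandwich[of "\<lambda>_. 0" _ _ "\<lambda>n. \<gamma> ^ n"])
    show "\<forall>\<^sub>F n in sequentially. 0 \<le> Delta (d ^ n) (d ^ n) (tensor_pow d T n) (M n)"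
      using ev by (rule eventually_mono) (use bounds in blast)
    show "\<forall>\<^sub>F n in sequentially. Delta (d ^ n) (d ^ n) (tensor_pow d T n) (M n) \<le> \<gamma> ^ n"
      using ev by (rule eventually_mono) (use bounds in blast)
    show "(\<lambda>n. \<gamma> ^ n) \<longlonglongrightarrow> 0" by (rule LIMSEQ_realpow_zero[OF \<gamma>])
  qed simp
  then show ?thesis using c(1) by (simp add: achievable_rate_def M_def)
qed

theorem theorem1:
  fixes d :: nat and T :: "complex mat \<Rightarrow> complex mat" and \<epsilon> :: real
  assumes "prime d"
    and "channel d d T"
    and "0 < \<epsilon>" and "\<epsilon> < 1/2"
    and "cb_norm d d (\<lambda>X. X - T X) < 2 powr (- H2 \<epsilon> / \<epsilon>)"
  shows "quantum_capacity d T \<ge> ereal ((1 - 4 * \<epsilon>) * log 2 (real d) - H2 (2 * \<epsilon>))"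
proof -
  define R where "R = (1 - 4 * \<epsilon>) * log 2 (real d) - H2 (2 * \<epsilon>)"
  have le: "ereal c \<le> quantum_capacity d T" if "achievable_rate d T c" for c
    unfolding quantum_capacity_def using that by (intro Sup_upper) auto
  have "0 < d" using assms(1) prime_gt_0_nat by auto
  then have zero: "ereal 0 \<le> quantum_capacity d T"
    by (rule le[OF achievable_zero[OF _ assms(2)]])
  show ?thesis
  proof (rule ccontr)
    assume "\<not> ?thesis"
    then have lt: "quantum_capacity d T < ereal R" by (simp add: R_def)
    then obtain q where q: "quantum_capacity d T = ereal q" "0 \<le> q" "q < R"
      using zero by (cases "quantum_capacity d T") auto
    \<comment> \<open>Only rates strictly below \<open>R\<close> are known to be achievable, so the
      midpoint of \<open>q\<close> and \<open>R\<close> is used; it is non-negative because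
      \<open>q\<close> is.\<close>
    have "achievable_rate d T ((q + R) / 2)"
      by (rule achievable_rate_below[OF assms]) (use q in \<open>simp_all flip: R_def\<close>)
    from le[OF this] have "(q + R) / 2 \<le> q" using q(1) by simp
    with q show False by simp
  qed
qed

end
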